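(* Let $(\gamma_+,\gamma_-)$ be an angularly regular parallel pair of cooriented frontal germs in $\mathbb{R}^2$ with common angular parameter $u$ near $0$, so that $\gamma_+'(u)=\rho_+(u)\mathbf e(u)$ and $\gamma_-'(u)=-\rho_-(u)\mathbf e(u)$, with $\gamma_+(0)\neq\gamma_-(0)$. Put $\Delta_\rho=\rho_+-\rho_-$ and let $\mathrm E_{1/2}(u)=\frac12(\gamma_+(u)+\gamma_-(u))$ be the local Wigner caustic branch. Then $$\mathrm E_{1/2}'(u)=\frac{\Delta_\rho(u)}{2}\,\mathbf e(u),$$ and $\mathrm E_{1/2}$ is a front, including at every singular point. Moreover: (i) $\mathrm E_{1/2}$ is regular at $0$ if and only if $\Delta_\rho(0)\ne0$; (ii) $\mathrm E_{1/2}$ is a $3/2$-cusp at $0$ if and only if $\Delta_\rho(0)=0$ and $\Delta_\rho'(0)\ne0$; (iii) $\mathrm E_{1/2}$ is a $4/3$-cusp at $0$ if and only if $\Delta_\rho(0)=\Delta_\rho'(0)=0$ and $\Delta_\rho''(0)\ne0$; (iv) if $\Delta_\rho(0)=\Delta_\rho'(0)=\Delta_\rho''(0)=0$ and $\Delta_\rho'''(0)\ne0$, then $\mathrm E_{1/2}$ is $C^1$-equivalent to a $5/4$-cusp; (v) under the conditions in (iv), put $$Q_{\mathrm E_{1/2}}=35\,\Delta_\rho^{(4)}(0)^2-48\,\Delta_\rho'''(0)\Delta_\rho^{(5)}(0)+2400\,\Delta_\rho'''(0)^2 .$$ Then $\mathrm E_{1/2}$ is a $5/4$-cusp, a $(5/4;+7)$-cusp,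 or a $(5/4;-7)$-cusp according as $Q_{\mathrm E_{1/2}}$ is zero, positive, or negative, respectively.
   Context: All maps are $C^\infty$ germs unless stated otherwise. A smooth germ $\gamma:(\mathbb R,0)\to\mathbb R^2$ is a cooriented frontal if it has a smooth unit normal field $\mathbf n$ with $\gamma'\cdot\mathbf n=0$; choosing the unit tangent field $\mathbf e$ so that $(\mathbf e,\mathbf n)$ is positively oriented, one has $\gamma'(t)=\ell(t)\mathbf e(t)$, $\mathbf e=(\cos\theta,\sin\theta)$, $\mathbf n=(-\sin\theta,\cos\theta)$ with smooth $\ell,\theta$. It is a front if $(\gamma,\mathbf n)$ is an immersion, equivalently $(\ell,\theta')\neq(0,0)$; it is angularly regular if $\theta'\neq0$. Angularly regular parallel pair: two angularly regular cooriented frontal germs $\gamma_\pm$ whose tangent lines at the base points are parallel, the tangent lifts being chosen opposite at the base points. By the inverse function theorem both are parametrised by a common angular parameter $u$ near $0$, with $\gamma_+'(u)=\rho_+(u)\mathbf e(u)$ and $\gamma_-'(u)=-\rho_-(u)\mathbf e(u)$, where $\mathbf e(u)=(\cos(u+\theta_0),\sin(u+\theta_0))$ for a constant $\theta_0$, $\mathbf n=\mathbf e'$, and $\rho_\pm$ are smooth functions (the extended signed radii of curvature, possibly vanishing). Prime denotes $d/du$. Two germs $(\mathbb R,0)\to\mathbb R^2$ are $\mathcal A$-equivalent if they differ by smooth diffeomorphism germs in source and target, and $C^1$-equivalent if they differ by $C^1$ diffeomorphism germs. A $3/2$-, $4/3$-, $5/4$-, $(5/4;\pm7)$-cusp is a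 germ $\mathcal A$-equivalent to $t\mapsto(t^2,t^3)$, $(t^3,t^4)$, $(t^4,t^5)$, $(t^4,t^5\pm t^7)$, respectively; "$C^1$-equivalent to a $5/4$-cusp" means $C^1$-equivalent to $t\mapsto(t^4,t^5)$. *)

theory Defs
  imports "HOL-Analysis.Analysis" "HOL-Library.Extended_Nat"
begin

section \<open>Maps of class \<open>C\<^sup>k\<close> and germs\<close>

text \<open>On an open subset of a Euclidean space, being \<open>n\<close> times continuously differentiable is
  expressed through iterated directional derivatives.\<close>

primrec times_cont_diff_on ::
    "nat \<Rightarrow> 'a::euclidean_space set \<Rightarrow> ('a \<Rightarrow> 'b::real_normed_vector) \<Rightarrow> bool" where
  "times_cont_diff_on 0 S f \<longleftrightarrow> continuous_on S f"
| "times_cont_diff_on (Suc n) S f \<longleftrightarrow>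
     (\<forall>x\<in>S. f differentiable (at x)) \<and>
     (\<forall>v. times_cont_diff_on n S (\<lambda>x. frechet_derivative f (at x) v))"

definition Ck_on ::
    "enat \<Rightarrow> 'a::euclidean_space set \<Rightarrow> ('a \<Rightarrow> 'b::real_normed_vector) \<Rightarrow> bool" where
  "Ck_on k S f \<longleftrightarrow> (\<forall>n. enat n \<le> k \<longrightarrow> times_cont_diff_on n S f)"

text \<open>Germs at \<open>0\<close> are represented by total functions, and only their values near \<open>0\<close> matter.\<close>

definition smooth_germ :: "(real \<Rightarrow> 'b::real_normed_vector) \<Rightarrow> bool" where
  "smooth_germ f \<longleftrightarrow> (\<exists>U. open U \<and> 0 \<in> U \<and> Ck_on \<infinity> U f)"

definition Ck_diffeo_germ ::
    "enat \<Rightarrow> ('a::euclidean_space \<Rightarrow> 'b::euclidean_space) \<Rightarrow> 'a \<Rightarrow> 'b \<Rightarrow> bool" where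
  "Ck_diffeo_germ k f a b \<longleftrightarrow>
     f a = b \<and>
     (\<exists>U V g. open U \<and> open V \<and> a \<in> U \<and> homeomorphism U V f g \<and> Ck_on k U f \<and> Ck_on k V g)"

definition Ck_equivalent :: "enat \<Rightarrow> (real \<Rightarrow> real \<times> real) \<Rightarrow> (real \<Rightarrow> real \<times> real) \<Rightarrow> bool" where
  "Ck_equivalent k \<gamma> \<delta> \<longleftrightarrow>
     (\<exists>\<phi> \<Phi>. Ck_diffeo_germ k \<phi> 0 0 \<and> Ck_diffeo_germ k \<Phi> (\<gamma> 0) (\<delta> 0) \<and>
            (\<forall>\<^sub>F t in nhds 0. \<delta> (\<phi> t) = \<Phi> (\<gamma> t)))"

definition A_equivalent :: "(real \<Rightarrow> real \<times> real) \<Rightarrow> (real \<Rightarrow> real \<times> real) \<Rightarrow> bool" where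
  "A_equivalent \<gamma> \<delta> \<longleftrightarrow> Ck_equivalent \<infinity> \<gamma> \<delta>"

definition C1_equivalent :: "(real \<Rightarrow> real \<times> real) \<Rightarrow> (real \<Rightarrow> real \<times> real) \<Rightarrow> bool" where
  "C1_equivalent \<gamma> \<delta> \<longleftrightarrow> Ck_equivalent 1 \<gamma> \<delta>"

section \<open>Cusps\<close>

definition is_3_2_cusp :: "(real \<Rightarrow> real \<times> real) \<Rightarrow> bool" where
  "is_3_2_cusp \<gamma> \<longleftrightarrow> A_equivalent \<gamma> (\<lambda>t. (t ^ 2, t ^ 3))"

definition is_4_3_cusp :: "(real \<Rightarrow> real \<times> real) \<Rightarrow> bool" where
  "is_4_3_cusp \<gamma> \<longleftrightarrow> A_equivalent \<gamma> (\<lambda>t. (t ^ 3, t ^ 4))"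

definition is_5_4_cusp :: "(real \<Rightarrow> real \<times> real) \<Rightarrow> bool" where
  "is_5_4_cusp \<gamma> \<longleftrightarrow> A_equivalent \<gamma> (\<lambda>t. (t ^ 4, t ^ 5))"

definition is_5_4_plus_7_cusp :: "(real \<Rightarrow> real \<times> real) \<Rightarrow> bool" where
  "is_5_4_plus_7_cusp \<gamma> \<longleftrightarrow> A_equivalent \<gamma> (\<lambda>t. (t ^ 4, t ^ 5 + t ^ 7))"

definition is_5_4_minus_7_cusp :: "(real \<Rightarrow> real \<times> real) \<Rightarrow> bool" where
  "is_5_4_minus_7_cusp \<gamma> \<longleftrightarrow> A_equivalent \<gamma> (\<lambda>t. (t ^ 4, t ^ 5 - t ^ 7))"

section \<open>Frontals and fronts\<close>

definition tangent_dir :: "real \<Rightarrow> real \<times> real" where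
  "tangent_dir \<theta> = (cos \<theta>, sin \<theta>)"

definition normal_dir :: "real \<Rightarrow> real \<times> real" where
  "normal_dir \<theta> = (- sin \<theta>, cos \<theta>)"

definition regular_at :: "(real \<Rightarrow> 'b::real_normed_vector) \<Rightarrow> real \<Rightarrow> bool" where
  "regular_at \<gamma> t \<longleftrightarrow> (\<exists>v. (\<gamma> has_vector_derivative v) (at t) \<and> v \<noteq> 0)"

definition cooriented_frontal :: "(real \<Rightarrow> real \<times> real) \<Rightarrow> (real \<Rightarrow> real \<times> real) \<Rightarrow> bool" where
  "cooriented_frontal \<gamma> n \<longleftrightarrow>
     smooth_germ \<gamma> \<and> smooth_germ n \<and>
     (\<forall>\<^sub>F t in nhds 0. norm (n t) = 1 \<and> vector_derivative \<gamma> (at t) \<bullet> n t = 0)"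

text \<open>A map defined near \<open>0\<close> on the line is an immersion iff it is regular at each parameter, so
  the condition below says that \<open>(\<gamma>, n)\<close> is an immersion; it includes the parameters at which
  \<open>\<gamma>\<close> itself is singular.\<close>

definition cooriented_front :: "(real \<Rightarrow> real \<times> real) \<Rightarrow> (real \<Rightarrow> real \<times> real) \<Rightarrow> bool" where
  "cooriented_front \<gamma> n \<longleftrightarrow>
     cooriented_frontal \<gamma> n \<and> (\<forall>\<^sub>F t in nhds 0. regular_at (\<lambda>s. (\<gamma> s, n s)) t)"

text \<open>A cooriented frontal with tangent angle \<open>\<theta>\<close>: its unit tangent field is
  \<open>tangent_dir \<circ> \<theta>\<close>, its coorientation is \<open>normal_dir \<circ> \<theta>\<close>.\<close>

definition frontal_with_angle ::
    "(real \<Rightarrow> real \<times> real) \<Rightarrow> (real \<Rightarrow> real) \<Rightarrow> (real \<Rightarrow> real) \<Rightarrow> bool" where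
  "frontal_with_angle \<gamma> l \<theta> \<longleftrightarrow>
     cooriented_frontal \<gamma> (\<lambda>t. normal_dir (\<theta> t)) \<and> smooth_germ l \<and> smooth_germ \<theta> \<and>
     (\<forall>\<^sub>F t in nhds 0. (\<gamma> has_vector_derivative l t *\<^sub>R tangent_dir (\<theta> t)) (at t))"

definition angularly_regular_frontal ::
    "(real \<Rightarrow> real \<times> real) \<Rightarrow> (real \<Rightarrow> real) \<Rightarrow> (real \<Rightarrow> real) \<Rightarrow> bool" where
  "angularly_regular_frontal \<gamma> l \<theta> \<longleftrightarrow>
     frontal_with_angle \<gamma> l \<theta> \<and> (\<forall>\<^sub>F t in nhds 0. deriv \<theta> t \<noteq> 0)"

text \<open>The pair is given in its common angular parameter. Shifting the angle of the second curve by
  \<open>pi\<close> encodes the choice of opposite tangent lifts.\<close>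

definition angularly_regular_parallel_pair ::
    "(real \<Rightarrow> real \<times> real) \<Rightarrow> (real \<Rightarrow> real \<times> real) \<Rightarrow> (real \<Rightarrow> real) \<Rightarrow> (real \<Rightarrow> real) \<Rightarrow> real \<Rightarrow> bool"
  where
  "angularly_regular_parallel_pair \<gamma>p \<gamma>m \<rho>p \<rho>m \<theta>0 \<longleftrightarrow>
     angularly_regular_frontal \<gamma>p \<rho>p (\<lambda>u. u + \<theta>0) \<and>
     angularly_regular_frontal \<gamma>m \<rho>m (\<lambda>u. u + \<theta>0 + pi)"

lemma parallel_pair_derivatives:
  assumes "angularly_regular_parallel_pair \<gamma>p \<gamma>m \<rho>p \<rho>m \<theta>0"
  shows "\<forall>\<^sub>F u in nhds 0. (\<gamma>p has_vector_derivative \<rho>p u *\<^sub>R tangent_dir (u + \<theta>0)) (at u)"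
    and "\<forall>\<^sub>F u in nhds 0. (\<gamma>m has_vector_derivative - \<rho>m u *\<^sub>R tangent_dir (u + \<theta>0)) (at u)"
  using assms
  by (simp_all add: angularly_regular_parallel_pair_def angularly_regular_frontal_def
      frontal_with_angle_def tangent_dir_def)

definition wigner_caustic_branch ::
    "(real \<Rightarrow> real \<times> real) \<Rightarrow> (real \<Rightarrow> real \<times> real) \<Rightarrow> real \<Rightarrow> real \<times> real" where
  "wigner_caustic_branch \<gamma>p \<gamma>m u = (1 / 2) *\<^sub>R (\<gamma>p u + \<gamma>m u)"

end

theory Submission
  imports Defs
begin

text \<open>In the frame at the base point, \<open>E = E 0 + X e + Y n\<close> with \<open>X' = \<Delta> cos u / 2\<close> and
  \<open>Y' = \<Delta> sin u / 2\<close>. If \<open>\<Delta>\<close> vanishes to order \<open>m\<close>, then \<open>X\<close> and \<open>Y\<close> vanish to orders \<open>m + 1\<close> and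
  \<open>m + 2\<close>. Every germ that is divisible by a high power of \<open>s\<close> is a smooth function of the monomial
  curve \<open>\<delta>\<close>: it is a combination of \<open>1, s, \<dots>, s ^ (k - 1)\<close> over the smooth functions of \<open>s ^ k\<close>,
  and high powers of \<open>s\<close> are polynomials in the coordinates of \<open>\<delta>\<close> up to a unit. Hence only finitely
  many Taylor coefficients obstruct \<open>X\<close> and \<open>Y\<close> from being functions of \<open>\<delta>\<close>, and a polynomial change of
  parameter \<open>\<tau>\<close> removes them. For \<open>(s ^ 4, s ^ 5 + \<epsilon> s ^ 7)\<close> the last obstruction determines \<open>\<epsilon>\<close>, which
  is a positive multiple of \<open>Q\<close>. Then \<open>E \<circ> \<tau> = \<Psi> \<circ> \<delta>\<close> for a local diffeomorphism \<open>\<Psi>\<close>. Conversely, a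
  diffeomorphism distorts distances by at most a constant factor, so the order of \<open>E - E 0\<close> is an
  invariant and recovers \<open>m\<close>.\<close>

section \<open>Calculus of \<open>C\<^sup>k\<close> maps\<close>

text \<open>The coefficients that obstruct are those at the gaps, above the leading exponent, of the
  semigroup generated by the two exponents of the cusp: none for 2, 3; only 5 for 3, 4; and 6, 7, 11
  for 4, 5. Each gap puts one condition on X and one on Y. At the gap 5 of the 4/3-cusp, \<alpha>
  and \<beta> meet both. At the gaps 6 and 7 of the 5/4-cusp there are four conditions for three
  parameters \<alpha>, \<beta>, \<gamma>; the one left over, at s^7 in Y, defines \<epsilon>. At 11
  a second change of parameter again has two parameters for two conditions. For \<epsilon> nonzero
  the terms at 7 and 11 need not vanish: they must be \<epsilon> times those at 5 and 9, because s^5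
  + \<epsilon> s^7 and its product with s^4 are the available functions. A scaling of the parameter
  normalises the size of \<epsilon> and keeps its sign. The germs are only smooth, so a remainder
  s^N g(s) is not a power series in the coordinates of \<delta>. Moreover its extension to the plane
  must have zero differential, or it would disturb the Jacobian of \<Psi>. This fixes N as 4, 6 and
  12: from there on every needed power of s is a product of two functions of \<delta> vanishing at
  0.\<close>

lemma times_cont_diff_on_cong:
  assumes "open S" "\<And>x. x \<in> S \<Longrightarrow> f x = g x" "times_cont_diff_on n S f"
  shows "times_cont_diff_on n S g"
  using assms(2,3)
proof (induction n arbitrary: f g)
  case 0
  then show ?case by (auto cong: continuous_on_cong)
next
  case (Suc n)
  have d: "f differentiable at x" if "x \<in> S" for x using Suc.prems that by auto
  have "frechet_derivative f (at x) = frechet_derivative g (at x)" if "x \<in> S" for x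
    using frechet_derivative_transform_within_open[OF d[OF that] \<open>open S\<close> that] Suc.prems by auto
  moreover have "g differentiable at x" if "x \<in> S" for x
    using d[OF that] Suc.prems(1) that \<open>open S\<close>
    by (meson differentiable_def has_derivative_transform_within_open)
  ultimately show ?case
    using Suc.prems(2) Suc.IH[of "\<lambda>x. frechet_derivative f (at x) v" "\<lambda>x. frechet_derivative g (at x) v" for v]
    by simp
qed

lemma times_cont_diff_on_subset:
  "times_cont_diff_on n S f \<Longrightarrow> T \<subseteq> S \<Longrightarrow> times_cont_diff_on n T f"
  by (induction n arbitrary: f) (auto intro: continuous_on_subset)

text \<open>The closure rules below rest on this form: any explicit formula for the derivative may
  stand in for \<open>frechet_derivative\<close>, and the induction on the order then runs on that
  formula.\<close>

lemma times_cont_diff_on_SucI: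
  assumes "open S" "\<And>x. x \<in> S \<Longrightarrow> (f has_derivative f' x) (at x)"
    "\<And>v. times_cont_diff_on n S (\<lambda>x. f' x v)"
  shows "times_cont_diff_on (Suc n) S f"
proof -
  have "frechet_derivative f (at x) = f' x" if "x \<in> S" for x
    using assms(2)[OF that] frechet_derivative_at by metis
  then show ?thesis
    using assms times_cont_diff_on_cong[OF assms(1) _ assms(3)]
    by (auto simp: differentiable_def) 
qed

lemma times_cont_diff_on_SucD:
  assumes "times_cont_diff_on (Suc n) S f" "x \<in> S"
  shows "(f has_derivative frechet_derivative f (at x)) (at x)"
  using assms frechet_derivative_works by auto

lemma times_cont_diff_on_frechet:
  "times_cont_diff_on (Suc n) S f \<Longrightarrow> times_cont_diff_on n S (\<lambda>x. frechet_derivative f (at x) v)"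
  by simp

lemma times_cont_diff_on_Suc_lower:
  "times_cont_diff_on (Suc n) S f \<Longrightarrow> times_cont_diff_on n S f"
proof (induction n arbitrary: f)
  case 0
  then show ?case
    by (auto intro!: differentiable_imp_continuous_on simp: differentiable_on_def differentiable_at_withinI)
next
  case (Suc n)
  then show ?case by (metis times_cont_diff_on.simps(2))
qed

lemma times_cont_diff_on_mono:
  "times_cont_diff_on n S f \<Longrightarrow> m \<le> n \<Longrightarrow> times_cont_diff_on m S f"
  by (induction n) (auto simp del: times_cont_diff_on.simps simp: le_Suc_eq dest: times_cont_diff_on_Suc_lower)

lemma times_cont_diff_on_continuous: "times_cont_diff_on n S f \<Longrightarrow> continuous_on S f"
  using times_cont_diff_on_mono[of n S f 0] by simp

lemma times_cont_diff_on_const: "times_cont_diff_on n S (\<lambda>x. c)"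
  by (induction n arbitrary: c) simp_all

lemma times_cont_diff_on_bounded_linear:
  assumes "open S" "bounded_linear h"
  shows "times_cont_diff_on n S f \<Longrightarrow> times_cont_diff_on n S (\<lambda>x. h (f x))"
proof (induction n arbitrary: f)
  case 0
  then show ?case using bounded_linear.continuous_on[OF assms(2)] by auto
next
  case (Suc n)
  show ?case
  proof (rule times_cont_diff_on_SucI[OF assms(1)])
    show "((\<lambda>x. h (f x)) has_derivative (\<lambda>v. h (frechet_derivative f (at x) v))) (at x)" if "x \<in> S" for x
      using bounded_linear.has_derivative[OF assms(2) times_cont_diff_on_SucD[OF Suc.prems that]] .
    show "times_cont_diff_on n S (\<lambda>x. h (frechet_derivative f (at x) v))" for v
      using Suc.IH Suc.prems by simp
  qed
qed

lemma times_cont_diff_on_ident: "open S \<Longrightarrow> times_cont_diff_on n S (\<lambda>x. x)"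
  by (cases n) (auto intro!: times_cont_diff_on_SucI[where f'="\<lambda>_ v. v"] times_cont_diff_on_const
      simp del: times_cont_diff_on.simps(2))

lemma times_cont_diff_on_add:
  assumes "open S"
  shows "times_cont_diff_on n S f \<Longrightarrow> times_cont_diff_on n S g \<Longrightarrow> times_cont_diff_on n S (\<lambda>x. f x + g x)"
proof (induction n arbitrary: f g)
  case 0
  then show ?case by (auto intro: continuous_on_add)
next
  case (Suc n)
  show ?case
  proof (rule times_cont_diff_on_SucI[OF assms])
    show "((\<lambda>x. f x + g x) has_derivative
        (\<lambda>v. frechet_derivative f (at x) v + frechet_derivative g (at x) v)) (at x)" if "x \<in> S" for x
      using times_cont_diff_on_SucD[OF Suc.prems(1) that] times_cont_diff_on_SucD[OF Suc.prems(2) that]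
      by (rule has_derivative_add)
  qed (use Suc in simp)
qed

lemma times_cont_diff_on_sum:
  assumes "open S" "\<And>i. i \<in> I \<Longrightarrow> times_cont_diff_on n S (f i)"
  shows "times_cont_diff_on n S (\<lambda>x. \<Sum>i\<in>I. f i x)"
  using assms(2) by (induction I rule: infinite_finite_induct)
    (auto intro!: times_cont_diff_on_const times_cont_diff_on_add assms(1))

lemma times_cont_diff_on_scaleR:
  fixes f :: "'a::euclidean_space \<Rightarrow> real"
  assumes "open S"
  shows "times_cont_diff_on n S f \<Longrightarrow> times_cont_diff_on n S g \<Longrightarrow> times_cont_diff_on n S (\<lambda>x. f x *\<^sub>R g x)"
proof (induction n arbitrary: f g)
  case 0
  then show ?case by (auto intro: continuous_on_scaleR)
next
  case (Suc n)
  show ?case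
  proof (rule times_cont_diff_on_SucI[OF assms])
    show "((\<lambda>x. f x *\<^sub>R g x) has_derivative
        (\<lambda>v. f x *\<^sub>R frechet_derivative g (at x) v + frechet_derivative f (at x) v *\<^sub>R g x)) (at x)"
      if "x \<in> S" for x
      using times_cont_diff_on_SucD[OF Suc.prems(1) that] times_cont_diff_on_SucD[OF Suc.prems(2) that]
      by (rule has_derivative_scaleR)
    show "times_cont_diff_on n S
        (\<lambda>x. f x *\<^sub>R frechet_derivative g (at x) v + frechet_derivative f (at x) v *\<^sub>R g x)" for v
      using Suc.prems
      by (intro times_cont_diff_on_add Suc.IH assms Suc.prems[THEN times_cont_diff_on_Suc_lower]
          Suc.prems[THEN times_cont_diff_on_frechet])
  qed
qed

lemma times_cont_diff_on_diff:
  assumes "open S" "times_cont_diff_on n S f" "times_cont_diff_on n S g"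
  shows "times_cont_diff_on n S (\<lambda>x. f x - g x)"
  using times_cont_diff_on_add[OF assms(1,2) times_cont_diff_on_bounded_linear[OF assms(1)
      bounded_linear_minus[OF bounded_linear_ident] assms(3)]] by simp

lemma times_cont_diff_on_cmult:
  fixes f :: "'a::euclidean_space \<Rightarrow> real"
  assumes "open S" "times_cont_diff_on n S f"
  shows "times_cont_diff_on n S (\<lambda>x. c * f x)"
  by (rule times_cont_diff_on_bounded_linear[OF assms(1) bounded_linear_mult_right assms(2)])

lemma times_cont_diff_on_Pair:
  assumes "open S" "times_cont_diff_on n S f" "times_cont_diff_on n S g"
  shows "times_cont_diff_on n S (\<lambda>x. (f x, g x))"
proof -
  have "times_cont_diff_on n S (\<lambda>x. (f x, 0) + (0, g x))"
    by (intro times_cont_diff_on_add assms(1)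
        times_cont_diff_on_bounded_linear[OF assms(1) _ assms(2), of "\<lambda>y. (y, 0)"]
        times_cont_diff_on_bounded_linear[OF assms(1) _ assms(3), of "\<lambda>y. (0, y)"]
        bounded_linear_Pair bounded_linear_ident bounded_linear_zero)
  then show ?thesis by simp
qed

lemma times_cont_diff_on_compose:
  fixes f :: "'a::euclidean_space \<Rightarrow> 'b::euclidean_space"
  assumes "open S" "open T" "f ` S \<subseteq> T"
  shows "times_cont_diff_on n S f \<Longrightarrow> times_cont_diff_on n T g \<Longrightarrow> times_cont_diff_on n S (\<lambda>x. g (f x))"
proof (induction n arbitrary: g)
  case 0
  then show ?case using assms(3) by (auto intro: continuous_on_compose2)
next
  case (Suc n)
  let ?f' = "\<lambda>x. frechet_derivative f (at x)" and ?g' = "\<lambda>x. frechet_derivative g (at x)"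
  show ?case
  proof (rule times_cont_diff_on_SucI[OF assms(1)])
    \<comment> \<open>The class only controls derivatives in a fixed direction, whereas
      \<open>?f' x v\<close> moves with x. Expanding it over \<open>Basis\<close> leaves fixed
      directions b and scalar coefficients.\<close>
    show "((\<lambda>x. g (f x)) has_derivative (\<lambda>v. \<Sum>b\<in>Basis. (?f' x v \<bullet> b) *\<^sub>R ?g' (f x) b)) (at x)"
      if "x \<in> S" for x
    proof -
      have g: "(g has_derivative ?g' (f x)) (at (f x))"
        using times_cont_diff_on_SucD[OF Suc.prems(2)] assms(3) that by auto
      have "?g' (f x) w = (\<Sum>b\<in>Basis. (w \<bullet> b) *\<^sub>R ?g' (f x) b)" for w
      proof -
        have "?g' (f x) (\<Sum>b\<in>Basis. (w \<bullet> b) *\<^sub>R b) = (\<Sum>b\<in>Basis. (w \<bullet> b) *\<^sub>R ?g' (f x) b)"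
          using has_derivative_linear[OF g] by (simp only: linear_sum linear_scale)
        then show ?thesis by (simp only: euclidean_representation)
      qed
      then have "(\<lambda>v. ?g' (f x) (?f' x v)) = (\<lambda>v. \<Sum>b\<in>Basis. (?f' x v \<bullet> b) *\<^sub>R ?g' (f x) b)"
        by blast
      then show ?thesis
        using has_derivative_compose[OF times_cont_diff_on_SucD[OF Suc.prems(1) that] g] by metis
    qed
    fix v
    have 1: "times_cont_diff_on n S (\<lambda>x. ?f' x v \<bullet> b)" for b
      using times_cont_diff_on_bounded_linear[OF assms(1) bounded_linear_inner_left, of n "\<lambda>x. ?f' x v" b] Suc.prems
      by simp
    have 2: "times_cont_diff_on n S (\<lambda>x. ?g' (f x) b)" for b
      using Suc.IH[of "\<lambda>y. ?g' y b"] Suc.prems times_cont_diff_on_Suc_lower[OF Suc.prems(1)] by simp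
    show "times_cont_diff_on n S (\<lambda>x. \<Sum>b\<in>Basis. (?f' x v \<bullet> b) *\<^sub>R ?g' (f x) b)"
      by (intro times_cont_diff_on_sum times_cont_diff_on_scaleR assms(1) 1 2)
  qed
qed

lemma times_cont_diff_on_inverse:
  fixes f :: "'a::euclidean_space \<Rightarrow> real"
  assumes "open S" "\<And>x. x \<in> S \<Longrightarrow> f x \<noteq> 0"
  shows "times_cont_diff_on n S f \<Longrightarrow> times_cont_diff_on n S (\<lambda>x. inverse (f x))"
proof (induction n)
  case 0
  then show ?case using assms by (auto intro: continuous_on_inverse)
next
  case (Suc n)
  note low = times_cont_diff_on_Suc_lower[OF Suc.prems]
  show ?case
  proof (rule times_cont_diff_on_SucI[OF assms(1)])
    show "((\<lambda>x. inverse (f x)) has_derivative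
       (\<lambda>v. - (inverse (f x) *\<^sub>R (frechet_derivative f (at x) v *\<^sub>R inverse (f x))))) (at x)" if "x \<in> S" for x
      using Deriv.has_derivative_inverse[OF assms(2)[OF that] times_cont_diff_on_SucD[OF Suc.prems that]]
      by (simp add: ac_simps)
    fix v
    have "times_cont_diff_on n S (\<lambda>x. inverse (f x) *\<^sub>R (frechet_derivative f (at x) v *\<^sub>R inverse (f x)))"
      using Suc.prems by (intro times_cont_diff_on_scaleR assms(1) Suc.IH low) auto
    from times_cont_diff_on_bounded_linear[OF assms(1) bounded_linear_minus[OF bounded_linear_ident] this]
    show "times_cont_diff_on n S (\<lambda>x. - (inverse (f x) *\<^sub>R (frechet_derivative f (at x) v *\<^sub>R inverse (f x))))" .
  qed
qed

section \<open>Smooth functions of one real variable\<close>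

lemma times_cont_diff_on_real_SucI:
  fixes f :: "real \<Rightarrow> 'b::real_normed_vector"
  assumes "open S" "\<And>x. x \<in> S \<Longrightarrow> (f has_vector_derivative f' x) (at x)" "times_cont_diff_on n S f'"
  shows "times_cont_diff_on (Suc n) S f"
  using assms(2) times_cont_diff_on_bounded_linear[OF assms(1) bounded_linear_scaleR_right assms(3)]
  by (intro times_cont_diff_on_SucI[OF assms(1), where f'="\<lambda>x v. v *\<^sub>R f' x"])
    (auto simp: has_vector_derivative_def)

text \<open>A class of functions closed under differentiation consists of smooth functions. With P a
  family depending on parameters, no formula for the iterated derivatives of a single member is
  required.\<close>

lemma smooth_on_coinduct:
  fixes f :: "real \<Rightarrow> 'b::real_normed_vector"
  assumes "open S" "P f"
    and step: "\<And>f. P f \<Longrightarrow> \<exists>f'. P f' \<and> (\<forall>x\<in>S. (f has_vector_derivative f' x) (at x))"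
  shows "Ck_on k S f"
proof -
  have "times_cont_diff_on n S f" if "P f" for n f
    using that
  proof (induction n arbitrary: f)
    case 0
    from step[OF this] have "continuous_on S f"
      by (meson continuous_at_imp_continuous_on has_vector_derivative_continuous)
    then show ?case by simp
  next
    case (Suc n)
    from step[OF Suc.prems] Suc.IH show ?case
      by (metis times_cont_diff_on_real_SucI[OF assms(1)])
  qed
  with assms(2) show ?thesis by (simp add: Ck_on_def)
qed

lemma smooth_on_vector_derivative:
  fixes f :: "real \<Rightarrow> 'b::real_normed_vector"
  assumes "open S" "Ck_on \<infinity> S f"
  obtains f' where "Ck_on \<infinity> S f'" "\<And>x. x \<in> S \<Longrightarrow> (f has_vector_derivative f' x) (at x)"
proof
  have t: "times_cont_diff_on (Suc n) S f" for n using assms(2) unfolding Ck_on_def by (metis enat_ord_code(3))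
  show "Ck_on \<infinity> S (\<lambda>x. frechet_derivative f (at x) 1)"
    using t by (auto simp: Ck_on_def)
  fix x assume "x \<in> S"
  from times_cont_diff_on_SucD[OF t this]
  have d: "(f has_derivative frechet_derivative f (at x)) (at x)" .
  have "frechet_derivative f (at x) = (\<lambda>v. v *\<^sub>R frechet_derivative f (at x) 1)"
  proof
    fix v
    show "frechet_derivative f (at x) v = v *\<^sub>R frechet_derivative f (at x) 1"
      using linear_scale[OF has_derivative_linear[OF d], of v 1] by (metis mult.right_neutral real_scaleR_def)
  qed
  with d show "(f has_vector_derivative frechet_derivative f (at x) 1) (at x)"
    by (simp add: has_vector_derivative_def)
qed


section \<open>Smooth germs\<close>

definition smooth_at :: "('a::euclidean_space \<Rightarrow> 'b::real_normed_vector) \<Rightarrow> 'a \<Rightarrow> bool" where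
  "smooth_at f a \<longleftrightarrow> (\<exists>U. open U \<and> a \<in> U \<and> Ck_on \<infinity> U f)"

lemma smooth_germ_iff_smooth_at: "smooth_germ f \<longleftrightarrow> smooth_at f 0"
  by (simp add: smooth_germ_def smooth_at_def)

lemma Ck_on_infinity: "Ck_on \<infinity> U f \<longleftrightarrow> (\<forall>n. times_cont_diff_on n U f)"
  by (simp add: Ck_on_def)

lemma Ck_on_subset: "Ck_on k S f \<Longrightarrow> T \<subseteq> S \<Longrightarrow> Ck_on k T f"
  by (auto simp: Ck_on_def intro: times_cont_diff_on_subset)

lemma Ck_on_compose:
  fixes f :: "'a::euclidean_space \<Rightarrow> 'b::euclidean_space"
  assumes "open S" "open T" "f ` S \<subseteq> T" "Ck_on k S f" "Ck_on k T g"
  shows "Ck_on k S (\<lambda>x. g (f x))"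
  using times_cont_diff_on_compose[OF assms(1-3)] assms(4,5) by (auto simp: Ck_on_def)

lemma smooth_atI: "(\<And>n. times_cont_diff_on n UNIV f) \<Longrightarrow> smooth_at f a"
  by (auto simp: smooth_at_def Ck_on_infinity intro!: exI[of _ UNIV])

lemma smooth_at_const: "smooth_at (\<lambda>x. c) a"
  by (intro smooth_atI times_cont_diff_on_const)

lemma smooth_at_ident: "smooth_at (\<lambda>x. x) a"
  by (intro smooth_atI times_cont_diff_on_ident) simp

lemma smooth_at_binary:
  assumes "smooth_at f a" "smooth_at g a"
    and "\<And>n U. open U \<Longrightarrow> times_cont_diff_on n U f \<Longrightarrow> times_cont_diff_on n U g \<Longrightarrow>
      times_cont_diff_on n U (\<lambda>x. h (f x) (g x))"
  shows "smooth_at (\<lambda>x. h (f x) (g x)) a"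
proof -
  obtain U V where "open U" "a \<in> U" "Ck_on \<infinity> U f" "open V" "a \<in> V" "Ck_on \<infinity> V g"
    using assms(1,2) by (auto simp: smooth_at_def)
  then show ?thesis unfolding smooth_at_def Ck_on_infinity
    by (intro exI[of _ "U \<inter> V"] conjI allI assms(3) open_Int)
      (blast intro: times_cont_diff_on_subset[OF _ Int_lower1] times_cont_diff_on_subset[OF _ Int_lower2])+
qed

lemma smooth_at_add: "smooth_at f a \<Longrightarrow> smooth_at g a \<Longrightarrow> smooth_at (\<lambda>x. f x + g x) a"
  by (rule smooth_at_binary) (auto intro: times_cont_diff_on_add)

lemma smooth_at_scaleR: "smooth_at f a \<Longrightarrow> smooth_at g a \<Longrightarrow> smooth_at (\<lambda>x. f x *\<^sub>R g x) a"
  by (rule smooth_at_binary) (auto intro: times_cont_diff_on_scaleR)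

lemma smooth_at_mult:
  fixes f g :: "'a::euclidean_space \<Rightarrow> real"
  shows "smooth_at f a \<Longrightarrow> smooth_at g a \<Longrightarrow> smooth_at (\<lambda>x. f x * g x) a"
  using smooth_at_scaleR[of f a g] by simp

lemma smooth_at_Pair: "smooth_at f a \<Longrightarrow> smooth_at g a \<Longrightarrow> smooth_at (\<lambda>x. (f x, g x)) a"
  by (rule smooth_at_binary) (auto intro: times_cont_diff_on_Pair)

lemma smooth_at_bounded_linear: "bounded_linear h \<Longrightarrow> smooth_at f a \<Longrightarrow> smooth_at (\<lambda>x. h (f x)) a"
  by (auto simp: smooth_at_def Ck_on_infinity intro!: times_cont_diff_on_bounded_linear)

lemma smooth_at_minus: "smooth_at f a \<Longrightarrow> smooth_at (\<lambda>x. - f x) a"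
  by (rule smooth_at_bounded_linear[OF bounded_linear_minus[OF bounded_linear_ident]])

lemma smooth_at_diff: "smooth_at f a \<Longrightarrow> smooth_at g a \<Longrightarrow> smooth_at (\<lambda>x. f x - g x) a"
  using smooth_at_add[OF _ smooth_at_minus, of f a g] by simp

lemma smooth_at_fst: "smooth_at f a \<Longrightarrow> smooth_at (\<lambda>x. fst (f x)) a"
  by (rule smooth_at_bounded_linear[OF bounded_linear_fst])

lemma smooth_at_snd: "smooth_at f a \<Longrightarrow> smooth_at (\<lambda>x. snd (f x)) a"
  by (rule smooth_at_bounded_linear[OF bounded_linear_snd])

lemma smooth_at_power:
  fixes f :: "'a::euclidean_space \<Rightarrow> real"
  shows "smooth_at f a \<Longrightarrow> smooth_at (\<lambda>x. f x ^ n) a"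
  by (induction n) (auto intro: smooth_at_const smooth_at_mult)

lemma smooth_at_sum: "(\<And>i. i \<in> I \<Longrightarrow> smooth_at (f i) a) \<Longrightarrow> smooth_at (\<lambda>x. \<Sum>i\<in>I. f i x) a"
  by (induction I rule: infinite_finite_induct) (auto intro: smooth_at_const smooth_at_add)

lemma smooth_at_isCont: "smooth_at f a \<Longrightarrow> isCont f a"
  unfolding smooth_at_def Ck_on_infinity
  using times_cont_diff_on_continuous continuous_on_eq_continuous_at by blast

lemma isCont_eventually_nhds:
  "isCont f a \<Longrightarrow> \<forall>\<^sub>F y in nhds (f a). P y \<Longrightarrow> \<forall>\<^sub>F x in nhds a. P (f x)"
  by (rule eventually_compose_filterlim[where F="nhds (f a)"])
    (auto simp: isCont_def tendsto_at_iff_tendsto_nhds)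

lemma smooth_at_compose:
  fixes f :: "'a::euclidean_space \<Rightarrow> 'b::euclidean_space"
  assumes "smooth_at g b" "smooth_at f a" "f a = b"
  shows "smooth_at (\<lambda>x. g (f x)) a"
proof -
  obtain U V where UV: "open U" "a \<in> U" "Ck_on \<infinity> U f" "open V" "f a \<in> V" "Ck_on \<infinity> V g"
    using assms unfolding smooth_at_def by blast
  have "continuous_on U f"
    using UV(3) times_cont_diff_on_continuous unfolding Ck_on_infinity by blast
  then have o: "open (U \<inter> f -` V)"
    using UV(1,4) by (rule continuous_open_preimage)
  have "Ck_on \<infinity> (U \<inter> f -` V) (\<lambda>x. g (f x))"
    by (rule Ck_on_compose[OF o UV(4) _ Ck_on_subset[OF UV(3)] UV(6)]) auto
  then show ?thesis
    unfolding smooth_at_def using UV o by blast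
qed

lemma smooth_at_inverse:
  fixes f :: "'a::euclidean_space \<Rightarrow> real"
  assumes "smooth_at f a" "f a \<noteq> 0"
  shows "smooth_at (\<lambda>x. inverse (f x)) a"
proof (rule smooth_at_compose[OF _ assms(1) refl])
  have "times_cont_diff_on n (- {0}) (\<lambda>x::real. inverse x)" for n
    by (intro times_cont_diff_on_inverse times_cont_diff_on_ident) auto
  then show "smooth_at inverse (f a)"
    unfolding smooth_at_def Ck_on_infinity using assms(2) by (intro exI[of _ "- {0}"]) auto
qed

lemma smooth_at_divide:
  fixes f :: "'a::euclidean_space \<Rightarrow> real"
  shows "smooth_at f a \<Longrightarrow> smooth_at g a \<Longrightarrow> g a \<noteq> 0 \<Longrightarrow> smooth_at (\<lambda>x. f x / g x) a"
  unfolding divide_inverse by (intro smooth_at_mult smooth_at_inverse)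

lemma Ck_on_sin_cos: "Ck_on k UNIV (\<lambda>x::real. c * sin x + d * cos x)"
proof (rule smooth_on_coinduct[where P="\<lambda>f. \<exists>c d. f = (\<lambda>x::real. c * sin x + d * cos x)"])
  fix f assume "\<exists>c d. f = (\<lambda>x::real. c * sin x + d * cos x)"
  then obtain c d where f: "f = (\<lambda>x::real. c * sin x + d * cos x)" by blast
  have "(f has_vector_derivative (- d) * sin x + c * cos x) (at x)" for x
    unfolding f has_real_derivative_iff_has_vector_derivative[symmetric]
    by (auto intro!: derivative_eq_intros)
  then show "\<exists>f'. (\<exists>c d. f' = (\<lambda>x. c * sin x + d * cos x)) \<and> (\<forall>x\<in>UNIV. (f has_vector_derivative f' x) (at x))"
    by (intro exI[of _ "\<lambda>x. (- d) * sin x + c * cos x"]) blast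
qed auto

lemma smooth_at_sin: "smooth_at (\<lambda>x::real. sin x) a" and smooth_at_cos: "smooth_at (\<lambda>x::real. cos x) a"
  using Ck_on_sin_cos[of \<infinity> 1 0] Ck_on_sin_cos[of \<infinity> 0 1]
  by (auto simp: smooth_at_def intro!: exI[of _ UNIV])

lemmas smooth_intros = smooth_at_const smooth_at_ident smooth_at_add smooth_at_diff smooth_at_minus
  smooth_at_mult smooth_at_scaleR smooth_at_Pair smooth_at_fst smooth_at_snd smooth_at_power
  smooth_at_sum smooth_at_divide

section \<open>Germs of diffeomorphisms\<close>

lemma homeomorphism_compose_restrict:
  fixes f :: "'a::topological_space \<Rightarrow> 'b::topological_space" and g :: "'b \<Rightarrow> 'c::topological_space"
  assumes "homeomorphism U V f f'" "homeomorphism V' W g g'"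
  shows "homeomorphism (f' ` (V \<inter> V')) (g ` (V \<inter> V')) (g \<circ> f) (f' \<circ> g')"
proof (rule homeomorphism_compose)
  show "homeomorphism (f' ` (V \<inter> V')) (V \<inter> V') f f'"
    by (rule homeomorphism_symD, rule homeomorphism_of_subsets[OF homeomorphism_symD[OF assms(1)]])
      (use assms(1) in \<open>auto simp: homeomorphism_def\<close>)
  show "homeomorphism (V \<inter> V') (g ` (V \<inter> V')) g g'"
    by (rule homeomorphism_of_subsets[OF assms(2)]) auto
qed

lemma homeomorphism_open_image:
  assumes "homeomorphism U V f g" "open U" "open W" "W \<subseteq> V"
  shows "open (g ` W)"
proof -
  have "g ` W = U \<inter> f -` W" using assms by (force simp: homeomorphism_def)
  then show ?thesis using assms by (metis continuous_open_preimage homeomorphism_def)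
qed

lemma Ck_diffeo_germ_compose:
  assumes "Ck_diffeo_germ k f a b" "Ck_diffeo_germ k g b c"
  shows "Ck_diffeo_germ k (\<lambda>x. g (f x)) a c"
proof -
  obtain U V f' where f: "f a = b" "open U" "open V" "a \<in> U" "homeomorphism U V f f'" "Ck_on k U f" "Ck_on k V f'"
    using assms(1) by (auto simp: Ck_diffeo_germ_def)
  obtain V' W g' where g: "g b = c" "open V'" "open W" "b \<in> V'" "homeomorphism V' W g g'" "Ck_on k V' g" "Ck_on k W g'"
    using assms(2) by (auto simp: Ck_diffeo_germ_def)
  \<comment> \<open>The range of f and the domain of g need only share a neighbourhood of b, so both
    homeomorphisms are cut down to the overlap.\<close>
  define X where "X = V \<inter> V'"
  have X: "open X" "X \<subseteq> V" "X \<subseteq> V'" "b \<in> X" using f g by (auto simp: X_def homeomorphism_def)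
  have o: "open (f' ` X)" "open (g ` X)"
    using homeomorphism_open_image[OF f(5,2) X(1,2)]
      homeomorphism_open_image[OF homeomorphism_symD[OF g(5)] g(3) X(1,3)] by auto
  have a: "a \<in> f' ` X" using f X by (force simp: homeomorphism_def)
  have h: "homeomorphism (f' ` X) (g ` X) (\<lambda>x. g (f x)) (\<lambda>x. f' (g' x))"
    using homeomorphism_compose_restrict[OF f(5) g(5)] by (simp add: X_def o_def)
  have i: "f ` f' ` X \<subseteq> X" "g' ` g ` X \<subseteq> X" "f' ` X \<subseteq> U" "g ` X \<subseteq> W"
    using f(5) g(5) X by (auto simp: homeomorphism_def)
  have "Ck_on k (f' ` X) (\<lambda>x. g (f x))"
    by (rule Ck_on_compose[OF o(1) X(1) i(1) Ck_on_subset[OF f(6) i(3)] Ck_on_subset[OF g(6) X(3)]])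
  moreover have "Ck_on k (g ` X) (\<lambda>x. f' (g' x))"
    by (rule Ck_on_compose[OF o(2) X(1) i(2) Ck_on_subset[OF g(7) i(4)] Ck_on_subset[OF f(7) X(2)]])
  ultimately show ?thesis
    unfolding Ck_diffeo_germ_def using f(1) g(1) o a h
    by (intro conjI exI[of _ "f' ` X"] exI[of _ "g ` X"] exI[of _ "\<lambda>x. f' (g' x)"]) auto
qed

lemma Ck_diffeo_germ_inverse:
  assumes "Ck_diffeo_germ k f a b"
  obtains g where "Ck_diffeo_germ k g b a" "\<forall>\<^sub>F x in nhds a. g (f x) = x" "\<forall>\<^sub>F y in nhds b. f (g y) = y"
proof -
  obtain U V g where f: "f a = b" "open U" "open V" "a \<in> U" "homeomorphism U V f g" "Ck_on k U f" "Ck_on k V g"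
    using assms by (auto simp: Ck_diffeo_germ_def)
  then have "b \<in> V" "g b = a" "\<forall>x\<in>U. g (f x) = x" "\<forall>y\<in>V. f (g y) = y" by (auto simp: homeomorphism_def)
  then show thesis
    using f homeomorphism_symD[OF f(5)]
    by (intro that[of g]) (auto simp: Ck_diffeo_germ_def eventually_nhds)
qed

lemma Ck_diffeo_germ_isCont: "Ck_diffeo_germ k f a b \<Longrightarrow> isCont f a"
  unfolding Ck_diffeo_germ_def homeomorphism_def using continuous_on_eq_continuous_at by blast

lemma Ck_diffeo_germ_mono: "Ck_diffeo_germ k f a b \<Longrightarrow> l \<le> k \<Longrightarrow> Ck_diffeo_germ l f a b"
  unfolding Ck_diffeo_germ_def Ck_on_def by (meson order_trans)

lemma Ck_equivalent_trans:
  assumes "Ck_equivalent k \<gamma> \<delta>" "Ck_equivalent k \<delta> \<eta>"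
  shows "Ck_equivalent k \<gamma> \<eta>"
proof -
  obtain \<phi> \<Phi> where 1: "Ck_diffeo_germ k \<phi> 0 0" "Ck_diffeo_germ k \<Phi> (\<gamma> 0) (\<delta> 0)" "\<forall>\<^sub>F t in nhds 0. \<delta> (\<phi> t) = \<Phi> (\<gamma> t)"
    using assms(1) by (auto simp: Ck_equivalent_def)
  obtain \<psi> \<Psi> where 2: "Ck_diffeo_germ k \<psi> 0 0" "Ck_diffeo_germ k \<Psi> (\<delta> 0) (\<eta> 0)" "\<forall>\<^sub>F t in nhds 0. \<eta> (\<psi> t) = \<Psi> (\<delta> t)"
    using assms(2) by (auto simp: Ck_equivalent_def)
  have "\<phi> 0 = 0" using 1 by (simp add: Ck_diffeo_germ_def)
  then have "\<forall>\<^sub>F t in nhds 0. \<eta> (\<psi> (\<phi> t)) = \<Psi> (\<delta> (\<phi> t))"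
    using isCont_eventually_nhds[OF Ck_diffeo_germ_isCont[OF 1(1)]] 2(3) by simp
  then have "\<forall>\<^sub>F t in nhds 0. \<eta> (\<psi> (\<phi> t)) = \<Psi> (\<Phi> (\<gamma> t))"
    using 1(3) by eventually_elim simp
  then show ?thesis unfolding Ck_equivalent_def
    using Ck_diffeo_germ_compose[OF 1(1) 2(1)] Ck_diffeo_germ_compose[OF 1(2) 2(2)] by blast
qed

lemma Ck_equivalent_mono: "Ck_equivalent k \<gamma> \<delta> \<Longrightarrow> l \<le> k \<Longrightarrow> Ck_equivalent l \<gamma> \<delta>"
  unfolding Ck_equivalent_def by (meson Ck_diffeo_germ_mono)

text \<open>The hypothesis \<open>boot\<close> isolates the one fact that depends on the dimension:
  inverting a linear map is as smooth as the map itself. It is a reciprocal on the line and Cramer's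
  rule in the plane. Given it, the formula for the derivative of g lifts the smoothness of g from n
  to n + 1.\<close>

lemma inverse_function_theorem_Ck:
  fixes f :: "'a::euclidean_space \<Rightarrow> 'a"
  assumes U: "open U" "a \<in> U" "Ck_on k U f" "1 \<le> k" and "(f has_derivative L) (at a)" "inj L"
    and boot: "\<And>n U V (g :: 'a \<Rightarrow> 'a). open U \<Longrightarrow> open V \<Longrightarrow> g ` V \<subseteq> U \<Longrightarrow> times_cont_diff_on n V g \<Longrightarrow>
      (\<And>v. times_cont_diff_on n U (\<lambda>x. frechet_derivative f (at x) v)) \<Longrightarrow>
      (\<And>y. y \<in> V \<Longrightarrow> linear (frechet_derivative f (at (g y)))) \<Longrightarrow>
      (\<And>y. y \<in> V \<Longrightarrow> bij (frechet_derivative f (at (g y)))) \<Longrightarrow>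
      (\<And>v. times_cont_diff_on n V (\<lambda>y. inv (frechet_derivative f (at (g y))) v))"
  shows "Ck_diffeo_germ k f a (f a)"
proof -
  let ?F = "\<lambda>x. frechet_derivative f (at x)"
  have f1: "times_cont_diff_on (Suc 0) U f"
    using U(3,4) unfolding Ck_on_def by (metis One_nat_def one_enat_def)
  have d: "(f has_derivative ?F x) (at x)" if "x \<in> U" for x
    by (rule times_cont_diff_on_SucD[OF f1 that])
  \<comment> \<open>Off U, \<open>?F x\<close> need not be bounded linear, so the passage through
    \<open>Blinfun\<close> is faithful only on U.\<close>
  have bl: "blinfun_apply (Blinfun (?F x)) = ?F x" if "x \<in> U" for x
    by (rule bounded_linear_Blinfun_apply) (rule has_derivative_bounded_linear[OF d[OF that]])
  have FL: "?F a = L" using assms(5) frechet_derivative_at by metis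
  have "linear L" using assms(5) by (rule has_derivative_linear)
  then obtain L' where L': "linear L'" "L' \<circ> L = id"
    using linear_injective_left_inverse assms(6) by blast
  obtain U' V g g' where g: "open U'" "U' \<subseteq> U" "a \<in> U'" "open V" "f a \<in> V" "homeomorphism U' V f g"
    "\<And>y. y \<in> V \<Longrightarrow> (g has_derivative (g' y)) (at y)"
    "\<And>y. y \<in> V \<Longrightarrow> g' y = inv (blinfun_apply (Blinfun (?F (g y))))"
    "\<And>y. y \<in> V \<Longrightarrow> bij (blinfun_apply (Blinfun (?F (g y))))"
  proof (rule inverse_function_theorem[of U f "\<lambda>x. Blinfun (?F x)" a "Blinfun L'"])
    show "(f has_derivative blinfun_apply (Blinfun (?F x))) (at x)" if "x \<in> U" for x
      using d[OF that] bl[OF that] by simp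
    show "continuous_on U (\<lambda>x. Blinfun (?F x))"
    proof (rule continuous_on_blinfun_componentwise)
      fix b :: 'a
      have "continuous_on U (\<lambda>x. ?F x b)"
        using f1 by simp
      then show "continuous_on U (\<lambda>x. blinfun_apply (Blinfun (?F x)) b)"
        by (rule continuous_on_eq) (simp add: bl)
    qed
    show "Blinfun L' o\<^sub>L Blinfun (?F a) = id_blinfun"
      unfolding FL using L' bl[OF U(2), unfolded FL] bounded_linear_Blinfun_apply[of L']
      by (intro blinfun_eqI) (auto simp: linear_conv_bounded_linear fun_eq_iff)
  qed (use U in auto)
  have gV: "g ` V \<subseteq> U'" using g(6) by (auto simp: homeomorphism_def)
  have gU: "g y \<in> U" if "y \<in> V" for y using gV g(2) that by blast
  have lin: "linear (?F (g y))" if "y \<in> V" for y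
    using d gV g(2) that by (blast intro: has_derivative_linear)
  have bij: "bij (?F (g y))" and g': "g' y = inv (?F (g y))" if "y \<in> V" for y
    using g(8,9)[OF that] unfolding bl[OF gU[OF that]] by auto
  have "times_cont_diff_on n V g" if "enat n \<le> k" for n
    using that
  proof (induction n)
    case 0
    then show ?case using g(6) by (simp add: homeomorphism_def)
  next
    case (Suc n)
    have fn: "times_cont_diff_on (Suc n) U f" using U(3) Suc.prems unfolding Ck_on_def by blast
    have gn: "times_cont_diff_on n V g"
      using Suc.prems by (intro Suc.IH) (meson Suc_ile_eq order_less_imp_le)
    have "times_cont_diff_on n V (\<lambda>y. inv (?F (g y)) v)" for v
    proof (rule boot[OF \<open>open U'\<close> \<open>open V\<close> gV gn])
      show "times_cont_diff_on n U' (\<lambda>x. ?F x v)" for v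
        by (rule times_cont_diff_on_subset[OF times_cont_diff_on_frechet[OF fn] g(2)])
    qed (rule lin bij; assumption)+
    then show ?case using g(7) g'
      by (intro times_cont_diff_on_SucI[OF \<open>open V\<close>, where f'="\<lambda>y. inv (?F (g y))"]) auto
  qed
  then have "Ck_on k V g" by (simp add: Ck_on_def)
  then show ?thesis
    unfolding Ck_diffeo_germ_def using g(1,3,4,6) Ck_on_subset[OF U(3) g(2)] by blast
qed

lemma real_diffeo_germI:
  fixes f :: "real \<Rightarrow> real"
  assumes "open S" "a \<in> S" "Ck_on k S f" "1 \<le> k" "(f has_real_derivative c) (at a)" "c \<noteq> 0"
  shows "Ck_diffeo_germ k f a (f a)"
proof (rule inverse_function_theorem_Ck[OF assms(1-4) assms(5)[unfolded has_field_derivative_def]])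
  show "inj ((*) c)" using assms(6) by (simp add: inj_on_def)
  fix n U V and g :: "real \<Rightarrow> real" and v :: real
  let ?F = "\<lambda>x. frechet_derivative f (at x)"
  assume *: "open U" "open V" "g ` V \<subseteq> U" "times_cont_diff_on n V g"
    "\<And>v. times_cont_diff_on n U (\<lambda>x. ?F x v)" "\<And>y. y \<in> V \<Longrightarrow> linear (?F (g y))" "\<And>y. y \<in> V \<Longrightarrow> bij (?F (g y))"
  have F: "?F (g y) w = w * ?F (g y) 1" if "y \<in> V" for y w
    using linear_scale[OF *(6)[OF that], of w 1] by simp
  have nz: "?F (g y) 1 \<noteq> 0" if y: "y \<in> V" for y
  proof
    assume "?F (g y) 1 = 0"
    then have "?F (g y) w = 0" for w using F[OF that, of w] by simp
    moreover obtain w where "?F (g y) w = 1" using *(7)[OF y] by (metis bij_pointE)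
    ultimately show False by simp
  qed
  have "times_cont_diff_on n V (\<lambda>y. inverse (?F (g y) 1) *\<^sub>R v)"
    by (intro times_cont_diff_on_scaleR times_cont_diff_on_inverse times_cont_diff_on_const
        times_cont_diff_on_compose[OF *(2,1,3,4,5)] nz \<open>open V\<close>)
  then show "times_cont_diff_on n V (\<lambda>y. inv (?F (g y)) v)"
  proof (rule times_cont_diff_on_cong[OF \<open>open V\<close>, rotated])
    fix y assume that: "y \<in> V"
    show "inverse (?F (g y) 1) *\<^sub>R v = inv (?F (g y)) v"
    using F[OF that, of "inverse (?F (g y) 1) *\<^sub>R v"] nz[OF that] *(7)[OF that]
      by (intro inv_f_eq[symmetric]) (auto simp: bij_def)
  qed
qed

lemma plane_diffeo_germI:
  fixes f :: "real \<times> real \<Rightarrow> real \<times> real"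
  assumes "open S" "a \<in> S" "Ck_on k S f" "1 \<le> k" "(f has_derivative L) (at a)" "inj L"
  shows "Ck_diffeo_germ k f a (f a)"
proof (rule inverse_function_theorem_Ck[OF assms])
  fix n U V and g :: "real \<times> real \<Rightarrow> real \<times> real" and v :: "real \<times> real"
  let ?F = "\<lambda>x. frechet_derivative f (at x)"
  assume *: "open U" "open V" "g ` V \<subseteq> U" "times_cont_diff_on n V g"
    "\<And>v. times_cont_diff_on n U (\<lambda>x. ?F x v)" "\<And>y. y \<in> V \<Longrightarrow> linear (?F (g y))" "\<And>y. y \<in> V \<Longrightarrow> bij (?F (g y))"
  define p q where "p y = ?F (g y) (1, 0)" and "q y = ?F (g y) (0, 1)" for y
  define D where "D y = fst (p y) * snd (q y) - snd (p y) * fst (q y)" for y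
  have F: "?F (g y) w = fst w *\<^sub>R p y + snd w *\<^sub>R q y" if "y \<in> V" for y w
    using linear_add[OF *(6)[OF that], of "fst w *\<^sub>R (1, 0)" "snd w *\<^sub>R (0, 1)"]
      linear_scale[OF *(6)[OF that], of "fst w" "(1, 0)"] linear_scale[OF *(6)[OF that], of "snd w" "(0, 1)"]
    by (simp add: p_def q_def)
  have nz: "D y \<noteq> 0" if y: "y \<in> V" for y
  proof
    assume D: "D y = 0"
    obtain w1 w2 where w: "?F (g y) w1 = (1, 0)" "?F (g y) w2 = (0, 1)"
      using bij_is_surj[OF *(7)[OF y]] by (metis surjD)
    \<comment> \<open>Multiplicativity of the determinant: w1 and w2 are the columns of the inverse
      matrix.\<close>
    have "D y * (fst w1 * snd w2 - snd w1 * fst w2) = 1"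
      using w unfolding F[OF that] D_def by (simp add: prod_eq_iff) algebra
    with D show False by simp
  qed
  \<comment> \<open>Cramer's rule for the system with columns p y, q y and right-hand side
    v.\<close>
  define W where "W y = inverse (D y) *\<^sub>R
    (fst v * snd (q y) - snd v * fst (q y), snd v * fst (p y) - fst v * snd (p y))" for y
  note sm = times_cont_diff_on_bounded_linear[OF \<open>open V\<close> bounded_linear_fst]
    times_cont_diff_on_bounded_linear[OF \<open>open V\<close> bounded_linear_snd]
  have mult: "times_cont_diff_on n V (\<lambda>x. h x * k x)"
    if "times_cont_diff_on n V h" "times_cont_diff_on n V k" for h k :: "_ \<Rightarrow> real"
    using times_cont_diff_on_scaleR[OF \<open>open V\<close> that] by simp
  have pq: "times_cont_diff_on n V p" "times_cont_diff_on n V q"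
    unfolding p_def q_def by (intro times_cont_diff_on_compose[OF *(2,1,3,4,5)])+
  have "times_cont_diff_on n V W"
    unfolding W_def D_def
    by (intro times_cont_diff_on_scaleR[OF \<open>open V\<close>] times_cont_diff_on_inverse[OF \<open>open V\<close>]
        times_cont_diff_on_Pair[OF \<open>open V\<close>] times_cont_diff_on_diff[OF \<open>open V\<close>] mult sm pq times_cont_diff_on_const nz[unfolded D_def])
  then show "times_cont_diff_on n V (\<lambda>y. inv (?F (g y)) v)"
  proof (rule times_cont_diff_on_cong[OF \<open>open V\<close>, rotated], intro inv_f_eq[symmetric])
    fix y assume that: "y \<in> V"
    show "inj (?F (g y))" using *(7)[OF that] by (simp add: bij_def)
    show "?F (g y) (W y) = v"
      unfolding F[OF that] W_def using nz[OF that]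
      by (simp add: prod_eq_iff field_simps) (simp add: D_def algebra_simps)
  qed
qed


section \<open>Division of smooth functions and Taylor expansions\<close>

lemma Ck_on_deriv:
  fixes f :: "real \<Rightarrow> real"
  assumes "open S" "Ck_on \<infinity> S f"
  shows "Ck_on \<infinity> S (deriv f)" "\<And>x. x \<in> S \<Longrightarrow> (f has_real_derivative deriv f x) (at x)"
proof -
  obtain f' where f': "Ck_on \<infinity> S f'" "\<And>x. x \<in> S \<Longrightarrow> (f has_real_derivative f' x) (at x)"
    using smooth_on_vector_derivative[OF assms] by (metis has_real_derivative_iff_has_vector_derivative)
  then have eq: "f' x = deriv f x" if "x \<in> S" for x using that DERIV_imp_deriv by metis
  show "Ck_on \<infinity> S (deriv f)"
    using f'(1) times_cont_diff_on_cong[OF assms(1) eq] by (simp add: Ck_on_infinity)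
  show "(f has_real_derivative deriv f x) (at x)" if "x \<in> S" for x
    using f'(2)[OF that] eq[OF that] by simp
qed

lemma Ck_on_higher_deriv:
  fixes f :: "real \<Rightarrow> real"
  assumes "open S" "Ck_on \<infinity> S f"
  shows "Ck_on \<infinity> S ((deriv ^^ n) f)"
  by (induction n) (auto simp: assms Ck_on_deriv(1))

lemma smooth_at_deriv:
  fixes f :: "real \<Rightarrow> real"
  assumes "smooth_at f a"
  shows "smooth_at (deriv f) a" "\<forall>\<^sub>F x in nhds a. (f has_real_derivative deriv f x) (at x)"
proof -
  obtain U where U: "open U" "a \<in> U" "Ck_on \<infinity> U f" using assms unfolding smooth_at_def by blast
  show "smooth_at (deriv f) a"
    unfolding smooth_at_def using U(1,2) Ck_on_deriv(1)[OF U(1,3)] by (intro exI[of _ U] conjI)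
  show "\<forall>\<^sub>F x in nhds a. (f has_real_derivative deriv f x) (at x)"
    unfolding eventually_nhds using U(1,2) Ck_on_deriv(2)[OF U(1,3)] by (intro exI[of _ U] conjI ballI)
qed

lemma smooth_at_higher_deriv:
  fixes f :: "real \<Rightarrow> real"
  shows "smooth_at f a \<Longrightarrow> smooth_at ((deriv ^^ n) f) a"
  by (induction n) (simp_all add: smooth_at_deriv(1))

text \<open>A derivative at x depends on a neighbourhood of x, so the equality is first upgraded to
  hold near every nearby point.\<close>

lemma eventually_deriv_cong:
  fixes f g :: "real \<Rightarrow> real"
  assumes "\<forall>\<^sub>F x in nhds a. f x = g x"
  shows "\<forall>\<^sub>F x in nhds a. deriv f x = deriv g x"
proof -
  have "\<forall>\<^sub>F y in nhds a. \<forall>\<^sub>F x in nhds y. f x = g x"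
    using assms by (simp add: eventually_eventually)
  then show ?thesis by (rule eventually_mono) (rule deriv_cong_ev, auto)
qed

lemma eventually_higher_deriv_cong:
  fixes f g :: "real \<Rightarrow> real"
  assumes "\<forall>\<^sub>F x in nhds a. f x = g x"
  shows "\<forall>\<^sub>F x in nhds a. (deriv ^^ n) f x = (deriv ^^ n) g x"
  by (induction n) (simp_all add: eventually_deriv_cong assms)

text \<open>Differentiation under the integral replaces F by its derivative and k by k + 1. The
  weights s^k are there to make the family closed under differentiation.\<close>

lemma smooth_on_integral:
  fixes F :: "real \<Rightarrow> real"
  assumes "0 < r" "Ck_on \<infinity> {-r<..<r} F"
  shows "Ck_on \<infinity> {-r<..<r} (\<lambda>t. integral (cbox 0 1) (\<lambda>s. s ^ k * F (s * t)))"
proof (rule smooth_on_coinduct[where P="\<lambda>f. \<exists>F k. Ck_on \<infinity> {-r<..<r} F \<and>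
      f = (\<lambda>t. integral (cbox 0 1) (\<lambda>s::real. s ^ k * F (s * t)))"])
  fix f assume "\<exists>F k. Ck_on \<infinity> {-r<..<r} F \<and> f = (\<lambda>t. integral (cbox 0 1) (\<lambda>s::real. s ^ k * F (s * t)))"
  then obtain F k where F: "Ck_on \<infinity> {-r<..<r} F"
    and f: "f = (\<lambda>t. integral (cbox 0 1) (\<lambda>s. s ^ k * F (s * t)))" by blast
  note F' = Ck_on_deriv[OF _ F]
  have m: "s * t \<in> {-r<..<r}" if "s \<in> cbox 0 1" "t \<in> {-r<..<r}" for s t :: real
  proof -
    have "\<bar>s * t\<bar> \<le> 1 * \<bar>t\<bar>" unfolding abs_mult using that by (intro mult_right_mono) auto
    then show ?thesis using that by auto
  qed
  have cF: "continuous_on {-r<..<r} F" "continuous_on {-r<..<r} (deriv F)"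
    using F F' by (auto simp: Ck_on_infinity intro: times_cont_diff_on_continuous)
  have "(f has_real_derivative integral (cbox 0 1) (\<lambda>s. s ^ Suc k * deriv F (s * t))) (at t)"
    if t: "t \<in> {-r<..<r}" for t
  proof -
    have "((\<lambda>t. integral (cbox 0 1) (\<lambda>s. s ^ k * F (s * t))) has_field_derivative
        integral (cbox 0 1) (\<lambda>s. s ^ Suc k * deriv F (s * t))) (at t within {-r<..<r})"
    proof (rule leibniz_rule_field_derivative)
      fix t s :: real assume *: "t \<in> {-r<..<r}" "s \<in> cbox 0 1"
      from F'(2)[OF _ m[OF *(2,1)]]
      have "((\<lambda>t. F (s * t)) has_real_derivative deriv F (s * t) * s) (at t)"
        using DERIV_chain'[of "\<lambda>t. s * t" s t UNIV F "deriv F (s * t)"] by (auto intro!: derivative_eq_intros)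
      then have "((\<lambda>t. s ^ k * F (s * t)) has_real_derivative s ^ k * (deriv F (s * t) * s)) (at t)"
        by (rule DERIV_cmult)
      then show "((\<lambda>t. s ^ k * F (s * t)) has_real_derivative s ^ Suc k * deriv F (s * t))
          (at t within {-r<..<r})"
        by (auto intro: has_field_derivative_at_within simp: ac_simps)
    next
      fix t assume "t \<in> {-r<..<r}"
      then show "(\<lambda>s. s ^ k * F (s * t)) integrable_on cbox 0 1"
        by (intro integrable_continuous continuous_intros continuous_on_compose2[OF cF(1)]) (use m in auto)
    next
      show "continuous_on ({-r<..<r} \<times> cbox 0 1) (\<lambda>(t, s). s ^ Suc k * deriv F (s * t))"
        unfolding split_beta
        by (intro continuous_intros continuous_on_compose2[OF cF(2)]) (use m in auto)
    qed (use t in simp_all)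
    then show ?thesis unfolding f at_within_open[OF t open_greaterThanLessThan] .
  qed
  then show "\<exists>f'. (\<exists>F k. Ck_on \<infinity> {-r<..<r} F \<and> f' = (\<lambda>t. integral (cbox 0 1) (\<lambda>s::real. s ^ k * F (s * t))))
      \<and> (\<forall>x\<in>{-r<..<r}. (f has_vector_derivative f' x) (at x))"
    unfolding has_real_derivative_iff_has_vector_derivative[symmetric]
    using F'(1)[OF open_greaterThanLessThan] by blast
next
  show "\<exists>G l. Ck_on \<infinity> {-r<..<r} G \<and> (\<lambda>t. integral (cbox 0 1) (\<lambda>s. s ^ k * F (s * t))) =
      (\<lambda>t. integral (cbox 0 1) (\<lambda>s::real. s ^ l * G (s * t)))"
    using assms(2) by blast
qed simp

lemma smooth_on_interval:
  fixes f :: "real \<Rightarrow> 'b::real_normed_vector"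
  assumes "smooth_at f 0" "\<forall>\<^sub>F t in nhds 0. P t"
  obtains r where "r > 0" "Ck_on \<infinity> {-r<..<r} f" "\<And>t. t \<in> {-r<..<r} \<Longrightarrow> P t"
proof -
  obtain U where U: "open U" "0 \<in> U" "Ck_on \<infinity> U f" using assms(1) unfolding smooth_at_def by blast
  obtain r1 where "r1 > 0" "ball 0 r1 \<subseteq> U" using U openE by blast
  moreover obtain r2 where "r2 > 0" "\<And>t. dist t 0 < r2 \<Longrightarrow> P t"
    using assms(2) unfolding eventually_nhds_metric by blast
  ultimately show thesis
    using U by (intro that[of "min r1 r2"]) (auto intro!: Ck_on_subset[of \<infinity> U] simp: subset_iff)
qed

text \<open>The case \<open>n = 0\<close> is Hadamard's lemma.\<close>

lemma smooth_at_antiderivative_factor: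
  fixes f r :: "real \<Rightarrow> real"
  assumes "smooth_at r 0" "\<forall>\<^sub>F t in nhds 0. (f has_real_derivative t ^ n * r t) (at t)" "f 0 = 0"
  obtains g where "smooth_at g 0" "\<forall>\<^sub>F t in nhds 0. f t = t ^ Suc n * g t"
proof -
  obtain \<rho> where \<rho>: "\<rho> > 0" "Ck_on \<infinity> {-\<rho><..<\<rho>} r"
    "\<And>t. t \<in> {-\<rho><..<\<rho>} \<Longrightarrow> (f has_real_derivative t ^ n * r t) (at t)"
    using smooth_on_interval[OF assms(1,2)] by metis
  \<comment> \<open>The substitution x = s t in the integral of x^n r(x) from 0 to t pulls out the
    factor t^(n+1).\<close>
  define g where "g t = integral (cbox 0 1) (\<lambda>s. s ^ n * r (s * t))" for t
  have "f t = t ^ Suc n * g t" if t: "t \<in> {-\<rho><..<\<rho>}" for t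
  proof -
    have "((\<lambda>s. t ^ Suc n * (s ^ n * r (s * t))) has_integral f (1 * t) - f (0 * t)) {0..1}"
    proof (rule fundamental_theorem_of_calculus)
      fix s :: real assume s: "s \<in> {0..1}"
      have "\<bar>s * t\<bar> \<le> 1 * \<bar>t\<bar>" unfolding abs_mult using s by (intro mult_right_mono) auto
      then have "s * t \<in> {-\<rho><..<\<rho>}" using t by auto
      then have "((\<lambda>s. f (s * t)) has_real_derivative ((s * t) ^ n * r (s * t)) * t) (at s)"
        by (intro DERIV_chain'[of "\<lambda>s. s * t" t s UNIV f, OF _ \<rho>(3)]) (auto intro!: derivative_eq_intros)
      then show "((\<lambda>s. f (s * t)) has_vector_derivative t ^ Suc n * (s ^ n * r (s * t))) (at s within {0..1})"
        unfolding has_real_derivative_iff_has_vector_derivative[symmetric]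
        by (auto intro: has_field_derivative_at_within simp: power_mult_distrib ac_simps)
    qed simp
    from integral_unique[OF this] have "t ^ Suc n * integral {0..1} (\<lambda>s. s ^ n * r (s * t)) = f t"
      using assms(3) by simp
    then show ?thesis unfolding g_def cbox_interval by simp
  qed
  moreover have "\<forall>\<^sub>F t in nhds 0. t \<in> {-\<rho><..<\<rho>}"
    using \<rho>(1) by (intro eventually_nhds_in_open) auto
  ultimately have "\<forall>\<^sub>F t in nhds 0. f t = t ^ Suc n * g t" by (rule eventually_mono[rotated])
  moreover have "smooth_at g 0"
    unfolding smooth_at_def g_def using smooth_on_integral[OF \<rho>(1,2)] \<rho>(1) by (intro exI[of _ "{-\<rho><..<\<rho>}"]) auto
  ultimately show thesis using that[of g] by blast
qed

lemma smooth_at_hadamard: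
  fixes f :: "real \<Rightarrow> real"
  assumes "smooth_at f 0"
  obtains g where "smooth_at g 0" "\<forall>\<^sub>F t in nhds 0. f t = f 0 + t * g t"
proof -
  have "\<forall>\<^sub>F t in nhds 0. ((\<lambda>t. f t - f 0) has_real_derivative t ^ 0 * deriv f t) (at t)"
    using smooth_at_deriv(2)[OF assms] by eventually_elim (auto intro!: derivative_eq_intros)
  from smooth_at_antiderivative_factor[OF smooth_at_deriv(1)[OF assms] this]
  obtain g where "smooth_at g 0" "\<forall>\<^sub>F t in nhds 0. f t - f 0 = t ^ Suc 0 * g t" by auto
  then show thesis by (intro that[of g]) (auto elim!: eventually_mono)
qed

text \<open>Leibniz rule for t g(t). For n = 0 the factor n annihilates the term in which n - 1 is
  truncated. The constant c fits the form f(0) + t g(t) of Hadamard's lemma.\<close>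

lemma higher_deriv_times_ident:
  fixes g :: "real \<Rightarrow> real"
  assumes "smooth_at g 0"
  shows "\<forall>\<^sub>F t in nhds 0. (deriv ^^ n) (\<lambda>t. c + t * g t) t =
    (if n = 0 then c else 0) + t * (deriv ^^ n) g t + n * (deriv ^^ (n - 1)) g t"
proof (induction n)
  case (Suc n)
  have "\<forall>\<^sub>F t in nhds 0. deriv (\<lambda>t. (if n = 0 then c else 0) + t * (deriv ^^ n) g t + n * (deriv ^^ (n - 1)) g t) t
      = t * (deriv ^^ Suc n) g t + Suc n * (deriv ^^ n) g t"
    using smooth_at_deriv(2)[OF smooth_at_higher_deriv[OF assms, of n]]
      smooth_at_deriv(2)[OF smooth_at_higher_deriv[OF assms, of "n - 1"]]
  proof eventually_elim
    case (elim t)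
    have "n = 0 \<or> deriv ((deriv ^^ (n - 1)) g) t = (deriv ^^ n) g t" by (cases n) auto
    with elim show ?case
      by (intro DERIV_imp_deriv) (auto intro!: derivative_eq_intros simp: algebra_simps)
  qed
  with eventually_deriv_cong[OF Suc] show ?case by eventually_elim simp
qed simp

text \<open>Iterated Hadamard lemma: if f = f(0) + t g, the Taylor coefficients of g are those of f
  shifted by one. In contrast to a Lagrange remainder, the factor r is itself smooth.\<close>

lemma taylor_smooth:
  fixes f :: "real \<Rightarrow> real"
  assumes "smooth_at f 0"
  obtains r where "smooth_at r 0"
    "\<forall>\<^sub>F t in nhds 0. f t = (\<Sum>i<N. (deriv ^^ i) f 0 / fact i * t ^ i) + t ^ N * r t"
proof -
  have "\<exists>r. smooth_at r 0 \<and> (\<forall>\<^sub>F t in nhds 0. f t = (\<Sum>i<N. (deriv ^^ i) f 0 / fact i * t ^ i) + t ^ N * r t)"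
    using assms
  proof (induction N arbitrary: f)
    case (Suc N)
    obtain g where g: "smooth_at g 0" "\<forall>\<^sub>F t in nhds 0. f t = f 0 + t * g t"
      using smooth_at_hadamard[OF Suc.prems] by blast
    obtain r where r: "smooth_at r 0" "\<forall>\<^sub>F t in nhds 0. g t = (\<Sum>i<N. (deriv ^^ i) g 0 / fact i * t ^ i) + t ^ N * r t"
      using Suc.IH[OF g(1)] by blast
    have d: "(deriv ^^ Suc i) f 0 = Suc i * (deriv ^^ i) g 0" for i
      using eventually_nhds_x_imp_x[OF eventually_higher_deriv_cong[OF g(2), of "Suc i"]]
        eventually_nhds_x_imp_x[OF higher_deriv_times_ident[OF g(1), of "Suc i" "f 0"]] by simp
    have c: "(deriv ^^ Suc i) f 0 / fact (Suc i) = (deriv ^^ i) g 0 / fact i" for i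
      unfolding d by simp
    have "\<forall>\<^sub>F t in nhds 0. f t = (\<Sum>i<Suc N. (deriv ^^ i) f 0 / fact i * t ^ i) + t ^ Suc N * r t"
      using g(2) r(2)
    proof eventually_elim
      case (elim t)
      have "f t = f 0 + t * ((\<Sum>i<N. (deriv ^^ i) g 0 / fact i * t ^ i) + t ^ N * r t)"
        using elim by metis
      also have "\<dots> = f 0 + (\<Sum>i<N. (deriv ^^ Suc i) f 0 / fact (Suc i) * t ^ Suc i) + t ^ Suc N * r t"
        unfolding c by (simp add: sum_distrib_left algebra_simps)
      finally show ?case unfolding sum.lessThan_Suc_shift by simp
    qed
    with r(1) show ?case by blast
  qed auto
  then show thesis using that by blast
qed

text \<open>Division by \<open>t ^ n\<close> is only meaningful off \<open>0\<close>; continuity restores the value at \<open>0\<close>.\<close>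

lemma eventually_cancel_power:
  fixes f g :: "real \<Rightarrow> real"
  assumes "\<forall>\<^sub>F t in nhds 0. t ^ n * f t = t ^ n * g t" "isCont f 0" "isCont g 0"
  shows "\<forall>\<^sub>F t in nhds 0. f t = g t"
proof -
  have ne: "\<forall>\<^sub>F t in at 0. f t = g t"
    using assms(1) unfolding eventually_at_filter by (rule eventually_mono) auto
  have "(f \<longlongrightarrow> f 0) (at 0)" "(g \<longlongrightarrow> g 0) (at 0)" using assms(2,3) by (simp_all add: isCont_def)
  then have "f 0 = g 0"
    using tendsto_cong[OF ne] tendsto_unique[of "at 0" f] by (metis trivial_limit_at)
  show ?thesis
    using ne unfolding eventually_at_filter
  proof (rule eventually_mono)
    fix t assume "t \<noteq> 0 \<longrightarrow> t \<in> UNIV \<longrightarrow> f t = g t"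
    then show "f t = g t" using \<open>f 0 = g 0\<close> by (cases "t = 0") auto
  qed
qed


section \<open>Borel's lemma\<close>

text \<open>Differentiating exp(-1/x) produces powers of 1/x; with these included, the family is
  closed under differentiation.\<close>

definition exp_flat :: "nat \<Rightarrow> real \<Rightarrow> real" where
  "exp_flat p x = (if x > 0 then exp (- 1 / x) / x ^ p else 0)"

text \<open>With m = p + 2, exp(1/x) >= (1 + 1/(m x))^m >= (1/(m x))^m. Division by x^p uses up p of
  the m powers of x; the two that remain force a zero derivative at 0.\<close>

lemma exp_flat_le:
  assumes "x > 0"
  shows "exp_flat p x \<le> real (p + 2) ^ (p + 2) * x\<^sup>2"
proof -
  obtain m where m: "m = p + 2" by simp
  define y where "y = real m * x"
  have y: "y > 0" using assms by (simp add: y_def m)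
  have "(1 / y) ^ m \<le> (1 + (1 / x) / m) ^ m"
    using assms y by (intro power_mono) (auto simp: y_def field_simps)
  also have "\<dots> \<le> exp (1 / x)"
    using assms m by (intro exp_ge_one_plus_x_over_n_power_n) (auto intro: order.trans[of _ 0])
  finally have "1 / y ^ m \<le> exp (1 / x)"
    by (simp add: power_one_over)
  then have "1 \<le> exp (1 / x) * y ^ m"
    using y by (simp add: pos_divide_le_eq)
  then have "exp (- 1 / x) \<le> y ^ m"
    by (simp add: exp_minus field_simps)
  also have "y ^ m = real (p + 2) ^ (p + 2) * x\<^sup>2 * x ^ p"
    unfolding y_def power_mult_distrib by (simp add: m power_add power2_eq_square ac_simps)
  finally show ?thesis using assms by (simp add: exp_flat_def pos_divide_le_eq)
qed

lemma DERIV_zero_of_quadratic_bound: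
  fixes f :: "real \<Rightarrow> real"
  assumes "\<forall>\<^sub>F x in nhds 0. \<bar>f x\<bar> \<le> C * x\<^sup>2"
  shows "(f has_real_derivative 0) (at 0)"
proof -
  have f0: "f 0 = 0" using eventually_nhds_x_imp_x[OF assms] by simp
  have "\<forall>\<^sub>F x in at 0. norm (f x / x) \<le> C * \<bar>x\<bar>"
    using assms unfolding eventually_at_filter
    by (rule eventually_mono) (auto simp: field_simps power2_eq_square abs_mult[symmetric] divide_le_eq)
  moreover have "((\<lambda>x. C * \<bar>x\<bar>) \<longlongrightarrow> 0) (at 0)"
    by (auto intro!: tendsto_eq_intros)
  ultimately have "((\<lambda>x. f x / x) \<longlongrightarrow> 0) (at 0)"
    by (rule Lim_null_comparison)
  then show ?thesis using f0 by (simp add: has_field_derivative_iff)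
qed

lemma exp_flat_deriv:
  "(exp_flat p has_real_derivative exp_flat (p + 2) x - p * exp_flat (p + 1) x) (at x)"
proof -
  consider "x > 0" | "x < 0" | "x = 0" by linarith
  then show ?thesis
  proof cases
    case 1
    have "((\<lambda>x. exp (- 1 / x) / x ^ p) has_real_derivative exp_flat (p + 2) x - p * exp_flat (p + 1) x) (at x)"
      using 1 by (auto intro!: derivative_eq_intros simp: exp_flat_def)
        (cases p; simp add: field_simps power2_eq_square)
    then show ?thesis
      by (rule has_field_derivative_transform_within_open[where S="{0<..}"]) (use 1 in \<open>auto simp: exp_flat_def\<close>)
  next
    case 2
    have "((\<lambda>x. 0) has_real_derivative exp_flat (p + 2) x - p * exp_flat (p + 1) x) (at x)"
      using 2 by (auto simp: exp_flat_def)
    then show ?thesis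
      by (rule has_field_derivative_transform_within_open[where S="{..<0}"]) (use 2 in \<open>auto simp: exp_flat_def\<close>)
  next
    case 3
    have "\<bar>exp_flat p x\<bar> \<le> real (p + 2) ^ (p + 2) * x\<^sup>2" for x
      using exp_flat_le[of x p] by (cases "x > 0") (auto simp: exp_flat_def)
    then have "\<forall>\<^sub>F x in nhds 0. \<bar>exp_flat p x\<bar> \<le> real (p + 2) ^ (p + 2) * x\<^sup>2"
      by (intro always_eventually allI)
    moreover have "exp_flat q 0 = 0" for q by (simp add: exp_flat_def)
    ultimately show ?thesis using DERIV_zero_of_quadratic_bound[of "exp_flat p"] 3 by simp
  qed
qed

lemma times_cont_diff_on_exp_flat: "times_cont_diff_on n UNIV (exp_flat p)"
proof (induction n arbitrary: p)
  case 0
  then show ?case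
    using exp_flat_deriv by (auto intro!: continuous_at_imp_continuous_on DERIV_isCont)
next
  case (Suc n)
  show ?case
  proof (rule times_cont_diff_on_real_SucI[OF open_UNIV])
    show "(exp_flat p has_vector_derivative exp_flat (p + 2) x - p * exp_flat (p + 1) x) (at x)" for x
      using exp_flat_deriv by (simp only: has_real_derivative_iff_has_vector_derivative)
  qed (intro times_cont_diff_on_diff times_cont_diff_on_cmult Suc open_UNIV)
qed

lemma Ck_on_UNIVI:
  assumes "\<And>a. smooth_at f a"
  shows "Ck_on \<infinity> UNIV f"
proof -
  have "times_cont_diff_on n UNIV f" if "\<And>a. \<exists>U. open U \<and> a \<in> U \<and> times_cont_diff_on n U f" for n
    and f :: "'a \<Rightarrow> 'b"
    using that
  proof (induction n arbitrary: f)
    case 0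
    then show ?case
      by (metis continuous_at_imp_continuous_on continuous_on_eq_continuous_at times_cont_diff_on.simps(1))
  next
    case (Suc n)
    have "\<exists>U. open U \<and> a \<in> U \<and> times_cont_diff_on n U (\<lambda>x. frechet_derivative f (at x) v)" for a v
      using Suc.prems[of a] times_cont_diff_on_frechet by blast
    moreover have "f differentiable at a" for a
      using Suc.prems[of a] by auto
    ultimately show ?case using Suc.IH by simp
  qed
  moreover have "\<exists>U. open U \<and> a \<in> U \<and> times_cont_diff_on n U f" for a n
    using assms[of a] unfolding smooth_at_def Ck_on_infinity by blast
  ultimately show ?thesis unfolding Ck_on_infinity by simp
qed

lemma bump_function:
  obtains \<psi> :: "real \<Rightarrow> real" where "\<And>a. smooth_at \<psi> a" "\<And>x. \<bar>x\<bar> \<le> 1 \<Longrightarrow> \<psi> x = 1" "\<And>x. \<bar>x\<bar> \<ge> 2 \<Longrightarrow> \<psi> x = 0"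
proof
  let ?e = "exp_flat 0"
  \<comment> \<open>The numerator vanishes for |x| >= 2 and the second summand below for |x| <= 1.
    The denominator is never 0, since 4 - x^2 and x^2 - 1 cannot both be nonpositive.\<close>
  let ?\<psi> = "\<lambda>x::real. ?e (4 - x\<^sup>2) / (?e (4 - x\<^sup>2) + ?e (x\<^sup>2 - 1))"
  have e: "?e y \<ge> 0" "?e y > 0 \<longleftrightarrow> y > 0" for y by (auto simp: exp_flat_def)
  have "smooth_at ?e b" for b
    by (rule smooth_atI) (rule times_cont_diff_on_exp_flat)
  then have s: "smooth_at (\<lambda>x::real. ?e (4 - x\<^sup>2)) a" "smooth_at (\<lambda>x::real. ?e (x\<^sup>2 - 1)) a" for a
    by (rule smooth_at_compose[OF _ _ refl]; intro smooth_intros)+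
  have "?e (4 - x\<^sup>2) + ?e (x\<^sup>2 - 1) \<noteq> 0" for x :: real
    using e[of "4 - x\<^sup>2"] e[of "x\<^sup>2 - 1"] by (cases "x\<^sup>2 > 1") linarith+
  with s show "smooth_at ?\<psi> a" for a by (intro smooth_intros)
  show "?\<psi> x = 1" if "\<bar>x\<bar> \<le> 1" for x
  proof -
    have "x\<^sup>2 \<le> 1" using that by (simp add: abs_square_le_1)
    then show ?thesis by (simp add: exp_flat_def)
  qed
  show "?\<psi> x = 0" if "\<bar>x\<bar> \<ge> 2" for x
  proof -
    have "x\<^sup>2 \<ge> 2\<^sup>2" using that by (metis abs_le_square_iff abs_numeral)
    then show ?thesis by (simp add: exp_flat_def)
  qed
qed

lemma higher_deriv_power_at_0:
  "(deriv ^^ n) (\<lambda>t::real. t ^ m) 0 = (if n = m then fact n else 0)"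
proof (induction m arbitrary: n)
  case 0
  have "(deriv ^^ n) (\<lambda>t::real. c) = (\<lambda>t. if n = 0 then c else 0)" for c
    by (induction n) auto
  then show ?case by simp
next
  case (Suc m)
  have "smooth_at (\<lambda>t::real. t ^ m) 0" by (intro smooth_intros)
  from eventually_nhds_x_imp_x[OF higher_deriv_times_ident[OF this, of n 0]] Suc
  show ?case by (cases n) auto
qed

text \<open>The function is the sum of the terms a n * x^n * \<psi>(\<kappa> n * x). The cutoff does
  not touch the Taylor coefficients at 0, and a large \<kappa> n makes all derivatives of order
  below n small, so every termwise differentiated series converges uniformly.\<close>

lemma borel_lemma:
  fixes a :: "nat \<Rightarrow> real"
  obtains f :: "real \<Rightarrow> real" where "smooth_at f 0" "\<And>n. (deriv ^^ n) f 0 = a n * fact n"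
proof -
  obtain \<psi> :: "real \<Rightarrow> real" where \<psi>: "\<And>a. smooth_at \<psi> a" "\<And>x. \<bar>x\<bar> \<le> 1 \<Longrightarrow> \<psi> x = 1" "\<And>x. \<bar>x\<bar> \<ge> 2 \<Longrightarrow> \<psi> x = 0"
    using bump_function by blast
  define h where "h n x = x ^ n * \<psi> x" for n x
  have sh: "Ck_on \<infinity> UNIV (h n)" for n
    unfolding h_def by (intro Ck_on_UNIVI smooth_intros \<psi>)
  define D where "D j n = (deriv ^^ j) (h n)" for j n
  have DD: "(D j n has_real_derivative D (Suc j) n x) (at x)" for j n x
    using Ck_on_deriv(2)[OF open_UNIV Ck_on_higher_deriv[OF open_UNIV sh]] by (simp add: D_def)
  have D_out: "D j n x = 0" if "\<bar>x\<bar> > 2" for j n x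
  proof -
    have "\<forall>\<^sub>F x in nhds x. h n x = 0"
      using \<psi>(3) that by (intro eventually_nhds_in_open[of "{x. \<bar>x\<bar> > 2}", THEN eventually_mono])
        (auto simp: h_def intro!: open_Collect_less continuous_intros)
    from eventually_higher_deriv_cong[OF this, of j]
    have "D j n x = (deriv ^^ j) (\<lambda>x. 0) x" unfolding D_def by (rule eventually_nhds_x_imp_x)
    also have "(deriv ^^ j) (\<lambda>x::real. 0::real) = (\<lambda>x. 0)" by (induction j) auto
    finally show ?thesis .
  qed
  have D0: "D j n 0 = (if j = n then fact j else 0)" for j n
  proof -
    have "\<forall>\<^sub>F x in nhds 0. h n x = x ^ n"
      using \<psi>(2) by (intro eventually_nhds_in_open[of "{x. \<bar>x\<bar> < 1}", THEN eventually_mono])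
        (auto simp: h_def intro!: open_Collect_less continuous_intros)
    from eventually_nhds_x_imp_x[OF eventually_higher_deriv_cong[OF this, of j]]
    show ?thesis unfolding D_def higher_deriv_power_at_0 .
  qed
  have "\<exists>B. \<forall>x. \<bar>D j n x\<bar> \<le> B" for j n
  proof -
    have "continuous_on {-2..2} (D j n)"
      using DD by (intro continuous_at_imp_continuous_on) (blast intro: DERIV_isCont)
    then have "compact (D j n ` {-2..2})" by (rule compact_continuous_image) simp
    then obtain B where B: "\<forall>y \<in> D j n ` {-2..2}. \<bar>y\<bar> \<le> B"
      using compact_imp_bounded bounded_real by metis
    then have "\<bar>D j n x\<bar> \<le> max B 0" for x
    proof (cases "\<bar>x\<bar> > 2")
      case False
      then have "x \<in> {-2..2}" by auto
      with B show ?thesis by (intro max.coboundedI1) blast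
    qed (use D_out in simp)
    then show ?thesis by blast
  qed
  then obtain B where B: "\<bar>D j n x\<bar> \<le> B j n" for j n x
    by metis
  have B0: "B j n \<ge> 0" for j n using B[of j n 0] by linarith
  define K where "K n = (\<Sum>j<n. B j n)" for n
  have BK: "B j n \<le> K n" if "j < n" for j n
    unfolding K_def using that B0 by (intro member_le_sum[where f="\<lambda>j. B j n"]) auto
  \<comment> \<open>Chosen so that |a n| K n / \<kappa> n <= 2^(-n); the summand 1 keeps \<kappa> n
    away from 0 and makes its powers increase.\<close>
  define \<kappa> where "\<kappa> n = 1 + \<bar>a n\<bar> * K n * 2 ^ n" for n
  have K0: "K n \<ge> 0" for n unfolding K_def using B0 by (intro sum_nonneg)
  then have \<kappa>1: "\<kappa> n \<ge> 1" for n by (simp add: \<kappa>_def)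
  \<comment> \<open>The j-th derivative of a n * x^n * \<psi>(\<kappa> n * x), which equals a n * h
    n (\<kappa> n * x) / \<kappa> n ^ n.\<close>
  define G where "G j n x = a n * \<kappa> n ^ j / \<kappa> n ^ n * D j n (\<kappa> n * x)" for j n x
  have G_deriv: "(G j n has_real_derivative G (Suc j) n x) (at x)" for j n x
  proof -
    have "((\<lambda>x. D j n (\<kappa> n * x)) has_real_derivative D (Suc j) n (\<kappa> n * x) * \<kappa> n) (at x)"
      by (rule DERIV_chain'[OF _ DD]) (auto intro!: derivative_eq_intros)
    from DERIV_cmult[OF this, of "a n * \<kappa> n ^ j / \<kappa> n ^ n"]
    show ?thesis unfolding G_def by (simp add: ac_simps)
  qed
  have G_bound: "\<bar>G j n x\<bar> \<le> (1/2) ^ n" if "j < n" for j n x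
  proof -
    have l: "\<kappa> n > 0" using \<kappa>1[of n] by linarith
    have "\<kappa> n ^ j * \<kappa> n \<le> \<kappa> n ^ n"
      using power_increasing[of "Suc j" n "\<kappa> n"] \<kappa>1[of n] that by (simp add: ac_simps)
    then have "\<kappa> n ^ j / \<kappa> n ^ n \<le> 1 / \<kappa> n" using l by (simp add: field_simps)
    then have "\<bar>a n\<bar> * (\<kappa> n ^ j / \<kappa> n ^ n) * \<bar>D j n (\<kappa> n * x)\<bar> \<le> \<bar>a n\<bar> * (1 / \<kappa> n) * K n"
      using B[of j n "\<kappa> n * x"] BK[OF that] l by (intro mult_mono) auto
    also have "\<dots> \<le> (1/2) ^ n"
    proof -
      have "\<bar>a n\<bar> * K n * 2 ^ n \<le> \<kappa> n" by (simp add: \<kappa>_def)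
      then show ?thesis using l by (simp add: field_simps power_divide)
    qed
    finally show ?thesis using l by (simp add: G_def abs_mult)
  qed
  define S where "S j x = (\<Sum>n. G j n x)" for j x
  have S_deriv: "(S j has_real_derivative S (Suc j) x) (at x)" for j x
    unfolding S_def[abs_def]
  proof (rule has_field_derivative_series'(2)[where S=UNIV and ?x0.0=0 and f="G j" and f'="G (Suc j)"])
    show "uniformly_convergent_on UNIV (\<lambda>n x. \<Sum>i<n. G (Suc j) i x)"
      by (rule Weierstrass_m_test'_ev[where M="\<lambda>n. (1/2) ^ n"])
        (auto intro!: eventually_mono[OF eventually_gt_at_top[of "Suc j"]] G_bound)
    show "summable (\<lambda>n. G j n 0)"
      by (rule summable_comparison_test_ev[where g="\<lambda>n. (1/2) ^ n"])
        (auto intro!: eventually_mono[OF eventually_gt_at_top[of "j"]] G_bound)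
  qed (auto simp: G_deriv)
  have "Ck_on \<infinity> UNIV (S 0)"
  proof (rule smooth_on_coinduct[where P="\<lambda>f. \<exists>j. f = S j"])
    fix f assume "\<exists>j. f = S j"
    then show "\<exists>f'. (\<exists>j. f' = S j) \<and> (\<forall>x\<in>UNIV. (f has_vector_derivative f' x) (at x))"
      using S_deriv by (auto simp flip: has_real_derivative_iff_has_vector_derivative)
  qed auto
  moreover have "(deriv ^^ n) (S 0) = S n" for n
  proof (induction n)
    case (Suc n)
    then show ?case using DERIV_imp_deriv[OF S_deriv] by auto
  qed simp
  moreover have "S n 0 = a n * fact n" for n
  proof -
    have "G n m 0 = (if m = n then a n * fact n else 0)" for m
      using \<kappa>1[of n] by (simp add: G_def D0)
    then show ?thesis unfolding S_def using sums_single[of n "\<lambda>m. a n * fact n"] by (simp add: sums_iff)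
  qed
  ultimately show thesis
    by (intro that[of "S 0"]) (auto simp: smooth_at_def intro!: exI[of _ UNIV])
qed


section \<open>Smooth functions of one variable as a module over the functions of a power\<close>

text \<open>Divisibility by every power with a smooth quotient, rather than vanishing of all
  derivatives, is the form in which flatness is applied.\<close>

definition flat_at_0 :: "(real \<Rightarrow> real) \<Rightarrow> bool" where
  "flat_at_0 r \<longleftrightarrow> smooth_at r 0 \<and> (\<forall>N. \<exists>g. smooth_at g 0 \<and> (\<forall>\<^sub>F t in nhds 0. r t = t ^ N * g t))"

lemma flat_at_0_deriv:
  assumes "flat_at_0 r"
  shows "flat_at_0 (deriv r)"
  unfolding flat_at_0_def
proof (intro conjI allI)
  show "smooth_at (deriv r) 0" using assms by (simp add: flat_at_0_def smooth_at_deriv(1))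
  fix N
  obtain g where g: "smooth_at g 0" "\<forall>\<^sub>F t in nhds 0. r t = t ^ Suc N * g t"
    using assms unfolding flat_at_0_def by meson
  have "\<forall>\<^sub>F t in nhds 0. deriv r t = t ^ N * (Suc N * g t + t * deriv g t)"
    using eventually_deriv_cong[OF g(2)] smooth_at_deriv(2)[OF g(1)]
  proof eventually_elim
    case (elim t)
    have "((\<lambda>t. t ^ Suc N * g t) has_real_derivative (Suc N * t ^ N) * g t + deriv g t * t ^ Suc N) (at t)"
      using DERIV_mult[OF DERIV_pow[of "Suc N" t UNIV] elim(2)] by simp
    then show ?case unfolding elim(1) by (simp add: DERIV_imp_deriv algebra_simps)
  qed
  moreover have "smooth_at (\<lambda>t. Suc N * g t + t * deriv g t) 0"
    by (intro smooth_intros g smooth_at_deriv(1))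
  ultimately show "\<exists>g. smooth_at g 0 \<and> (\<forall>\<^sub>F t in nhds 0. deriv r t = t ^ N * g t)"
    by blast
qed

lemma flat_at_0_bound:
  assumes "flat_at_0 r"
  shows "\<forall>\<^sub>F t in nhds 0. \<bar>r t\<bar> \<le> \<bar>t\<bar> ^ N"
proof -
  obtain g where g: "smooth_at g 0" "\<forall>\<^sub>F t in nhds 0. r t = t ^ Suc N * g t"
    using assms unfolding flat_at_0_def by meson
  have "smooth_at (\<lambda>t. t * g t) 0" by (intro smooth_intros g)
  then have "isCont (\<lambda>t. t * g t) 0" by (rule smooth_at_isCont)
  then have "\<forall>\<^sub>F t in nhds 0. t * g t \<in> {-1<..<1}"
    by (rule isCont_eventually_nhds) (rule eventually_nhds_in_open; simp)
  with g(2) show ?thesis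
  proof eventually_elim
    case (elim t)
    have "\<bar>r t\<bar> = \<bar>t\<bar> ^ N * \<bar>t * g t\<bar>" unfolding elim(1) by (simp add: abs_mult power_abs)
    also have "\<dots> \<le> \<bar>t\<bar> ^ N * 1" using elim(2) by (intro mult_left_mono) auto
    finally show ?case by simp
  qed
qed

text \<open>Differentiating r(root k x) brings in negative powers of root k x. At 0 they are
  outweighed by the flatness of r and its derivatives, so the quotients B form a family closed under
  differentiation.\<close>

lemma smooth_at_flat_root:
  assumes "flat_at_0 r" "k > 0"
  shows "smooth_at (\<lambda>x. if x > 0 then r (root k x) else 0) 0"
proof -
  obtain \<rho> where \<rho>: "\<rho> > 0" "Ck_on \<infinity> {-\<rho><..<\<rho>} r"
    using smooth_on_interval[of r "\<lambda>_. True"] assms(1) by (auto simp: flat_at_0_def)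
  define D where "D j = (deriv ^^ j) r" for j
  have DD: "(D j has_real_derivative D (Suc j) t) (at t)" if "t \<in> {-\<rho><..<\<rho>}" for j t
    using Ck_on_deriv(2)[OF _ Ck_on_higher_deriv[OF _ \<rho>(2)] that] by (simp add: D_def)
  have Dflat: "flat_at_0 (D j)" for j
    unfolding D_def by (induction j) (simp_all add: assms(1) flat_at_0_deriv)
  define B where "B p j x = (if x > 0 then D j (root k x) / root k x ^ p else 0)" for p j x
  let ?S = "{..<\<rho> ^ k}"
  \<comment> \<open>With t = root k x, dt/dx = 1 / (k t^(k-1)), so the two terms in the derivative
    of D j t / t^p get the exponents p + k - 1 and p + k. The subtraction is genuine since k >
    0.\<close>
  define B' where "B' p j x = inverse k * (B (p + k - 1) (Suc j) x - p * B (p + k) j x)" for p j x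
  have B_deriv: "(B p j has_real_derivative B' p j x) (at x)" if x: "x \<in> ?S" for p j x
  proof -
    consider "x > 0" | "x < 0" | "x = 0" by linarith
    then show ?thesis
    proof cases
      case 1
      define t where "t = root k x"
      have t0: "t > 0" using 1 assms(2) by (simp add: t_def)
      have "root k x < root k (\<rho> ^ k)" using x assms(2) by simp
      then have "t < \<rho>" using \<rho>(1) assms(2) by (simp add: t_def real_root_power_cancel)
      with t0 have t: "t \<in> {-\<rho><..<\<rho>}" by simp
      have "((\<lambda>t. D j t / t ^ p) has_real_derivative D (Suc j) t / t ^ p - p * D j t / t ^ (p + 1)) (at t)"
        using t0 by (auto intro!: derivative_eq_intros DD[OF t]) (cases p; simp add: field_simps)
      from DERIV_chain'[OF DERIV_real_root[OF assms(2) 1] this[unfolded t_def]]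
      have "((\<lambda>x. D j (root k x) / root k x ^ p) has_real_derivative
          (D (Suc j) t / t ^ p - p * D j t / t ^ (p + 1)) * inverse (k * t ^ (k - Suc 0))) (at x)"
        unfolding t_def .
      moreover have "(D (Suc j) t / t ^ p - p * D j t / t ^ (p + 1)) * inverse (k * t ^ (k - Suc 0)) = B' p j x"
      proof -
        obtain l where "k = Suc l" using assms(2) gr0_implies_Suc by blast
        then show ?thesis using 1 t0 unfolding B'_def B_def t_def[symmetric]
          by (simp add: power_add field_simps)
      qed
      ultimately have "((\<lambda>x. D j (root k x) / root k x ^ p) has_real_derivative B' p j x) (at x)" by simp
      then show ?thesis
        by (rule has_field_derivative_transform_within_open[where S="{0<..}"]) (use 1 in \<open>auto simp: B_def\<close>)
    next
      case 2
      have "((\<lambda>x. 0) has_real_derivative B' p j x) (at x)" using 2 by (simp add: B'_def B_def)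
      then show ?thesis
        by (rule has_field_derivative_transform_within_open[where S="{..<0}"]) (use 2 in \<open>auto simp: B_def\<close>)
    next
      case 3
      \<comment> \<open>The exponent p + 2 k leaves t^(2k) = x^2 after division by t^p, and a
        quadratic bound gives derivative 0.\<close>
      obtain d where d: "d > 0" "\<And>t. \<bar>t\<bar> < d \<Longrightarrow> \<bar>D j t\<bar> \<le> \<bar>t\<bar> ^ (p + 2 * k)"
        using flat_at_0_bound[OF Dflat, of j "p + 2 * k"] unfolding eventually_nhds_metric by (auto simp: dist_real_def)
      have "\<bar>B p j x\<bar> \<le> 1 * x\<^sup>2" if x: "x < d ^ k" for x
      proof (cases "x > 0")
        case True
        define t where "t = root k x"
        have t0: "t > 0" "t ^ k = x" using True assms(2) by (simp_all add: t_def)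
        have "root k x < root k (d ^ k)" using x assms(2) by simp
        then have "\<bar>t\<bar> < d" using t0(1) d(1) assms(2) by (simp add: t_def real_root_power_cancel)
        from d(2)[OF this] have "\<bar>D j t\<bar> \<le> t ^ p * (t ^ k)\<^sup>2"
          using t0(1) by (simp add: power_add power_mult mult.commute[of 2])
        then have "\<bar>D j t\<bar> / t ^ p \<le> x\<^sup>2" using t0 by (simp add: pos_divide_le_eq mult.commute)
        then show ?thesis using True t0(1) by (simp add: B_def t_def[symmetric] abs_divide)
      qed (simp add: B_def)
      moreover have "\<forall>\<^sub>F x in nhds 0. x \<in> {..<d ^ k}"
        using d(1) by (intro eventually_nhds_in_open) auto
      ultimately have "\<forall>\<^sub>F x in nhds 0. \<bar>B p j x\<bar> \<le> 1 * x\<^sup>2"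
        by (auto elim: eventually_mono)
      moreover have "B q i 0 = 0" for q i by (simp add: B_def)
      ultimately show ?thesis using DERIV_zero_of_quadratic_bound[of "B p j" 1] 3 by (simp add: B'_def)
    qed
  qed
  have "times_cont_diff_on n ?S (B p j)" for n p j
  proof (induction n arbitrary: p j)
    case 0
    have "continuous_on ?S (B p j)"
      using B_deriv by (intro continuous_at_imp_continuous_on) (blast intro: DERIV_isCont)
    then show ?case by simp
  next
    case (Suc n)
    show ?case
    proof (rule times_cont_diff_on_real_SucI)
      show "(B p j has_vector_derivative B' p j x) (at x)" if "x \<in> ?S" for x
        using B_deriv[OF that] by (simp only: has_real_derivative_iff_has_vector_derivative)
      show "times_cont_diff_on n ?S (B' p j)"
        unfolding B'_def by (intro times_cont_diff_on_diff times_cont_diff_on_cmult Suc open_lessThan)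
    qed simp
  qed
  then have "smooth_at (B 0 0) 0"
    unfolding smooth_at_def Ck_on_infinity using \<rho>(1) by (intro exI[of _ ?S]) auto
  moreover have "B 0 0 = (\<lambda>x. if x > 0 then r (root k x) else 0)"
    by (auto simp: B_def D_def)
  ultimately show ?thesis by simp
qed

lemma flat_at_0_even_part:
  assumes "flat_at_0 r"
  shows "flat_at_0 (\<lambda>t. (r t + r (- t)) / 2)"
  unfolding flat_at_0_def
proof (intro conjI allI)
  have refl: "smooth_at (\<lambda>t. g (- t)) 0" if "smooth_at g 0" for g :: "real \<Rightarrow> real"
    by (rule smooth_at_compose[OF that smooth_at_minus[OF smooth_at_ident]]) simp
  show "smooth_at (\<lambda>t. (r t + r (- t)) / 2) 0"
    using assms by (intro smooth_intros refl) (auto simp: flat_at_0_def)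
  fix N
  obtain g where g: "smooth_at g 0" "\<forall>\<^sub>F t in nhds 0. r t = t ^ N * g t"
    using assms unfolding flat_at_0_def by meson
  have "\<forall>\<^sub>F t in nhds 0. r (- t) = (- t) ^ N * g (- t)"
    using isCont_eventually_nhds[where f="\<lambda>t::real. - t" and a=0] g(2) by simp
  with g(2) have "\<forall>\<^sub>F t in nhds 0. (r t + r (- t)) / 2 = t ^ N * ((g t + (- 1) ^ N * g (- t)) / 2)"
  proof eventually_elim
    case (elim t)
    show ?case unfolding elim power_minus[of t N] by (simp add: algebra_simps add_divide_distrib)
  qed
  moreover have "smooth_at (\<lambda>t. (g t + (- 1) ^ N * g (- t)) / 2) 0"
    by (intro smooth_intros refl g) simp
  ultimately show "\<exists>g. smooth_at g 0 \<and> (\<forall>\<^sub>F t in nhds 0. (r t + r (- t)) / 2 = t ^ N * g t)"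
    by blast
qed

text \<open>For even k, root k (t^k) = |t|, and evenness of r makes |t| as good as t.\<close>

lemma flat_even_function_of_power:
  assumes "flat_at_0 r" "\<And>t. r (- t) = r t" "even k" "k > 0"
  obtains b where "smooth_at b 0" "\<And>t. r t = b (t ^ k)"
proof
  show "smooth_at (\<lambda>x. if x > 0 then r (root k x) else 0) 0"
    by (rule smooth_at_flat_root) fact+
  fix t :: real
  have "r 0 = 0" using eventually_nhds_x_imp_x[OF flat_at_0_bound[OF assms(1), of 1]] by simp
  moreover have "r t = r (root k (t ^ k))"
  proof -
    have "root k (t ^ k) = \<bar>t\<bar>"
      using assms(3,4) real_root_power_cancel[of k "\<bar>t\<bar>"] by (simp add: power_even_abs)
    then show ?thesis using assms(2)[of t] by (auto simp: abs_if)
  qed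
  ultimately show "r t = (if t ^ k > 0 then r (root k (t ^ k)) else 0)"
    using assms(3,4) by (auto simp: zero_less_power_eq)
qed

lemma flat_at_0_divide:
  assumes "flat_at_0 r"
  obtains s where "flat_at_0 s" "\<forall>\<^sub>F t in nhds 0. r t = t * s t"
proof -
  obtain s where s: "smooth_at s 0" "\<forall>\<^sub>F t in nhds 0. r t = t ^ 1 * s t"
    using assms unfolding flat_at_0_def by meson
  have "\<exists>g. smooth_at g 0 \<and> (\<forall>\<^sub>F t in nhds 0. s t = t ^ N * g t)" for N
  proof -
    obtain g where g: "smooth_at g 0" "\<forall>\<^sub>F t in nhds 0. r t = t ^ Suc N * g t"
      using assms unfolding flat_at_0_def by meson
    have "\<forall>\<^sub>F t in nhds 0. t ^ 1 * s t = t ^ 1 * (t ^ N * g t)"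
      using s(2) g(2) by eventually_elim (simp only: power_one_right power_Suc mult.assoc)
    then have "\<forall>\<^sub>F t in nhds 0. s t = t ^ N * g t"
      by (rule eventually_cancel_power) (intro smooth_at_isCont smooth_intros s g)+
    with g(1) show ?thesis by blast
  qed
  with s show thesis by (intro that[of s]) (simp_all add: flat_at_0_def)
qed

text \<open>Division of the exponents by k with remainder i; the residue class of i will belong to
  the coefficient of t^i.\<close>

lemma sum_lessThan_mult:
  fixes g :: "nat \<Rightarrow> real"
  shows "(\<Sum>i<k. \<Sum>n<N. g (k * n + i)) = sum g {..<k * N}"
proof -
  have "sum g {..<k * N} = (\<Sum>n<N. sum g {n * k..<n * k + k})"
    using sum.nat_group[of g k N] by (simp add: mult.commute)
  also have "\<dots> = (\<Sum>n<N. \<Sum>i<k. g (k * n + i))"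
  proof (rule sum.cong)
    show "sum g {m * k..<m * k + k} = (\<Sum>i<k. g (k * m + i))" for m
      using sum.shift_bounds_nat_ivl[of g 0 "m * k" k] by (simp add: ac_simps lessThan_atLeast0)
  qed simp
  finally show ?thesis by (subst sum.swap) simp
qed

text \<open>Borel's lemma provides the \<open>a i\<close> up to a flat remainder. The even part of a flat germ, extended
  by \<open>0\<close> to the negative half-line, is a smooth function of \<open>t ^ k\<close>, and so is its odd part divided by
  \<open>t\<close>.\<close>

lemma smooth_at_power_decomposition:
  fixes f :: "real \<Rightarrow> real"
  assumes "smooth_at f 0" "even k" "k > 0"
  obtains a :: "nat \<Rightarrow> real \<Rightarrow> real" where "\<And>i. smooth_at (a i) 0" "\<forall>\<^sub>F t in nhds 0. f t = (\<Sum>i<k. t ^ i * a i (t ^ k))"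
proof -
  define c where "c n = (deriv ^^ n) f 0 / fact n" for n
  \<comment> \<open>b takes over the Taylor coefficients of f in the residue class of i modulo k, so
    f and the sum of the t^i b i (t^k) have the same formal series.\<close>
  have "\<exists>b. smooth_at b 0 \<and> (\<forall>n. (deriv ^^ n) b 0 = c (k * n + i) * fact n)" for i
    using borel_lemma[of "\<lambda>n. c (k * n + i)"] by metis
  then have "\<forall>i. \<exists>b. smooth_at b 0 \<and> (\<forall>n. (deriv ^^ n) b 0 = c (k * n + i) * fact n)" by (rule allI)
  from choice[OF this] obtain b where b: "\<And>i. smooth_at (b i) 0" "\<And>i n. (deriv ^^ n) (b i) 0 = c (k * n + i) * fact n"
    by blast
  have pow: "smooth_at (\<lambda>t. g (t ^ k)) 0" if "smooth_at g 0" for g :: "real \<Rightarrow> real"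
    by (rule smooth_at_compose[OF that]) (use assms(3) in \<open>auto intro: smooth_intros\<close>)
  have evpow: "\<forall>\<^sub>F t in nhds 0. P (t ^ k)" if "\<forall>\<^sub>F x in nhds (0::real). P x" for P
    using isCont_eventually_nhds[where f="\<lambda>t::real. t ^ k" and a=0 and P=P] that assms(3) by (simp add: zero_power)
  define r where "r t = f t - (\<Sum>i<k. t ^ i * b i (t ^ k))" for t
  have "flat_at_0 r"
    unfolding flat_at_0_def
  proof (intro conjI allI)
    show "smooth_at r 0" unfolding r_def by (intro smooth_intros pow b assms(1))
    fix N
    obtain R where R: "smooth_at R 0" "\<forall>\<^sub>F t in nhds 0. f t = (\<Sum>i<k * N. c i * t ^ i) + t ^ (k * N) * R t"
      using taylor_smooth[OF assms(1), of "k * N"] unfolding c_def by blast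
    have "\<exists>R. smooth_at R 0 \<and> (\<forall>\<^sub>F x in nhds 0. b i x = (\<Sum>n<N. c (k * n + i) * x ^ n) + x ^ N * R x)" for i
    proof -
      have coeff: "(deriv ^^ n) (b i) 0 / fact n = c (k * n + i)" for n by (simp add: b(2))
      from taylor_smooth[OF b(1)[of i], of N, unfolded coeff] show ?thesis by blast
    qed
    then have "\<forall>i. \<exists>R. smooth_at R 0 \<and> (\<forall>\<^sub>F x in nhds 0. b i x = (\<Sum>n<N. c (k * n + i) * x ^ n) + x ^ N * R x)"
      by (rule allI)
    from choice[OF this] obtain S where S: "\<And>i. smooth_at (S i) 0"
      "\<And>i. \<forall>\<^sub>F x in nhds 0. b i x = (\<Sum>n<N. c (k * n + i) * x ^ n) + x ^ N * S i x" by blast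
    have "\<forall>\<^sub>F t in nhds 0. \<forall>i\<in>{..<k}. b i (t ^ k) = (\<Sum>n<N. c (k * n + i) * (t ^ k) ^ n) + (t ^ k) ^ N * S i (t ^ k)"
      by (intro eventually_ball_finite ballI evpow S(2)) simp
    with R(2) have "\<forall>\<^sub>F t in nhds 0. r t = t ^ N * (t ^ ((k - 1) * N) * (R t - (\<Sum>i<k. t ^ i * S i (t ^ k))))"
    proof eventually_elim
      case (elim t)
      have "(\<Sum>i<k. t ^ i * b i (t ^ k)) =
          (\<Sum>i<k. \<Sum>n<N. c (k * n + i) * t ^ (k * n + i)) + t ^ (k * N) * (\<Sum>i<k. t ^ i * S i (t ^ k))"
        using elim(2) by (simp add: sum.distrib[symmetric] sum_distrib_left power_add power_mult[symmetric] algebra_simps)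
      also have "(\<Sum>i<k. \<Sum>n<N. c (k * n + i) * t ^ (k * n + i)) = (\<Sum>i<k * N. c i * t ^ i)"
        by (rule sum_lessThan_mult)
      finally have "r t = t ^ (k * N) * (R t - (\<Sum>i<k. t ^ i * S i (t ^ k)))"
        unfolding r_def elim(1) by (simp add: algebra_simps)
      also have "t ^ (k * N) = t ^ N * t ^ ((k - 1) * N)"
        using assms(3) by (cases k) (simp_all add: power_add)
      finally show ?case by simp
    qed
    moreover have "smooth_at (\<lambda>t. t ^ ((k - 1) * N) * (R t - (\<Sum>i<k. t ^ i * S i (t ^ k)))) 0"
      by (intro smooth_intros R S pow)
    ultimately show "\<exists>g. smooth_at g 0 \<and> (\<forall>\<^sub>F t in nhds 0. r t = t ^ N * g t)" by blast
  qed
  \<comment> \<open>After division by t, the odd part of r becomes the even part of s, to which the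
    same lemma applies.\<close>
  then obtain s where s: "flat_at_0 s" "\<forall>\<^sub>F t in nhds 0. r t = t * s t" by (rule flat_at_0_divide)
  obtain e0 where e0: "smooth_at e0 0" "\<And>t. (r t + r (- t)) / 2 = e0 (t ^ k)"
    by (rule flat_even_function_of_power[OF flat_at_0_even_part[OF \<open>flat_at_0 r\<close>] _ assms(2,3)]) (auto simp: add.commute)
  obtain e1 where e1: "smooth_at e1 0" "\<And>t. (s t + s (- t)) / 2 = e1 (t ^ k)"
    by (rule flat_even_function_of_power[OF flat_at_0_even_part[OF s(1)] _ assms(2,3)]) (auto simp: add.commute)
  have "\<forall>\<^sub>F t in nhds 0. r (- t) = - t * s (- t)"
    using isCont_eventually_nhds[where f="\<lambda>t::real. - t" and a=0 and P="\<lambda>t. r t = t * s t"] s(2) by simp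
  with s(2) have r: "\<forall>\<^sub>F t in nhds 0. r t = e0 (t ^ k) + t * e1 (t ^ k)"
    by eventually_elim (simp add: e0(2)[symmetric] e1(2)[symmetric] field_simps)
  \<comment> \<open>The flat remainder e0 + t e1 is absorbed in the coefficients of 1 and t, both of
    which occur because k is even and positive.\<close>
  define a where "a i x = b i x + (if i = 0 then e0 x else if i = 1 then e1 x else 0)" for i x
  obtain l where k: "k = Suc (Suc l)"
    using assms(2,3) by (cases k; cases "k - 1") auto
  show thesis
  proof (rule that[of a])
    show "smooth_at (a i) 0" for i
      unfolding a_def by (cases "i = 0"; cases "i = 1"; simp; intro smooth_intros b e0 e1)
    show "\<forall>\<^sub>F t in nhds 0. f t = (\<Sum>i<k. t ^ i * a i (t ^ k))"
      using r
    proof eventually_elim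
      case (elim t)
      have "(\<Sum>i<k. t ^ i * (if i = 0 then e0 (t ^ k) else if i = 1 then e1 (t ^ k) else 0)) = e0 (t ^ k) + t * e1 (t ^ k)"
        unfolding k sum.lessThan_Suc_shift by simp
      then show ?case
        using elim by (simp add: r_def a_def distrib_left sum.distrib del: power_Suc)
    qed
  qed
qed


section \<open>Recognising equivalence with a monomial curve\<close>

text \<open>The constructions give E o \<tau> = \<Psi> o \<delta>, with the normal form on the
  source side; inverting both germs gives the orientation of \<open>Ck_equivalent\<close>.\<close>

lemma Ck_equivalentI:
  assumes "Ck_diffeo_germ k \<tau> 0 0" "Ck_diffeo_germ k \<Psi> 0 (E 0)" "isCont \<delta> 0" "\<delta> 0 = 0"
    and "\<forall>\<^sub>F s in nhds 0. E (\<tau> s) = \<Psi> (\<delta> s)"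
  shows "Ck_equivalent k E \<delta>"
proof -
  obtain \<phi> where \<phi>: "Ck_diffeo_germ k \<phi> 0 0" "\<forall>\<^sub>F t in nhds 0. \<tau> (\<phi> t) = t"
    using Ck_diffeo_germ_inverse[OF assms(1)] by metis
  obtain \<Phi> where \<Phi>: "Ck_diffeo_germ k \<Phi> (E 0) 0" "\<forall>\<^sub>F y in nhds 0. \<Phi> (\<Psi> y) = y"
    using Ck_diffeo_germ_inverse[OF assms(2)] by metis
  have \<phi>0: "isCont \<phi> 0" "\<phi> 0 = 0"
    using Ck_diffeo_germ_isCont[OF \<phi>(1)] \<phi>(1) by (simp_all add: Ck_diffeo_germ_def)
  have ev: "\<forall>\<^sub>F t in nhds 0. P (\<phi> t)" if "\<forall>\<^sub>F s in nhds 0. P s" for P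
    by (rule isCont_eventually_nhds[OF \<phi>0(1)]) (simp add: \<phi>0(2) that)
  have "\<forall>\<^sub>F s in nhds 0. \<Phi> (\<Psi> (\<delta> s)) = \<delta> s"
    by (rule isCont_eventually_nhds[OF assms(3)]) (simp add: assms(4) \<Phi>(2))
  from ev[OF this] ev[OF assms(5)] \<phi>(2) have "\<forall>\<^sub>F t in nhds 0. \<delta> (\<phi> t) = \<Phi> (E t)"
    by eventually_elim metis
  then show ?thesis unfolding Ck_equivalent_def assms(4) using \<phi>(1) \<Phi>(1) by blast
qed

section \<open>Smooth functions of the coordinates of \<delta>\<close>

definition in_ring :: "(real \<Rightarrow> real \<times> real) \<Rightarrow> (real \<Rightarrow> real) \<Rightarrow> bool" where
  "in_ring \<delta> f \<longleftrightarrow> (\<exists>F. smooth_at F 0 \<and> (\<forall>\<^sub>F s in nhds 0. f s = F (\<delta> s)))"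

text \<open>The pair (p, q) records the linear part of some extension F of f to the plane. F is not
  determined by f, but the linear parts of two chosen extensions decide whether together they form a
  local diffeomorphism.\<close>

definition pullback :: "(real \<Rightarrow> real \<times> real) \<Rightarrow> real \<Rightarrow> real \<Rightarrow> (real \<Rightarrow> real) \<Rightarrow> bool" where
  "pullback \<delta> p q f \<longleftrightarrow> (\<exists>F. smooth_at F 0 \<and> (F has_derivative (\<lambda>v. p * fst v + q * snd v)) (at 0) \<and>
     (\<forall>\<^sub>F s in nhds 0. f s = F (\<delta> s)))"

lemma in_ring_const: "in_ring \<delta> (\<lambda>s. c)"
  unfolding in_ring_def by (intro exI[of _ "\<lambda>_. c"]) (simp add: smooth_intros)

lemma in_ring_fst: "in_ring \<delta> (\<lambda>s. fst (\<delta> s))" and in_ring_snd: "in_ring \<delta> (\<lambda>s. snd (\<delta> s))"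
  unfolding in_ring_def by (intro exI[of _ fst] exI[of _ snd] conjI smooth_intros always_eventually; simp)+

lemma in_ring_binary:
  assumes "in_ring \<delta> f" "in_ring \<delta> g"
    and "\<And>F G. smooth_at F (0 :: real \<times> real) \<Longrightarrow> smooth_at G 0 \<Longrightarrow> smooth_at (\<lambda>x. h (F x) (G x)) 0"
  shows "in_ring \<delta> (\<lambda>s. h (f s) (g s))"
proof -
  obtain F G where FG: "smooth_at F 0" "smooth_at G 0"
    and e: "\<forall>\<^sub>F s in nhds 0. f s = F (\<delta> s)" "\<forall>\<^sub>F s in nhds 0. g s = G (\<delta> s)"
    using assms(1,2) unfolding in_ring_def by blast
  from e have "\<forall>\<^sub>F s in nhds 0. h (f s) (g s) = h (F (\<delta> s)) (G (\<delta> s))" by eventually_elim simp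
  then show ?thesis unfolding in_ring_def using assms(3)[OF FG] by (intro exI[of _ "\<lambda>x. h (F x) (G x)"]) simp
qed

lemma in_ring_add: "in_ring \<delta> f \<Longrightarrow> in_ring \<delta> g \<Longrightarrow> in_ring \<delta> (\<lambda>s. f s + g s)"
  by (rule in_ring_binary; (assumption | intro smooth_intros))

lemma in_ring_diff: "in_ring \<delta> f \<Longrightarrow> in_ring \<delta> g \<Longrightarrow> in_ring \<delta> (\<lambda>s. f s - g s)"
  by (rule in_ring_binary; (assumption | intro smooth_intros))

lemma in_ring_mult: "in_ring \<delta> f \<Longrightarrow> in_ring \<delta> g \<Longrightarrow> in_ring \<delta> (\<lambda>s. f s * g s)"
  by (rule in_ring_binary; (assumption | intro smooth_intros))

lemma in_ring_power: "in_ring \<delta> f \<Longrightarrow> in_ring \<delta> (\<lambda>s. f s ^ n)"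
  by (induction n) (simp_all add: in_ring_const in_ring_mult)

lemma in_ring_compose:
  assumes "in_ring \<delta> f" "smooth_at A (f 0)" "\<delta> 0 = 0"
  shows "in_ring \<delta> (\<lambda>s. A (f s))"
proof -
  obtain F where F: "smooth_at F 0" "\<forall>\<^sub>F s in nhds 0. f s = F (\<delta> s)"
    using assms(1) unfolding in_ring_def by blast
  have "F 0 = f 0" using eventually_nhds_x_imp_x[OF F(2)] assms(3) by simp
  then have "smooth_at (\<lambda>x. A (F x)) 0" using smooth_at_compose[OF assms(2) F(1)] by simp
  moreover have "\<forall>\<^sub>F s in nhds 0. A (f s) = A (F (\<delta> s))" using F(2) by eventually_elim simp
  ultimately show ?thesis unfolding in_ring_def by blast
qed

lemma in_ring_divide:
  assumes "in_ring \<delta> f" "in_ring \<delta> g" "g 0 \<noteq> 0" "\<delta> 0 = 0"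
  shows "in_ring \<delta> (\<lambda>s. f s / g s)"
proof -
  have "smooth_at inverse (g 0)" by (rule smooth_at_inverse[OF smooth_at_ident assms(3)])
  from in_ring_mult[OF assms(1) in_ring_compose[OF assms(2) this assms(4)]]
  show ?thesis by (simp add: divide_inverse)
qed

lemma pullback_cong: "pullback \<delta> p q f \<Longrightarrow> \<forall>\<^sub>F s in nhds 0. g s = f s \<Longrightarrow> pullback \<delta> p q g"
  unfolding pullback_def by (elim exE conjE, rule exI, intro conjI, assumption, assumption) (auto elim: eventually_elim2)

lemma pullback_add:
  assumes "pullback \<delta> p q f" "pullback \<delta> p' q' g"
  shows "pullback \<delta> (p + p') (q + q') (\<lambda>s. f s + g s)"
proof -
  obtain F where F: "smooth_at F 0" "(F has_derivative (\<lambda>v. p * fst v + q * snd v)) (at 0)"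
    "\<forall>\<^sub>F s in nhds 0. f s = F (\<delta> s)" using assms(1) unfolding pullback_def by blast
  obtain G where G: "smooth_at G 0" "(G has_derivative (\<lambda>v. p' * fst v + q' * snd v)) (at 0)"
    "\<forall>\<^sub>F s in nhds 0. g s = G (\<delta> s)" using assms(2) unfolding pullback_def by blast
  have "((\<lambda>v. F v + G v) has_derivative (\<lambda>v. (p + p') * fst v + (q + q') * snd v)) (at 0)"
    by (rule has_derivative_eq_rhs[OF has_derivative_add[OF F(2) G(2)]]) (auto simp: algebra_simps)
  moreover have "\<forall>\<^sub>F s in nhds 0. f s + g s = F (\<delta> s) + G (\<delta> s)"
    using F(3) G(3) by eventually_elim simp
  moreover have "smooth_at (\<lambda>v. F v + G v) 0" by (intro smooth_intros F G)
  ultimately show ?thesis unfolding pullback_def by blast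
qed

lemma pullback_linear: "pullback \<delta> p q (\<lambda>s. p * fst (\<delta> s) + q * snd (\<delta> s))"
  unfolding pullback_def
  by (intro exI[of _ "\<lambda>v. p * fst v + q * snd v"] conjI smooth_intros always_eventually)
    (auto intro!: derivative_eq_intros)

text \<open>The extension F G lies in the square of the maximal ideal, so its differential vanishes.
  For this rule, the expansions below are written as sums of products of two factors vanishing at
  0.\<close>

lemma pullback_mult:
  assumes "in_ring \<delta> f" "in_ring \<delta> g" "f 0 = 0" "g 0 = 0" "\<delta> 0 = 0"
  shows "pullback \<delta> 0 0 (\<lambda>s. f s * g s)"
proof -
  obtain F G where FG: "smooth_at F 0" "smooth_at G 0"
    and e: "\<forall>\<^sub>F s in nhds 0. f s = F (\<delta> s)" "\<forall>\<^sub>F s in nhds 0. g s = G (\<delta> s)"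
    using assms(1,2) unfolding in_ring_def by blast
  have z: "F 0 = 0" "G 0 = 0" using e[THEN eventually_nhds_x_imp_x] assms(3-5) by simp_all
  have "\<exists>L. (H has_derivative L) (at 0)" if "smooth_at H 0" for H :: "real \<times> real \<Rightarrow> real"
  proof -
    obtain U where "0 \<in> U" "times_cont_diff_on (Suc 0) U H"
      using \<open>smooth_at H 0\<close> unfolding smooth_at_def Ck_on_infinity by blast
    then show ?thesis using times_cont_diff_on_SucD by blast
  qed
  then obtain L M where "(F has_derivative L) (at 0)" "(G has_derivative M) (at 0)" using FG by meson
  from has_derivative_mult[OF this] have "((\<lambda>x. F x * G x) has_derivative (\<lambda>v. 0)) (at 0)"
    by (simp add: z)
  moreover have "\<forall>\<^sub>F s in nhds 0. f s * g s = F (\<delta> s) * G (\<delta> s)" using e by eventually_elim simp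
  moreover have "smooth_at (\<lambda>x. F x * G x) 0" by (intro smooth_intros FG)
  ultimately show ?thesis unfolding pullback_def by auto
qed

lemma smooth_at_real_diffeo_germ:
  fixes \<tau> :: "real \<Rightarrow> real"
  assumes "smooth_at \<tau> 0" "(\<tau> has_real_derivative c) (at 0)" "c \<noteq> 0" "\<tau> 0 = 0"
  shows "Ck_diffeo_germ \<infinity> \<tau> 0 0"
proof -
  obtain U where "open U" "0 \<in> U" "Ck_on \<infinity> U \<tau>" using assms(1) unfolding smooth_at_def by blast
  from real_diffeo_germI[OF this _ assms(2,3)] assms(4) show ?thesis by simp
qed

text \<open>The coordinates of the reparametrised curve in the frame \<open>(e, n)\<close> are functions of \<open>\<delta>\<close> with
  independent differentials, so that \<open>E \<circ> \<tau> = \<Psi> \<circ> \<delta>\<close> for a local diffeomorphism \<open>\<Psi>\<close>.\<close>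

lemma A_equivalentI_pullback:
  assumes \<tau>: "smooth_at \<tau> 0" "(\<tau> has_real_derivative c) (at 0)" "c \<noteq> 0" "\<tau> 0 = 0"
    and \<delta>: "isCont \<delta> 0" "\<delta> 0 = 0"
    and E: "\<forall>\<^sub>F u in nhds 0. E u = E 0 + X u *\<^sub>R tangent_dir \<theta> + Y u *\<^sub>R normal_dir \<theta>"
    and X: "pullback \<delta> p q (\<lambda>s. X (\<tau> s))" and Y: "pullback \<delta> p' q' (\<lambda>s. Y (\<tau> s))"
    and det: "p * q' - q * p' \<noteq> 0"
  shows "A_equivalent E \<delta>"
proof -
  obtain F where F: "smooth_at F 0" "(F has_derivative (\<lambda>v. p * fst v + q * snd v)) (at 0)"
    "\<forall>\<^sub>F s in nhds 0. X (\<tau> s) = F (\<delta> s)" using X unfolding pullback_def by blast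
  obtain G where G: "smooth_at G 0" "(G has_derivative (\<lambda>v. p' * fst v + q' * snd v)) (at 0)"
    "\<forall>\<^sub>F s in nhds 0. Y (\<tau> s) = G (\<delta> s)" using Y unfolding pullback_def by blast
  let ?\<Psi> = "\<lambda>v. E 0 + F v *\<^sub>R tangent_dir \<theta> + G v *\<^sub>R normal_dir \<theta>"
  have "\<forall>\<^sub>F s in nhds 0. E (\<tau> s) = E 0 + X (\<tau> s) *\<^sub>R tangent_dir \<theta> + Y (\<tau> s) *\<^sub>R normal_dir \<theta>"
    by (rule isCont_eventually_nhds[OF smooth_at_isCont[OF \<tau>(1)]]) (simp add: \<tau>(4) E)
  with F(3) G(3) have ev: "\<forall>\<^sub>F s in nhds 0. E (\<tau> s) = ?\<Psi> (\<delta> s)"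
    by eventually_elim simp
  have "smooth_at ?\<Psi> 0" by (intro smooth_intros F G)
  then obtain U where U: "open U" "0 \<in> U" "Ck_on \<infinity> U ?\<Psi>" unfolding smooth_at_def by blast
  let ?L = "\<lambda>v. (p * fst v + q * snd v) *\<^sub>R tangent_dir \<theta> + (p' * fst v + q' * snd v) *\<^sub>R normal_dir \<theta>"
  have d: "(?\<Psi> has_derivative ?L) (at 0)"
    by (rule has_derivative_eq_rhs, rule has_derivative_add, rule has_derivative_add, rule has_derivative_const,
        rule has_derivative_scaleR_left, rule F(2), rule has_derivative_scaleR_left, rule G(2)) auto
  have "inj ?L"
  proof (rule injI)
    fix v w :: "real \<times> real" assume vw: "?L v = ?L w"
    \<comment> \<open>The frame is orthonormal, so equal images force a = b = 0, a linear system
      with determinant p q' - q p'.\<close>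
    define a b where "a = p * (fst v - fst w) + q * (snd v - snd w)"
      and "b = p' * (fst v - fst w) + q' * (snd v - snd w)"
    have sc: "sin \<theta> * sin \<theta> + cos \<theta> * cos \<theta> = 1"
      using sin_cos_squared_add[of \<theta>] by (simp add: power2_eq_square)
    have "a * cos \<theta> - b * sin \<theta> = 0" "a * sin \<theta> + b * cos \<theta> = 0"
      using vw by (auto simp: tangent_dir_def normal_dir_def prod_eq_iff a_def b_def algebra_simps)
    then have ab: "a = 0" "b = 0" using sc by algebra+
    then have "(p * q' - q * p') * (fst v - fst w) = 0" "(p * q' - q * p') * (snd v - snd w) = 0"
      unfolding a_def b_def by algebra+
    with det show "v = w" by (simp add: prod_eq_iff)
  qed
  from plane_diffeo_germI[OF U _ d this]
  have "Ck_diffeo_germ \<infinity> ?\<Psi> 0 (E 0)"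
    using eventually_nhds_x_imp_x[OF ev] \<delta>(2) \<tau>(4) by (simp add: add.assoc)
  from Ck_equivalentI[OF smooth_at_real_diffeo_germ[OF \<tau>] this \<delta> ev]
  show ?thesis unfolding A_equivalent_def .
qed

text \<open>Large powers of the parameter are smooth functions of the monomial curve: over the functions
  of the coordinate \<open>s ^ k\<close>, a smooth function is a combination of \<open>1, s, \<dots>, s ^ (k - 1)\<close>.\<close>

lemma pullback_3_2:
  assumes "smooth_at g 0"
  shows "pullback (\<lambda>s. (s ^ 2, s ^ 3)) 0 0 (\<lambda>s. s ^ 4 * g s)"
proof -
  let ?\<delta> = "\<lambda>s::real. (s ^ 2, s ^ 3)"
  obtain a where a: "\<And>i. smooth_at (a i) (0::real)" "\<forall>\<^sub>F t in nhds 0. g t = (\<Sum>i<2. t ^ i * a i (t ^ 2))"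
    by (rule smooth_at_power_decomposition[OF assms, of 2]) auto
  note x = in_ring_fst[of ?\<delta>, simplified] and y = in_ring_snd[of ?\<delta>, simplified]
  have ax: "in_ring ?\<delta> (\<lambda>s. a i (s ^ 2))" for i
    by (rule in_ring_compose[OF x]) (simp_all add: a zero_prod_def)
  \<comment> \<open>4 = 2 + 2 and 5 = 2 + 3 represent both residues modulo 2 by sums of two
    generators.\<close>
  have "pullback ?\<delta> (0 + 0) (0 + 0) (\<lambda>s. s ^ 2 * (s ^ 2 * a 0 (s ^ 2)) + s ^ 2 * (s ^ 3 * a 1 (s ^ 2)))"
    by (intro pullback_add pullback_mult in_ring_mult x y ax) (simp_all add: zero_prod_def)
  then have "pullback ?\<delta> 0 0 (\<lambda>s. s ^ 2 * (s ^ 2 * a 0 (s ^ 2)) + s ^ 2 * (s ^ 3 * a 1 (s ^ 2)))" by simp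
  then show ?thesis
    by (rule pullback_cong)
      (use a(2) in eventually_elim, simp add: eval_nat_numeral algebra_simps)
qed

text \<open>The exponents 6 = 3 + 3, 7 = 3 + 4, 8 = 4 + 4 and 9 = 3 + 3 + 3 cover all residues
  modulo 4. Coefficients are taken over functions of s^4, because the decomposition asks for an even
  exponent.\<close>

lemma pullback_4_3:
  assumes "smooth_at g 0"
  shows "pullback (\<lambda>s. (s ^ 3, s ^ 4)) 0 0 (\<lambda>s. s ^ 6 * g s)"
proof -
  let ?\<delta> = "\<lambda>s::real. (s ^ 3, s ^ 4)"
  obtain a where a: "\<And>i. smooth_at (a i) (0::real)" "\<forall>\<^sub>F t in nhds 0. g t = (\<Sum>i<4. t ^ i * a i (t ^ 4))"
    by (rule smooth_at_power_decomposition[OF assms, of 4]) auto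
  note x = in_ring_fst[of ?\<delta>, simplified] and y = in_ring_snd[of ?\<delta>, simplified]
  have ay: "in_ring ?\<delta> (\<lambda>s. a i (s ^ 4))" for i
    by (rule in_ring_compose[OF y]) (simp_all add: a zero_prod_def)
  let ?f = "\<lambda>s. s ^ 3 * (s ^ 3 * a 0 (s ^ 4)) + s ^ 3 * (s ^ 4 * a 1 (s ^ 4)) +
      s ^ 4 * (s ^ 4 * a 2 (s ^ 4)) + s ^ 3 * (s ^ 3 * s ^ 3 * a 3 (s ^ 4))"
  have "pullback ?\<delta> (0 + 0 + 0 + 0) (0 + 0 + 0 + 0) ?f"
    by (intro pullback_add pullback_mult in_ring_mult x y ay) (simp_all add: zero_prod_def)
  then have "pullback ?\<delta> 0 0 ?f" by simp
  then show ?thesis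
    by (rule pullback_cong)
      (use a(2) in eventually_elim, simp add: eval_nat_numeral algebra_simps)
qed

text \<open>For \<epsilon> = 0 the decompositions are 12 = 4 + 4 + 4, 13 = 4 + 4 + 5, 14 = 4 + 5 + 5
  and 15 = 5 + 5 + 5. In general y contributes extra powers of s, and isolating a single one
  requires division by units 1 + O(x).\<close>

lemma pullback_5_4:
  assumes "smooth_at g 0"
  shows "pullback (\<lambda>s. (s ^ 4, s ^ 5 + \<epsilon> * s ^ 7)) 0 0 (\<lambda>s. s ^ 12 * g s)"
proof -
  let ?\<delta> = "\<lambda>s::real. (s ^ 4, s ^ 5 + \<epsilon> * s ^ 7)"
  obtain a where a: "\<And>i. smooth_at (a i) (0::real)" "\<forall>\<^sub>F t in nhds 0. g t = (\<Sum>i<4. t ^ i * a i (t ^ 4))"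
    by (rule smooth_at_power_decomposition[OF assms, of 4]) auto
  define x y where "x s = s ^ 4" and "y s = s ^ 5 + \<epsilon> * s ^ 7" for s :: real
  have xy: "in_ring ?\<delta> x" "in_ring ?\<delta> y" "x 0 = 0" "y 0 = 0"
    using in_ring_fst[of ?\<delta>] in_ring_snd[of ?\<delta>] by (simp_all add: x_def[abs_def] y_def[abs_def])
  have \<delta>0: "?\<delta> 0 = 0" by (simp add: zero_prod_def)
  have ax: "in_ring ?\<delta> (\<lambda>s. a i (x s))" for i
    by (rule in_ring_compose[OF xy(1)]) (simp_all add: a xy zero_prod_def)
  \<comment> \<open>Expanding \<open>y ^ 2\<close> and \<open>y ^ 3\<close> over \<open>1, s, s ^ 2, s ^ 3\<close> and eliminating shows that
    \<open>x * u = x ^ 3 * s ^ 2\<close> and \<open>y * v = x ^ 3 * s ^ 3\<close>.\<close>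
  define u v where "u s = (y s ^ 2 - 2 * \<epsilon> * x s ^ 3) / (1 + \<epsilon>\<^sup>2 * x s)"
    and "v s = (y s ^ 2 - (3 * \<epsilon> * x s ^ 3 + \<epsilon> ^ 3 * x s ^ 4)) / (1 - \<epsilon> ^ 4 * x s ^ 2)" for s
  have uv: "in_ring ?\<delta> u" "in_ring ?\<delta> v"
    unfolding u_def v_def
    by (intro in_ring_divide in_ring_diff in_ring_add in_ring_mult in_ring_power in_ring_const xy \<delta>0;
        simp add: xy(3,4))+
  have uv0: "u 0 = 0" "v 0 = 0" by (simp_all add: u_def v_def xy(3,4))
  \<comment> \<open>x^2 y is s^13 + \<epsilon> s^15; the summand with the coefficient - \<epsilon>
    removes the excess.\<close>
  let ?f = "\<lambda>s. x s * (x s * (x s * a 0 (x s))) + x s * ((x s * y s) * a 1 (x s)) + y s * ((- \<epsilon> * a 1 (x s)) * v s)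
     + x s * (u s * a 2 (x s)) + y s * (v s * a 3 (x s))"
  have "pullback ?\<delta> (0 + 0 + 0 + 0 + 0) (0 + 0 + 0 + 0 + 0) ?f"
    by (intro pullback_add pullback_mult in_ring_mult in_ring_const xy uv ax \<delta>0) (simp_all add: xy uv0)
  then have f: "pullback ?\<delta> 0 0 ?f" by simp
  have c: "isCont (\<lambda>s::real. 1 + \<epsilon>\<^sup>2 * x s) 0" "isCont (\<lambda>s::real. 1 - \<epsilon> ^ 4 * x s ^ 2) 0"
    unfolding x_def by (intro continuous_intros)+
  have "\<forall>\<^sub>F y in nhds (1 :: real). y \<noteq> 0" by (rule t1_space_nhds) simp
  then have nz: "\<forall>\<^sub>F s in nhds 0. 1 + \<epsilon>\<^sup>2 * x s \<noteq> 0" "\<forall>\<^sub>F s in nhds 0. 1 - \<epsilon> ^ 4 * x s ^ 2 \<noteq> 0"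
    using isCont_eventually_nhds[OF c(1), of "\<lambda>y. y \<noteq> 0"] isCont_eventually_nhds[OF c(2), of "\<lambda>y. y \<noteq> 0"]
    by (simp_all add: xy(3))
  have "\<forall>\<^sub>F s in nhds 0. s ^ 12 * g s = ?f s"
    using a(2) nz
  proof eventually_elim
    case (elim s)
    have 2: "x s * u s = x s ^ 3 * s ^ 2"
    proof -
      have "x s * (y s ^ 2 - 2 * \<epsilon> * x s ^ 3) = x s ^ 3 * s ^ 2 * (1 + \<epsilon>\<^sup>2 * x s)"
        unfolding x_def y_def by algebra
      then show ?thesis using elim(2) by (simp add: u_def divide_eq_eq)
    qed
    have 3: "y s * v s = x s ^ 3 * s ^ 3"
    proof -
      have "y s * (y s ^ 2 - (3 * \<epsilon> * x s ^ 3 + \<epsilon> ^ 3 * x s ^ 4)) = x s ^ 3 * s ^ 3 * (1 - \<epsilon> ^ 4 * x s ^ 2)"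
        unfolding x_def y_def by algebra
      then show ?thesis using elim(3) by (simp add: v_def divide_eq_eq)
    qed
    have 1: "x s * (x s * y s) - \<epsilon> * (x s ^ 3 * s ^ 3) = x s ^ 3 * s"
      unfolding x_def y_def by algebra
    have "?f s = x s ^ 3 * a 0 (x s) + (x s * (x s * y s) - \<epsilon> * (y s * v s)) * a 1 (x s)
        + (x s * u s) * a 2 (x s) + (y s * v s) * a 3 (x s)" by algebra
    also have "\<dots> = x s ^ 3 * (a 0 (x s) + s * a 1 (x s) + s ^ 2 * a 2 (x s) + s ^ 3 * a 3 (x s))"
      unfolding 2 3 1 by algebra
    also have "\<dots> = s ^ 12 * g s"
      unfolding elim(1) by (simp add: x_def eval_nat_numeral)
    finally show ?case by simp
  qed
  with f show ?thesis by (rule pullback_cong)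
qed


section \<open>Normal forms of the cusps\<close>

lemma smooth_at_compose_origin:
  fixes g :: "real \<Rightarrow> real"
  shows "smooth_at g 0 \<Longrightarrow> smooth_at \<tau> 0 \<Longrightarrow> \<tau> 0 = 0 \<Longrightarrow> smooth_at (\<lambda>s. g (\<tau> s :: real)) 0"
  by (rule smooth_at_compose)

lemma eventually_compose_origin:
  fixes \<tau> :: "real \<Rightarrow> real"
  assumes "\<forall>\<^sub>F u in nhds 0. P u" "smooth_at \<tau> 0" "\<tau> 0 = 0"
  shows "\<forall>\<^sub>F s in nhds 0. P (\<tau> s)"
  by (rule isCont_eventually_nhds[OF smooth_at_isCont[OF assms(2)]]) (simp add: assms)

section \<open>Taylor coefficients under a polynomial change of parameter\<close>

lemma reparam_expansion_4_3:
  fixes \<alpha> \<beta> :: real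
  defines "\<tau> \<equiv> \<lambda>s. s + \<alpha> * s ^ 2 + \<beta> * s ^ 3"
  assumes "smooth_at g 0" "\<forall>\<^sub>F u in nhds 0. f u = x0 * u ^ 3 + x1 * u ^ 4 + x2 * u ^ 5 + u ^ 6 * g u"
  obtains h where "smooth_at h 0" "\<forall>\<^sub>F s in nhds 0. f (\<tau> s) = x0 * s ^ 3 + (3 * \<alpha> * x0 + x1) * s ^ 4 +
    (x0 * (3 * \<beta> + 3 * \<alpha>\<^sup>2) + 4 * \<alpha> * x1 + x2) * s ^ 5 + s ^ 6 * h s"
proof
  have \<tau>: "smooth_at \<tau> 0" "\<tau> 0 = 0" unfolding \<tau>_def by (intro smooth_intros) simp
  define v where "v s = \<alpha> + \<beta> * s" for s
  have v: "smooth_at v 0" unfolding v_def by (intro smooth_intros)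
  \<comment> \<open>The quotients left in (1 + s v)^k when the terms that reach degree at most 5 in
    s^k (1 + s v)^k are split off.\<close>
  define P3 P4 P5 where "P3 s = v s ^ 3 + 6 * \<alpha> * \<beta> + 3 * \<beta>\<^sup>2 * s"
    and "P4 s = 4 * \<beta> + 6 * v s ^ 2 + 4 * s * v s ^ 3 + s ^ 2 * v s ^ 4"
    and "P5 s = 5 * v s + 10 * s * v s ^ 2 + 10 * s ^ 2 * v s ^ 3 + 5 * s ^ 3 * v s ^ 4 + s ^ 4 * v s ^ 5" for s
  let ?h = "\<lambda>s. x0 * P3 s + x1 * P4 s + x2 * P5 s + (1 + s * v s) ^ 6 * g (\<tau> s)"
  show "smooth_at ?h 0"
    unfolding P3_def P4_def P5_def by (intro smooth_intros v smooth_at_compose_origin[OF assms(2) \<tau>])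
  have e: "\<tau> s = s * (1 + s * v s)"
    "(1 + s * v s) ^ 3 = 1 + 3 * \<alpha> * s + (3 * \<beta> + 3 * \<alpha>\<^sup>2) * s ^ 2 + s ^ 3 * P3 s"
    "(1 + s * v s) ^ 4 = 1 + 4 * \<alpha> * s + s ^ 2 * P4 s"
    "(1 + s * v s) ^ 5 = 1 + s * P5 s" for s
    unfolding \<tau>_def P3_def P4_def P5_def v_def by algebra+
  show "\<forall>\<^sub>F s in nhds 0. f (\<tau> s) = x0 * s ^ 3 + (3 * \<alpha> * x0 + x1) * s ^ 4 +
    (x0 * (3 * \<beta> + 3 * \<alpha>\<^sup>2) + 4 * \<alpha> * x1 + x2) * s ^ 5 + s ^ 6 * ?h s"
    using eventually_compose_origin[OF assms(3) \<tau>]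
  proof eventually_elim
    case (elim s)
    have "f (\<tau> s) = x0 * (s ^ 3 * (1 + s * v s) ^ 3) + x1 * (s ^ 4 * (1 + s * v s) ^ 4)
        + x2 * (s ^ 5 * (1 + s * v s) ^ 5) + s ^ 6 * (1 + s * v s) ^ 6 * g (\<tau> s)"
      unfolding elim by (simp only: e(1) power_mult_distrib)
    then show ?case unfolding e(2-4) by algebra
  qed
qed

text \<open>The parameters act triangularly: \<alpha>, \<beta>, \<gamma> first reach the
  coefficients of s^5, s^6, s^7, each linearly with factor 4 x0. If x0 = 0, as for Y, each appears
  one degree later with factor 5 x1.\<close>

lemma reparam_expansion_5_4:
  fixes \<alpha> \<beta> \<gamma> :: real
  defines "\<tau> \<equiv> \<lambda>s. s + \<alpha> * s ^ 2 + \<beta> * s ^ 3 + \<gamma> * s ^ 4"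
  assumes "smooth_at g 0" "\<forall>\<^sub>F u in nhds 0. f u = x0 * u ^ 4 + x1 * u ^ 5 + x2 * u ^ 6 + x3 * u ^ 7 + u ^ 8 * g u"
  obtains h where "smooth_at h 0" "\<forall>\<^sub>F s in nhds 0. f (\<tau> s) = x0 * s ^ 4 + (4 * \<alpha> * x0 + x1) * s ^ 5 +
    (x0 * (4 * \<beta> + 6 * \<alpha>\<^sup>2) + 5 * \<alpha> * x1 + x2) * s ^ 6 +
    (x0 * (4 * \<gamma> + 12 * \<alpha> * \<beta> + 4 * \<alpha> ^ 3) + x1 * (5 * \<beta> + 10 * \<alpha>\<^sup>2) + 6 * \<alpha> * x2 + x3) * s ^ 7 + s ^ 8 * h s"
proof
  have \<tau>: "smooth_at \<tau> 0" "\<tau> 0 = 0" unfolding \<tau>_def by (intro smooth_intros) simp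
  define v where "v s = \<alpha> + \<beta> * s + \<gamma> * s ^ 2" for s
  have v: "smooth_at v 0" unfolding v_def by (intro smooth_intros)
  define P4 P5 P6 P7 where "P4 s = 6 * (\<beta>\<^sup>2 + 2 * \<alpha> * \<gamma> + 2 * \<beta> * \<gamma> * s + \<gamma>\<^sup>2 * s ^ 2)
      + 4 * ((\<beta> + \<gamma> * s) * (v s ^ 2 + v s * \<alpha> + \<alpha>\<^sup>2)) + v s ^ 4"
    and "P5 s = 5 * \<gamma> + 10 * ((\<beta> + \<gamma> * s) * (v s + \<alpha>)) + 10 * v s ^ 3 + 5 * s * v s ^ 4 + s ^ 2 * v s ^ 5"
    and "P6 s = 6 * (\<beta> + \<gamma> * s) + 15 * v s ^ 2 + 20 * s * v s ^ 3 + 15 * s ^ 2 * v s ^ 4 + 6 * s ^ 3 * v s ^ 5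
      + s ^ 4 * v s ^ 6"
    and "P7 s = 7 * v s + 21 * s * v s ^ 2 + 35 * s ^ 2 * v s ^ 3 + 35 * s ^ 3 * v s ^ 4 + 21 * s ^ 4 * v s ^ 5
      + 7 * s ^ 5 * v s ^ 6 + s ^ 6 * v s ^ 7" for s
  let ?h = "\<lambda>s. x0 * P4 s + x1 * P5 s + x2 * P6 s + x3 * P7 s + (1 + s * v s) ^ 8 * g (\<tau> s)"
  show "smooth_at ?h 0"
    unfolding P4_def P5_def P6_def P7_def
    by (intro smooth_intros v smooth_at_compose_origin[OF assms(2) \<tau>])
  have e: "\<tau> s = s * (1 + s * v s)"
    "(1 + s * v s) ^ 4 = 1 + 4 * \<alpha> * s + (4 * \<beta> + 6 * \<alpha>\<^sup>2) * s ^ 2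
      + (4 * \<gamma> + 12 * \<alpha> * \<beta> + 4 * \<alpha> ^ 3) * s ^ 3 + s ^ 4 * P4 s"
    "(1 + s * v s) ^ 5 = 1 + 5 * \<alpha> * s + (5 * \<beta> + 10 * \<alpha>\<^sup>2) * s ^ 2 + s ^ 3 * P5 s"
    "(1 + s * v s) ^ 6 = 1 + 6 * \<alpha> * s + s ^ 2 * P6 s"
    "(1 + s * v s) ^ 7 = 1 + s * P7 s" for s
    unfolding \<tau>_def P4_def P5_def P6_def P7_def v_def by algebra+
  show "\<forall>\<^sub>F s in nhds 0. f (\<tau> s) = x0 * s ^ 4 + (4 * \<alpha> * x0 + x1) * s ^ 5 +
    (x0 * (4 * \<beta> + 6 * \<alpha>\<^sup>2) + 5 * \<alpha> * x1 + x2) * s ^ 6 +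
    (x0 * (4 * \<gamma> + 12 * \<alpha> * \<beta> + 4 * \<alpha> ^ 3) + x1 * (5 * \<beta> + 10 * \<alpha>\<^sup>2) + 6 * \<alpha> * x2 + x3) * s ^ 7 + s ^ 8 * ?h s"
    using eventually_compose_origin[OF assms(3) \<tau>]
  proof eventually_elim
    case (elim s)
    have "f (\<tau> s) = x0 * (s ^ 4 * (1 + s * v s) ^ 4) + x1 * (s ^ 5 * (1 + s * v s) ^ 5)
        + x2 * (s ^ 6 * (1 + s * v s) ^ 6) + x3 * (s ^ 7 * (1 + s * v s) ^ 7) + s ^ 8 * (1 + s * v s) ^ 8 * g (\<tau> s)"
      unfolding elim by (simp only: e(1) power_mult_distrib)
    then show ?case unfolding e(2-5) by algebra
  qed
qed

text \<open>It treats all exponents from 4 to 12 uniformly: for z = O(s^6), only the term n z can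
  matter below degree 12.\<close>

lemma power_one_plus_expansion:
  fixes z :: "real \<Rightarrow> real"
  assumes "smooth_at z 0"
  obtains R where "smooth_at R 0" "\<And>s. (1 + z s) ^ n = 1 + n * z s + z s ^ 2 * R s"
proof -
  have "\<exists>R. smooth_at R 0 \<and> (\<forall>s. (1 + z s) ^ n = 1 + n * z s + z s ^ 2 * R s)"
  proof (induction n)
    case 0
    show ?case by (intro exI[of _ "\<lambda>_. 0"]) (simp add: smooth_intros)
  next
    case (Suc n)
    then obtain R where R: "smooth_at R 0" "\<And>s. (1 + z s) ^ n = 1 + n * z s + z s ^ 2 * R s" by blast
    have "smooth_at (\<lambda>s. n + (1 + z s) * R s) 0" by (intro smooth_intros assms R)
    moreover have "(1 + z s) ^ Suc n = 1 + Suc n * z s + z s ^ 2 * (n + (1 + z s) * R s)" for s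
      unfolding power_Suc R(2) by (simp add: algebra_simps power2_eq_square)
    ultimately show ?case by blast
  qed
  then show thesis using that by blast
qed

text \<open>The exponents up to \<open>9\<close> are untouched by a reparametrisation tangent to the identity to
  order \<open>7\<close>, and \<open>\<kappa>\<close>, \<open>\<mu>\<close> enter the coefficient of \<open>s ^ 11\<close> linearly.\<close>

lemma reparam_expansion_order_7:
  fixes \<kappa> \<mu> :: real
  defines "\<sigma> \<equiv> \<lambda>s. s + \<kappa> * s ^ 7 + \<mu> * s ^ 8"
  assumes "smooth_at g 0" "\<forall>\<^sub>F u in nhds 0. f u = c4 * u ^ 4 + c5 * u ^ 5 + c7 * u ^ 7 + c8 * u ^ 8
    + c9 * u ^ 9 + c10 * u ^ 10 + c11 * u ^ 11 + u ^ 12 * g u"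
  obtains h where "smooth_at h 0" "\<forall>\<^sub>F s in nhds 0. f (\<sigma> s) = c4 * s ^ 4 + c5 * s ^ 5 + c7 * s ^ 7 + c8 * s ^ 8
    + c9 * s ^ 9 + (c10 + 4 * \<kappa> * c4) * s ^ 10 + (c11 + 4 * \<mu> * c4 + 5 * \<kappa> * c5) * s ^ 11 + s ^ 12 * h s"
proof -
  have \<sigma>: "smooth_at \<sigma> 0" "\<sigma> 0 = 0" unfolding \<sigma>_def by (intro smooth_intros) simp
  define v where "v s = \<kappa> + \<mu> * s" for s
  define z where "z s = s ^ 6 * v s" for s
  have v: "smooth_at v 0" and z: "smooth_at z 0" unfolding z_def v_def by (intro smooth_intros)+
  have "\<forall>n. \<exists>R. smooth_at R 0 \<and> (\<forall>s. (1 + z s) ^ n = 1 + n * z s + z s ^ 2 * R s)"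
    using power_one_plus_expansion[OF z] by metis
  from choice[OF this] obtain R where R: "\<And>n. smooth_at (R n) 0"
    "\<And>n s. (1 + z s) ^ n = 1 + n * z s + z s ^ 2 * R n s" by blast
  define S where "S n s = real n * v s + s ^ 6 * v s ^ 2 * R n s" for n s
  have S: "smooth_at (S n) 0" for n unfolding S_def by (intro smooth_intros v R)
  have p: "(\<sigma> s) ^ n = s ^ n * (1 + s ^ 6 * S n s)" for n s
  proof -
    have "\<sigma> s = s * (1 + z s)" unfolding \<sigma>_def z_def v_def by algebra
    then have "(\<sigma> s) ^ n = s ^ n * (1 + n * z s + z s ^ 2 * R n s)" by (simp add: power_mult_distrib R(2))
    then show ?thesis by (simp add: S_def z_def power2_eq_square algebra_simps)
  qed
  \<comment> \<open>Only the powers 4 and 5 change below degree 12, so these two are split further;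
    the others go into h as a whole.\<close>
  have S45: "S 4 s = 4 * \<kappa> + s * (4 * \<mu> + s ^ 5 * v s ^ 2 * R 4 s)" "S 5 s = 5 * \<kappa> + s * (5 * \<mu> + s ^ 5 * v s ^ 2 * R 5 s)" for s
    unfolding S_def v_def of_nat_numeral by algebra+
  let ?h = "\<lambda>s. c4 * (s ^ 4 * v s ^ 2 * R 4 s) + c5 * (5 * \<mu> + s ^ 5 * v s ^ 2 * R 5 s) + c7 * (s * S 7 s)
    + c8 * (s ^ 2 * S 8 s) + c9 * (s ^ 3 * S 9 s) + c10 * (s ^ 4 * S 10 s) + c11 * (s ^ 5 * S 11 s)
    + (1 + s ^ 6 * S 12 s) * g (\<sigma> s)"
  have "smooth_at ?h 0"
    by (intro smooth_intros v S R smooth_at_compose_origin[OF assms(2) \<sigma>])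
  moreover have "\<forall>\<^sub>F s in nhds 0. f (\<sigma> s) = c4 * s ^ 4 + c5 * s ^ 5 + c7 * s ^ 7 + c8 * s ^ 8
    + c9 * s ^ 9 + (c10 + 4 * \<kappa> * c4) * s ^ 10 + (c11 + 4 * \<mu> * c4 + 5 * \<kappa> * c5) * s ^ 11 + s ^ 12 * ?h s"
    using eventually_compose_origin[OF assms(3) \<sigma>]
  proof eventually_elim
    case (elim s)
    show ?case unfolding elim p S45 by algebra
  qed
  ultimately show thesis by (rule that)
qed

section \<open>Reduction to normal form from the Taylor coefficients of X and Y\<close>

lemma pullback_linear_plus:
  assumes "pullback \<delta> 0 0 r" "\<forall>\<^sub>F s in nhds 0. f s = p * fst (\<delta> s) + q * snd (\<delta> s) + r s"
  shows "pullback \<delta> p q f"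
  using pullback_cong[OF pullback_add[OF pullback_linear[of \<delta> p q] assms(1)] assms(2)] by simp

text \<open>The semigroup generated by 2 and 3 has no gap from 2 on, so the angular parameter is
  kept as it is; the linear parts (x0, x1) and (0, y0) are independent.\<close>

lemma is_3_2_cuspI:
  assumes E: "\<forall>\<^sub>F u in nhds 0. E u = E 0 + X u *\<^sub>R tangent_dir \<theta> + Y u *\<^sub>R normal_dir \<theta>"
    and X: "smooth_at g 0" "\<forall>\<^sub>F u in nhds 0. X u = x0 * u ^ 2 + x1 * u ^ 3 + u ^ 4 * g u"
    and Y: "smooth_at h 0" "\<forall>\<^sub>F u in nhds 0. Y u = y0 * u ^ 3 + u ^ 4 * h u"
    and "x0 \<noteq> 0" "y0 \<noteq> 0"
  shows "is_3_2_cusp E"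
  unfolding is_3_2_cusp_def
proof (rule A_equivalentI_pullback[where \<tau>="\<lambda>s. s" and c=1, OF smooth_at_ident _ _ _ _ _ E])
  show "pullback (\<lambda>s. (s ^ 2, s ^ 3)) x0 x1 (\<lambda>s. X s)"
    by (rule pullback_linear_plus[OF pullback_3_2[OF X(1)]]) (use X(2) in simp)
  show "pullback (\<lambda>s. (s ^ 2, s ^ 3)) 0 y0 (\<lambda>s. Y s)"
    by (rule pullback_linear_plus[OF pullback_3_2[OF Y(1)]]) (use Y(2) in simp)
qed (use assms in \<open>auto simp: zero_prod_def intro!: continuous_intros derivative_eq_intros\<close>)

lemma is_4_3_cuspI:
  assumes E: "\<forall>\<^sub>F u in nhds 0. E u = E 0 + X u *\<^sub>R tangent_dir \<theta> + Y u *\<^sub>R normal_dir \<theta>"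
    and X: "smooth_at g 0" "\<forall>\<^sub>F u in nhds 0. X u = x0 * u ^ 3 + x1 * u ^ 4 + x2 * u ^ 5 + u ^ 6 * g u"
    and Y: "smooth_at h 0" "\<forall>\<^sub>F u in nhds 0. Y u = y0 * u ^ 4 + y1 * u ^ 5 + u ^ 6 * h u"
    and nz: "x0 \<noteq> 0" "y0 \<noteq> 0"
  shows "is_4_3_cusp E"
proof -
  \<comment> \<open>Both coordinates have to lose their s^5 term. In Y, which starts at order 4,
    only \<alpha> acts on it; \<beta> is then free to serve X.\<close>
  define \<alpha> where "\<alpha> = - y1 / (4 * y0)"
  define \<beta> where "\<beta> = - (3 * \<alpha>\<^sup>2 * x0 + 4 * \<alpha> * x1 + x2) / (3 * x0)"
  let ?\<tau> = "\<lambda>s. s + \<alpha> * s ^ 2 + \<beta> * s ^ 3"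
  have \<alpha>: "4 * \<alpha> * y0 + y1 = 0" and \<beta>: "x0 * (3 * \<beta> + 3 * \<alpha>\<^sup>2) + 4 * \<alpha> * x1 + x2 = 0"
    using nz by (simp_all add: \<alpha>_def[symmetric] \<beta>_def field_simps) (simp add: \<alpha>_def)
  obtain g' where g': "smooth_at g' 0" "\<forall>\<^sub>F s in nhds 0. X (?\<tau> s) = x0 * s ^ 3 + (3 * \<alpha> * x0 + x1) * s ^ 4 + s ^ 6 * g' s"
    using reparam_expansion_4_3[OF X, of \<alpha> \<beta>] unfolding \<beta> by auto
  obtain h' where h': "smooth_at h' 0" "\<forall>\<^sub>F s in nhds 0. Y (?\<tau> s) = y0 * s ^ 4 + s ^ 6 * h' s"
    using reparam_expansion_4_3[OF Y(1), of Y 0 y0 y1 \<alpha> \<beta>] Y(2) \<alpha> by auto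
  show ?thesis
    unfolding is_4_3_cusp_def
  proof (rule A_equivalentI_pullback[where \<tau>="?\<tau>" and c=1, OF _ _ _ _ _ _ E])
    show "pullback (\<lambda>s. (s ^ 3, s ^ 4)) x0 (3 * \<alpha> * x0 + x1) (\<lambda>s. X (?\<tau> s))"
      by (rule pullback_linear_plus[OF pullback_4_3[OF g'(1)]]) (use g'(2) in simp)
    show "pullback (\<lambda>s. (s ^ 3, s ^ 4)) 0 y0 (\<lambda>s. Y (?\<tau> s))"
      by (rule pullback_linear_plus[OF pullback_4_3[OF h'(1)]]) (use h'(2) in simp)
    show "smooth_at ?\<tau> 0" by (intro smooth_intros)
  qed (use nz in \<open>auto simp: zero_prod_def intro!: continuous_intros derivative_eq_intros\<close>)
qed

text \<open>There is no s^6 term, and the coefficients \<epsilon> c5 and \<epsilon> c9 are those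
  with which c5 y and c9 x y account for the terms at the gaps 7 and 11.\<close>

lemma pullback_5_4_expansion:
  fixes \<epsilon> :: real
  assumes "smooth_at g 0" "\<forall>\<^sub>F s in nhds 0. f s = c4 * s ^ 4 + c5 * s ^ 5 + \<epsilon> * c5 * s ^ 7 + c8 * s ^ 8
    + c9 * s ^ 9 + c10 * s ^ 10 + \<epsilon> * c9 * s ^ 11 + s ^ 12 * g s"
  shows "pullback (\<lambda>s. (s ^ 4, s ^ 5 + \<epsilon> * s ^ 7)) c4 c5 f"
proof -
  let ?\<delta> = "\<lambda>s::real. (s ^ 4, s ^ 5 + \<epsilon> * s ^ 7)"
  define x y where "x s = s ^ 4" and "y s = s ^ 5 + \<epsilon> * s ^ 7" for s :: real
  have xy: "in_ring ?\<delta> x" "in_ring ?\<delta> y" "x 0 = 0" "y 0 = 0"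
    using in_ring_fst[of ?\<delta>] in_ring_snd[of ?\<delta>] by (simp_all add: x_def[abs_def] y_def[abs_def])
  \<comment> \<open>c10 y^2 exceeds c10 s^10 by c10 (2 \<epsilon> s^12 + \<epsilon>^2 s^14), which
    is compensated here.\<close>
  let ?r = "\<lambda>s. s ^ 12 * (g s - c10 * (2 * \<epsilon> + \<epsilon>\<^sup>2 * s ^ 2))"
  have r: "pullback ?\<delta> 0 0 ?r" by (intro pullback_5_4 smooth_intros assms(1))
  have "pullback ?\<delta> (0 + 0 + 0) (0 + 0 + 0) (\<lambda>s. x s * (c8 * x s) + x s * (c9 * y s) + y s * (c10 * y s))"
    by (intro pullback_add pullback_mult in_ring_mult in_ring_const xy) (simp_all add: xy zero_prod_def)
  from pullback_add[OF this r]
  have r: "pullback ?\<delta> 0 0 (\<lambda>s. x s * (c8 * x s) + x s * (c9 * y s) + y s * (c10 * y s) + ?r s)" by simp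
  show ?thesis
  proof (rule pullback_linear_plus[OF r])
    show "\<forall>\<^sub>F s in nhds 0. f s = c4 * fst (?\<delta> s) + c5 * snd (?\<delta> s)
        + (x s * (c8 * x s) + x s * (c9 * y s) + y s * (c10 * y s) + ?r s)"
      using assms(2)
    proof eventually_elim
      case (elim s)
      show ?case unfolding elim x_def y_def fst_conv snd_conv by algebra
    qed
  qed
qed

lemma smooth_at_expansion_4:
  fixes f :: "real \<Rightarrow> real"
  assumes "smooth_at f 0"
  obtains c0 c1 c2 c3 r where "smooth_at r 0"
    "\<forall>\<^sub>F t in nhds 0. f t = c0 + c1 * t + c2 * t ^ 2 + c3 * t ^ 3 + t ^ 4 * r t"
proof -
  obtain f1 where f1: "smooth_at f1 0" "\<forall>\<^sub>F t in nhds 0. f t = f 0 + t * f1 t"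
    by (rule smooth_at_hadamard[OF assms])
  obtain f2 where f2: "smooth_at f2 0" "\<forall>\<^sub>F t in nhds 0. f1 t = f1 0 + t * f2 t"
    by (rule smooth_at_hadamard[OF f1(1)])
  obtain f3 where f3: "smooth_at f3 0" "\<forall>\<^sub>F t in nhds 0. f2 t = f2 0 + t * f3 t"
    by (rule smooth_at_hadamard[OF f2(1)])
  obtain f4 where f4: "smooth_at f4 0" "\<forall>\<^sub>F t in nhds 0. f3 t = f3 0 + t * f4 t"
    by (rule smooth_at_hadamard[OF f3(1)])
  from f1(2) f2(2) f3(2) f4(2)
  have "\<forall>\<^sub>F t in nhds 0. f t = f 0 + f1 0 * t + f2 0 * t ^ 2 + f3 0 * t ^ 3 + t ^ 4 * f4 t"
  proof eventually_elim
    case (elim t)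
    then show ?case by algebra
  qed
  with f4(1) show thesis by (rule that)
qed

text \<open>The conditions on \<alpha> and \<beta> clear s^6 in Y and in X. The s^7 coefficient of Y
  is then determined, since \<gamma> cannot act on it in the absence of a term of order 4;
  \<epsilon> is its ratio to y0.\<close>

lemma A_equivalent_5_4:
  assumes E: "\<forall>\<^sub>F u in nhds 0. E u = E 0 + X u *\<^sub>R tangent_dir \<theta> + Y u *\<^sub>R normal_dir \<theta>"
    and X: "smooth_at g 0" "\<forall>\<^sub>F u in nhds 0. X u = x0 * u ^ 4 + x1 * u ^ 5 + x2 * u ^ 6 + x3 * u ^ 7 + u ^ 8 * g u"
    and Y: "smooth_at h 0" "\<forall>\<^sub>F u in nhds 0. Y u = y0 * u ^ 5 + y1 * u ^ 6 + y2 * u ^ 7 + u ^ 8 * h u"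
    and nz: "x0 \<noteq> 0" "y0 \<noteq> 0"
    and \<alpha>: "5 * \<alpha> * y0 + y1 = 0"
    and \<beta>: "x0 * (4 * \<beta> + 6 * \<alpha>\<^sup>2) + 5 * \<alpha> * x1 + x2 = 0"
    and \<epsilon>: "\<epsilon> * y0 = y0 * (5 * \<beta> + 10 * \<alpha>\<^sup>2) + 6 * \<alpha> * y1 + y2"
  shows "A_equivalent E (\<lambda>t. (t ^ 4, t ^ 5 + \<epsilon> * t ^ 7))"
proof -
  \<comment> \<open>Solves for the s^7 coefficient of X to be \<epsilon> times its s^5 coefficient;
    4 x0 is the factor of \<gamma> there.\<close>
  define \<gamma> where "\<gamma> = (\<epsilon> * (4 * \<alpha> * x0 + x1)
    - (x0 * (12 * \<alpha> * \<beta> + 4 * \<alpha> ^ 3) + x1 * (5 * \<beta> + 10 * \<alpha>\<^sup>2) + 6 * \<alpha> * x2 + x3)) / (4 * x0)"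
  define c5 where "c5 = 4 * \<alpha> * x0 + x1"
  let ?\<tau> = "\<lambda>s. s + \<alpha> * s ^ 2 + \<beta> * s ^ 3 + \<gamma> * s ^ 4"
  have \<gamma>: "x0 * (4 * \<gamma> + 12 * \<alpha> * \<beta> + 4 * \<alpha> ^ 3) + x1 * (5 * \<beta> + 10 * \<alpha>\<^sup>2) + 6 * \<alpha> * x2 + x3 = \<epsilon> * c5"
  proof -
    have "4 * x0 * \<gamma> = \<epsilon> * c5 - (x0 * (12 * \<alpha> * \<beta> + 4 * \<alpha> ^ 3) + x1 * (5 * \<beta> + 10 * \<alpha>\<^sup>2) + 6 * \<alpha> * x2 + x3)"
      using nz by (simp add: \<gamma>_def c5_def)
    then show ?thesis by algebra
  qed
  obtain g1 where g1: "smooth_at g1 0"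
    "\<forall>\<^sub>F s in nhds 0. X (?\<tau> s) = x0 * s ^ 4 + c5 * s ^ 5 + 0 * s ^ 6 + \<epsilon> * c5 * s ^ 7 + s ^ 8 * g1 s"
    using reparam_expansion_5_4[OF X, of \<alpha> \<beta> \<gamma>] unfolding \<gamma> \<beta> c5_def[symmetric] by blast
  have Y': "\<forall>\<^sub>F u in nhds 0. Y u = 0 * u ^ 4 + y0 * u ^ 5 + y1 * u ^ 6 + y2 * u ^ 7 + u ^ 8 * h u"
    using Y(2) by simp
  obtain h1 where h1: "smooth_at h1 0"
    "\<forall>\<^sub>F s in nhds 0. Y (?\<tau> s) = 0 * s ^ 4 + y0 * s ^ 5 + 0 * s ^ 6 + \<epsilon> * y0 * s ^ 7 + s ^ 8 * h1 s"
    using reparam_expansion_5_4[OF Y(1) Y', of \<alpha> \<beta> \<gamma>] \<alpha> \<epsilon> by (auto simp: mult.commute)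
  \<comment> \<open>The remainders of order 8 are opened up because the gap 11 lies inside
    them.\<close>
  obtain a8 a9 a10 a11 g2 where g2: "smooth_at g2 0"
    "\<forall>\<^sub>F s in nhds 0. g1 s = a8 + a9 * s + a10 * s ^ 2 + a11 * s ^ 3 + s ^ 4 * g2 s"
    by (rule smooth_at_expansion_4[OF g1(1)])
  obtain b8 b9 b10 b11 h2 where h2: "smooth_at h2 0"
    "\<forall>\<^sub>F s in nhds 0. h1 s = b8 + b9 * s + b10 * s ^ 2 + b11 * s ^ 3 + s ^ 4 * h2 s"
    by (rule smooth_at_expansion_4[OF h1(1)])
  have X1: "\<forall>\<^sub>F s in nhds 0. X (?\<tau> s) = x0 * s ^ 4 + c5 * s ^ 5 + \<epsilon> * c5 * s ^ 7 + a8 * s ^ 8 + a9 * s ^ 9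
      + a10 * s ^ 10 + a11 * s ^ 11 + s ^ 12 * g2 s"
    using g1(2) g2(2)
  proof eventually_elim
    case (elim s)
    show ?case unfolding elim by algebra
  qed
  have Y1: "\<forall>\<^sub>F s in nhds 0. Y (?\<tau> s) = 0 * s ^ 4 + y0 * s ^ 5 + \<epsilon> * y0 * s ^ 7 + b8 * s ^ 8 + b9 * s ^ 9
      + b10 * s ^ 10 + b11 * s ^ 11 + s ^ 12 * h2 s"
    using h1(2) h2(2)
  proof eventually_elim
    case (elim s)
    show ?case unfolding elim by algebra
  qed
  \<comment> \<open>Y has no s^4 term, so \<kappa> alone sets its s^11 coefficient to \<epsilon> b9;
    \<mu> then does the same for X. The side effect at s^10 is harmless because 10 = 5 + 5 is not a
    gap.\<close>
  define \<kappa> where "\<kappa> = (\<epsilon> * b9 - b11) / (5 * y0)"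
  define \<mu> where "\<mu> = (\<epsilon> * a9 - a11 - 5 * \<kappa> * c5) / (4 * x0)"
  let ?\<sigma> = "\<lambda>s. s + \<kappa> * s ^ 7 + \<mu> * s ^ 8"
  have \<kappa>: "b11 + 4 * \<mu> * 0 + 5 * \<kappa> * y0 = \<epsilon> * b9" and \<mu>: "a11 + 4 * \<mu> * x0 + 5 * \<kappa> * c5 = \<epsilon> * a9"
  proof -
    have "5 * y0 * \<kappa> = \<epsilon> * b9 - b11" "4 * x0 * \<mu> = \<epsilon> * a9 - a11 - 5 * \<kappa> * c5"
      using nz by (simp_all add: \<kappa>_def \<mu>_def)
    then show "b11 + 4 * \<mu> * 0 + 5 * \<kappa> * y0 = \<epsilon> * b9" "a11 + 4 * \<mu> * x0 + 5 * \<kappa> * c5 = \<epsilon> * a9"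
      by algebra+
  qed
  obtain g3 where g3: "smooth_at g3 0"
    "\<forall>\<^sub>F s in nhds 0. X (?\<tau> (?\<sigma> s)) = x0 * s ^ 4 + c5 * s ^ 5 + \<epsilon> * c5 * s ^ 7 + a8 * s ^ 8 + a9 * s ^ 9
      + (a10 + 4 * \<kappa> * x0) * s ^ 10 + \<epsilon> * a9 * s ^ 11 + s ^ 12 * g3 s"
    using reparam_expansion_order_7[OF g2(1) X1, of \<kappa> \<mu>] unfolding \<mu> by blast
  obtain h3 where h3: "smooth_at h3 0"
    "\<forall>\<^sub>F s in nhds 0. Y (?\<tau> (?\<sigma> s)) = 0 * s ^ 4 + y0 * s ^ 5 + \<epsilon> * y0 * s ^ 7 + b8 * s ^ 8 + b9 * s ^ 9
      + (b10 + 4 * \<kappa> * 0) * s ^ 10 + \<epsilon> * b9 * s ^ 11 + s ^ 12 * h3 s"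
    using reparam_expansion_order_7[OF h2(1) Y1, of \<kappa> \<mu>] unfolding \<kappa> by blast
  show ?thesis
  proof (rule A_equivalentI_pullback[where \<tau>="\<lambda>s. ?\<tau> (?\<sigma> s)" and c=1, OF _ _ _ _ _ _ E])
    show "pullback (\<lambda>t. (t ^ 4, t ^ 5 + \<epsilon> * t ^ 7)) x0 c5 (\<lambda>s. X (?\<tau> (?\<sigma> s)))"
      by (rule pullback_5_4_expansion[OF g3])
    show "pullback (\<lambda>t. (t ^ 4, t ^ 5 + \<epsilon> * t ^ 7)) 0 y0 (\<lambda>s. Y (?\<tau> (?\<sigma> s)))"
      by (rule pullback_5_4_expansion[OF h3])
    show "smooth_at (\<lambda>s. ?\<tau> (?\<sigma> s)) 0" by (intro smooth_intros)
    have "((\<lambda>s. ?\<sigma> s) has_real_derivative 1) (at 0)" "(?\<tau> has_real_derivative 1) (at (?\<sigma> 0))"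
      by (auto intro!: derivative_eq_intros)
    from DERIV_chain'[OF this] show "((\<lambda>s. ?\<tau> (?\<sigma> s)) has_real_derivative 1) (at 0)" by simp
  qed (use nz in \<open>auto simp: zero_prod_def intro!: continuous_intros\<close>)
qed

text \<open>The substitution t = c s gives (c^4 s^4, c^5 (s^5 + c^2 \<epsilon> s^7)), so \<epsilon>
  is multiplied by the positive number c^2, up to a linear map of the plane.\<close>

lemma A_equivalent_5_4_scaling:
  fixes \<epsilon> :: real
  assumes "\<epsilon> \<noteq> 0"
  shows "A_equivalent (\<lambda>t. (t ^ 4, t ^ 5 + \<epsilon> * t ^ 7)) (\<lambda>t. (t ^ 4, t ^ 5 + sgn \<epsilon> * t ^ 7))"
proof -
  define c where "c = 1 / sqrt \<bar>\<epsilon>\<bar>"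
  have c: "c \<noteq> 0" "c\<^sup>2 * \<epsilon> = sgn \<epsilon>"
    using assms by (auto simp: c_def power_divide sgn_if)
  have c7: "c ^ 7 * \<epsilon> = c ^ 5 * sgn \<epsilon>"
    unfolding c(2)[symmetric] by (simp add: mult.assoc[symmetric] flip: power_add)
  let ?\<delta> = "\<lambda>t::real. (t ^ 4, t ^ 5 + sgn \<epsilon> * t ^ 7)"
  show ?thesis
  proof (rule A_equivalentI_pullback[where \<tau>="\<lambda>s. c * s" and c=c and \<theta>=0 and X="\<lambda>t. t ^ 4"
        and Y="\<lambda>t. t ^ 5 + \<epsilon> * t ^ 7"])
    show "pullback ?\<delta> (c ^ 4) 0 (\<lambda>s. (c * s) ^ 4)"
      by (rule pullback_cong[OF pullback_linear]) (simp add: power_mult_distrib)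
    have "(c * s) ^ 5 + \<epsilon> * (c * s) ^ 7 = 0 * fst (?\<delta> s) + c ^ 5 * snd (?\<delta> s)" for s
    proof -
      have "(c * s) ^ 5 + \<epsilon> * (c * s) ^ 7 = c ^ 5 * s ^ 5 + (c ^ 7 * \<epsilon>) * s ^ 7"
        by (simp add: power_mult_distrib)
      then show ?thesis unfolding c7 by (simp add: algebra_simps)
    qed
    then show "pullback ?\<delta> 0 (c ^ 5) (\<lambda>s. (c * s) ^ 5 + \<epsilon> * (c * s) ^ 7)"
      by (intro pullback_cong[OF pullback_linear] always_eventually allI)
    show "smooth_at (\<lambda>s. c * s) 0" by (intro smooth_intros)
    show "\<forall>\<^sub>F u in nhds 0. (u ^ 4, u ^ 5 + \<epsilon> * u ^ 7) = (0 ^ 4, 0 ^ 5 + \<epsilon> * 0 ^ 7) +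
        u ^ 4 *\<^sub>R tangent_dir 0 + (u ^ 5 + \<epsilon> * u ^ 7) *\<^sub>R normal_dir 0"
      by (simp add: tangent_dir_def normal_dir_def)
  qed (use c in \<open>auto simp: zero_prod_def intro!: continuous_intros derivative_eq_intros\<close>)
qed

text \<open>Since \<open>7/5 > 1\<close>, the map \<open>y \<mapsto> y + \<epsilon> y\<^sup>7\<^sup>/\<^sup>5\<close> is \<open>C\<^sup>1\<close>, and it removes the term of degree \<open>7\<close>.\<close>

lemma C1_equivalent_5_4:
  fixes \<epsilon> :: real
  shows "C1_equivalent (\<lambda>t. (t ^ 4, t ^ 5 + \<epsilon> * t ^ 7)) (\<lambda>t. (t ^ 4, t ^ 5))"
proof -
  \<comment> \<open>The odd real root makes y^(7/5) available for both signs, so that r (s^5) = s^7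
    for every s.\<close>
  define r where "r y = root 5 y ^ 7" for y :: real
  define \<Psi> where "\<Psi> = (\<lambda>v::real \<times> real. (fst v, snd v + \<epsilon> * r (snd v)))"
  have r_deriv: "(r has_real_derivative 7 / 5 * root 5 y ^ 2) (at y)" for y
  proof (cases "y = 0")
    case True
    have "((\<lambda>y. root 5 y ^ 2) \<longlongrightarrow> root 5 0 ^ 2) (at 0)" by (intro tendsto_intros)
    moreover have "root 5 h ^ 7 / h = root 5 h ^ 2" if "h \<noteq> 0" for h
    proof -
      have "root 5 h ^ 7 = root 5 h ^ 5 * root 5 h ^ 2" by (simp flip: power_add)
      also have "root 5 h ^ 5 = h" by (rule odd_real_root_pow) simp
      finally show ?thesis using that by simp
    qed
    then have "\<forall>\<^sub>F h in at 0. root 5 h ^ 2 = root 5 h ^ 7 / h"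
      by (auto simp: eventually_at_filter)
    ultimately have "((\<lambda>h. root 5 h ^ 7 / h) \<longlongrightarrow> 0) (at 0)"
      by (rule_tac Lim_transform_eventually) simp_all
    then show ?thesis using True by (simp add: has_field_derivative_iff r_def)
  next
    case False
    have "(root 5 has_real_derivative inverse (5 * root 5 y ^ (5 - Suc 0))) (at y)"
      using DERIV_odd_real_root[of 5 y] False by simp
    from DERIV_power[OF this, of 7]
    show ?thesis unfolding r_def using False
      by (rule_tac DERIV_cong) (assumption, simp add: field_simps flip: power_add)
  qed
  have "times_cont_diff_on (Suc 0) UNIV r"
  proof (rule times_cont_diff_on_real_SucI)
    show "(r has_vector_derivative 7 / 5 * root 5 y ^ 2) (at y)" for y
      using r_deriv by (simp only: has_real_derivative_iff_has_vector_derivative)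
    show "times_cont_diff_on 0 UNIV (\<lambda>y. 7 / 5 * root 5 y ^ 2)"
      by (auto intro!: continuous_intros)
  qed simp
  note r = this and id = times_cont_diff_on_ident[OF open_UNIV, where 'a="real \<times> real"]
  note fst = times_cont_diff_on_bounded_linear[OF open_UNIV bounded_linear_fst id]
    and snd = times_cont_diff_on_bounded_linear[OF open_UNIV bounded_linear_snd id]
  have "times_cont_diff_on (Suc 0) UNIV \<Psi>"
    unfolding \<Psi>_def
    by (rule times_cont_diff_on_Pair[OF open_UNIV fst times_cont_diff_on_add[OF open_UNIV snd
          times_cont_diff_on_cmult[OF open_UNIV times_cont_diff_on_compose[OF open_UNIV open_UNIV subset_UNIV snd r]]]])
  from times_cont_diff_on_mono[OF this] have Ck: "Ck_on 1 UNIV \<Psi>"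
    by (simp add: Ck_on_def one_enat_def del: times_cont_diff_on.simps)
  have "(r has_derivative (\<lambda>h. 0)) (at (snd (0 :: real \<times> real)))"
    using r_deriv[of 0] by (simp add: has_field_derivative_def flip: lambda_zero)
  from has_derivative_compose[OF bounded_linear_imp_has_derivative[OF bounded_linear_snd] this]
  have "((\<lambda>v::real \<times> real. r (snd v)) has_derivative (\<lambda>v. 0)) (at 0)" by simp
  \<comment> \<open>r has derivative 0 at 0, so the differential of \<Psi> there is the identity for
    every \<epsilon>.\<close>
  from has_derivative_Pair[OF bounded_linear_imp_has_derivative[OF bounded_linear_fst]
      has_derivative_add[OF bounded_linear_imp_has_derivative[OF bounded_linear_snd] has_derivative_mult_right[OF this, of \<epsilon>]]]
  have "(\<Psi> has_derivative (\<lambda>v. v)) (at 0)"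
    unfolding \<Psi>_def by simp
  from plane_diffeo_germI[OF open_UNIV UNIV_I Ck _ this]
  have "Ck_diffeo_germ 1 \<Psi> 0 0" by (simp add: \<Psi>_def r_def zero_prod_def)
  moreover have "Ck_diffeo_germ 1 (\<lambda>t::real. t) 0 0"
    unfolding Ck_diffeo_germ_def Ck_on_def
    by (intro conjI exI[of _ UNIV] exI[of _ "\<lambda>t. t"] allI impI times_cont_diff_on_ident)
      (auto simp: homeomorphism_def)
  moreover have "(s ^ 4, s ^ 5 + \<epsilon> * s ^ 7) = \<Psi> (s ^ 4, s ^ 5)" for s
    by (simp add: \<Psi>_def r_def odd_real_root_power_cancel)
  ultimately show ?thesis
    unfolding C1_equivalent_def
    by (intro Ck_equivalentI[where \<tau>="\<lambda>t. t" and \<Psi>=\<Psi>]) (auto simp: zero_prod_def intro!: continuous_intros)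
qed


section \<open>Order of contact of a germ with its base point\<close>

lemma has_derivative_linear_bound:
  assumes "(f has_derivative L) (at a)"
  obtains K where "K > 0" "\<forall>\<^sub>F x in nhds a. norm (f x - f a) \<le> K * norm (x - a)"
proof -
  obtain K where K: "K > 0" "\<And>v. norm (L v) \<le> norm v * K"
    using bounded_linear.pos_bounded[OF has_derivative_bounded_linear[OF assms]] by blast
  obtain d where d: "d > 0" "\<And>y. norm (y - a) < d \<Longrightarrow> norm (f y - f a - L (y - a)) \<le> 1 * norm (y - a)"
    using assms unfolding has_derivative_at_alt by (meson zero_less_one)
  have "norm (f y - f a) \<le> (K + 1) * norm (y - a)" if "dist y a < d" for y
  proof -
    have "norm (f y - f a) \<le> norm (f y - f a - L (y - a)) + norm (L (y - a))"
      using norm_triangle_ineq[of "f y - f a - L (y - a)" "L (y - a)"] by simp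
    then show ?thesis using d(2)[of y] K(2)[of "y - a"] that by (simp add: dist_norm algebra_simps)
  qed
  then have "\<forall>\<^sub>F x in nhds a. norm (f x - f a) \<le> (K + 1) * norm (x - a)"
    unfolding eventually_nhds_metric using d(1) by blast
  then show thesis using K(1) by (intro that[of "K + 1"]) simp
qed

lemma Ck_diffeo_germ_bound:
  assumes "Ck_diffeo_germ k f a b" "1 \<le> k"
  obtains K where "K > 0" "\<forall>\<^sub>F x in nhds a. norm (f x - b) \<le> K * norm (x - a)"
proof -
  obtain U where U: "a \<in> U" "Ck_on k U f" and b: "f a = b"
    using assms(1) unfolding Ck_diffeo_germ_def by blast
  have "times_cont_diff_on (Suc 0) U f"
    using U(2) assms(2) unfolding Ck_on_def by (metis One_nat_def one_enat_def)
  from has_derivative_linear_bound[OF times_cont_diff_on_SucD[OF this U(1)]] show thesis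
    using that b by metis
qed

text \<open>\<phi>, \<Phi> and their inverses satisfy linear bounds at the base points. The lower
  estimate uses those for \<psi> and \<Phi>, the upper one those for \<phi> and \<Psi>.\<close>

lemma Ck_equivalent_order:
  assumes "Ck_equivalent k E \<delta>" "1 \<le> k" "isCont E 0" "isCont \<delta> 0" "\<delta> 0 = 0"
    and \<delta>: "c > 0" "\<forall>\<^sub>F t in nhds 0. c * \<bar>t\<bar> ^ n \<le> norm (\<delta> t)" "\<forall>\<^sub>F t in nhds 0. norm (\<delta> t) \<le> C * \<bar>t\<bar> ^ n"
  obtains c' C' where "c' > 0" "\<forall>\<^sub>F t in nhds 0. c' * \<bar>t\<bar> ^ n \<le> norm (E t - E 0)"
    "\<forall>\<^sub>F t in nhds 0. norm (E t - E 0) \<le> C' * \<bar>t\<bar> ^ n"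
proof -
  obtain \<phi> \<Phi> where \<phi>: "Ck_diffeo_germ k \<phi> 0 0" and \<Phi>: "Ck_diffeo_germ k \<Phi> (E 0) 0"
    and eq: "\<forall>\<^sub>F t in nhds 0. \<delta> (\<phi> t) = \<Phi> (E t)"
    using assms(1,5) unfolding Ck_equivalent_def by auto
  obtain \<psi> where \<psi>: "Ck_diffeo_germ k \<psi> 0 0" "\<forall>\<^sub>F t in nhds 0. \<psi> (\<phi> t) = t"
    using Ck_diffeo_germ_inverse[OF \<phi>] by metis
  obtain \<Psi> where \<Psi>: "Ck_diffeo_germ k \<Psi> 0 (E 0)" "\<forall>\<^sub>F x in nhds (E 0). \<Psi> (\<Phi> x) = x"
    using Ck_diffeo_germ_inverse[OF \<Phi>] by metis
  obtain K1 where K1: "K1 > 0" "\<forall>\<^sub>F t in nhds 0. norm (\<phi> t - 0) \<le> K1 * norm (t - 0)"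
    by (rule Ck_diffeo_germ_bound[OF \<phi> assms(2)])
  obtain K2 where K2: "K2 > 0" "\<forall>\<^sub>F t in nhds 0. norm (\<psi> t - 0) \<le> K2 * norm (t - 0)"
    by (rule Ck_diffeo_germ_bound[OF \<psi>(1) assms(2)])
  obtain K3 where K3: "K3 > 0" "\<forall>\<^sub>F x in nhds (E 0). norm (\<Phi> x - 0) \<le> K3 * norm (x - E 0)"
    by (rule Ck_diffeo_germ_bound[OF \<Phi> assms(2)])
  obtain K4 where K4: "K4 > 0" "\<forall>\<^sub>F y in nhds 0. norm (\<Psi> y - E 0) \<le> K4 * norm (y - 0)"
    by (rule Ck_diffeo_germ_bound[OF \<Psi>(1) assms(2)])
  have \<phi>0: "isCont \<phi> 0" "\<phi> 0 = 0" using Ck_diffeo_germ_isCont[OF \<phi>] \<phi> by (simp_all add: Ck_diffeo_germ_def)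
  have ev\<phi>: "\<forall>\<^sub>F t in nhds 0. P (\<phi> t)" if "\<forall>\<^sub>F s in nhds 0. P s" for P
    by (rule isCont_eventually_nhds[OF \<phi>0(1)]) (simp add: \<phi>0(2) that)
  have ev\<delta>: "\<forall>\<^sub>F t in nhds 0. P (\<delta> t)" if "\<forall>\<^sub>F s in nhds 0. P s" for P
    by (rule isCont_eventually_nhds[OF assms(4)]) (simp add: assms(5) that)
  note evE = isCont_eventually_nhds[OF assms(3)]
  show thesis
  proof (rule that)
    show "c / (K3 * K2 ^ n) > 0" using \<delta>(1) K2(1) K3(1) by simp
    show "\<forall>\<^sub>F t in nhds 0. c / (K3 * K2 ^ n) * \<bar>t\<bar> ^ n \<le> norm (E t - E 0)"
      using eq \<psi>(2) ev\<phi>[OF K2(2)] evE[OF K3(2)] ev\<phi>[OF \<delta>(2)]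
    proof eventually_elim
      case (elim t)
      have "\<bar>t\<bar> ^ n \<le> (K2 * \<bar>\<phi> t\<bar>) ^ n" using elim(2,3) by (intro power_mono) auto
      then have "c * \<bar>t\<bar> ^ n \<le> K2 ^ n * (c * \<bar>\<phi> t\<bar> ^ n)" using \<delta>(1) by (simp add: power_mult_distrib)
      also have "\<dots> \<le> K2 ^ n * (K3 * norm (E t - E 0))"
        using elim(1,4,5) K2(1) by (intro mult_left_mono) auto
      finally show ?case using K2(1) K3(1) by (simp add: pos_divide_le_eq mult.commute mult.left_commute)
    qed
    \<comment> \<open>\<open>max C 0\<close> because C is not assumed to be nonnegative and
      inequalities are multiplied by it.\<close>
    show "\<forall>\<^sub>F t in nhds 0. norm (E t - E 0) \<le> K4 * (max C 0 * K1 ^ n) * \<bar>t\<bar> ^ n"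
      using eq evE[OF \<Psi>(2)] K1(2) ev\<phi>[OF ev\<delta>[OF K4(2)]] ev\<phi>[OF \<delta>(3)]
    proof eventually_elim
      case (elim t)
      have "norm (E t - E 0) \<le> K4 * norm (\<delta> (\<phi> t))" using elim(1,2,4) by simp
      also have "\<dots> \<le> K4 * (max C 0 * \<bar>\<phi> t\<bar> ^ n)"
        using elim(5) K4(1) by (intro mult_left_mono order_trans[OF elim(5)] mult_right_mono) auto
      also have "\<dots> \<le> K4 * (max C 0 * (K1 * \<bar>t\<bar>) ^ n)"
        using elim(3) K4(1) by (intro mult_left_mono power_mono) auto
      finally show ?case by (simp add: power_mult_distrib mult.assoc)
    qed
  qed
qed

text \<open>If b > a, division by |t|^a and the limit t = 0 would give c <= 0.\<close>

lemma power_bound_exponent_le: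
  fixes c C :: real
  assumes "c > 0" "\<forall>\<^sub>F t::real in nhds 0. c * \<bar>t\<bar> ^ a \<le> C * \<bar>t\<bar> ^ b"
  shows "b \<le> a"
proof (rule ccontr)
  assume "\<not> b \<le> a"
  then obtain d where d: "b = a + Suc d" using less_imp_Suc_add by fastforce
  have "\<forall>\<^sub>F t::real in at 0. c \<le> C * \<bar>t\<bar> ^ Suc d"
    using assms(2) unfolding eventually_at_filter
  proof eventually_elim
    case (elim t)
    show ?case
    proof (intro impI)
      assume "t \<noteq> 0"
      then have "0 < \<bar>t\<bar> ^ a" by simp
      moreover have "\<bar>t\<bar> ^ a * c \<le> \<bar>t\<bar> ^ a * (C * \<bar>t\<bar> ^ Suc d)"
        using elim unfolding d power_add by (simp add: algebra_simps)
      ultimately show "c \<le> C * \<bar>t\<bar> ^ Suc d" using mult_le_cancel_left_pos by blast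
    qed
  qed
  moreover have "((\<lambda>t::real. C * \<bar>t\<bar> ^ Suc d) \<longlongrightarrow> C * \<bar>0\<bar> ^ Suc d) (at 0)" by (intro tendsto_intros)
  ultimately have "c \<le> C * \<bar>0\<bar> ^ Suc d" by (intro tendsto_lowerbound) auto
  with assms(1) show False by simp
qed

lemma isCont_factor_bounds:
  fixes P :: "real \<Rightarrow> real"
  assumes "isCont P 0"
  shows "\<forall>\<^sub>F u in nhds 0. \<bar>u ^ n * P u\<bar> \<le> (\<bar>P 0\<bar> + 1) * \<bar>u\<bar> ^ n"
    and "P 0 \<noteq> 0 \<Longrightarrow> \<forall>\<^sub>F u in nhds 0. \<bar>P 0\<bar> / 2 * \<bar>u\<bar> ^ n \<le> \<bar>u ^ n * P u\<bar>"
proof -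
  have c: "isCont (\<lambda>u. \<bar>P u\<bar>) 0" using assms by (intro continuous_intros)
  have "\<forall>\<^sub>F y in nhds \<bar>P 0\<bar>. y < \<bar>P 0\<bar> + 1" by (rule eventually_nhds_in_open[of "{..<\<bar>P 0\<bar> + 1}", simplified]) simp
  from isCont_eventually_nhds[OF c this] show "\<forall>\<^sub>F u in nhds 0. \<bar>u ^ n * P u\<bar> \<le> (\<bar>P 0\<bar> + 1) * \<bar>u\<bar> ^ n"
  proof eventually_elim
    case (elim u)
    then have "\<bar>u\<bar> ^ n * \<bar>P u\<bar> \<le> \<bar>u\<bar> ^ n * (\<bar>P 0\<bar> + 1)" by (intro mult_left_mono) auto
    then show ?case by (simp add: abs_mult power_abs mult.commute)
  qed
  assume "P 0 \<noteq> 0"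
  then have "\<forall>\<^sub>F y in nhds \<bar>P 0\<bar>. y \<in> {\<bar>P 0\<bar> / 2<..}" by (intro eventually_nhds_in_open) simp_all
  from isCont_eventually_nhds[OF c this] show "\<forall>\<^sub>F u in nhds 0. \<bar>P 0\<bar> / 2 * \<bar>u\<bar> ^ n \<le> \<bar>u ^ n * P u\<bar>"
  proof eventually_elim
    case (elim u)
    then have "\<bar>u\<bar> ^ n * (\<bar>P 0\<bar> / 2) \<le> \<bar>u\<bar> ^ n * \<bar>P u\<bar>" by (intro mult_left_mono) auto
    then show ?case by (simp add: abs_mult power_abs mult.commute)
  qed
qed

section \<open>Curves parametrised by their tangent angle\<close>

lemma antiderivative_expansion:
  fixes f :: "real \<Rightarrow> real"
  assumes "f 0 = 0" "smooth_at r 0"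
    and "\<forall>\<^sub>F u in nhds 0. (f has_real_derivative u ^ n * (c0 + c1 * u + c2 * u ^ 2 + u ^ 3 * r u)) (at u)"
  obtains h where "smooth_at h 0" "\<forall>\<^sub>F u in nhds 0. f u = u ^ (n + 1) *
    (c0 / real (n + 1) + c1 / real (n + 2) * u + c2 / real (n + 3) * u ^ 2 + u ^ 3 * h u)"
proof -
  let ?p = "\<lambda>u::real. c0 / real (Suc n) * u ^ Suc n + c1 / real (Suc (n + 1)) * u ^ Suc (n + 1)
    + c2 / real (Suc (n + 2)) * u ^ Suc (n + 2)"
  have mono: "((\<lambda>u. c / real (Suc k) * u ^ Suc k) has_real_derivative c * u ^ k) (at u)" for c u :: real and k
    by (rule DERIV_cong[OF DERIV_cmult[OF DERIV_pow]]) simp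
  have p: "(?p has_real_derivative u ^ n * (c0 + c1 * u + c2 * u ^ 2)) (at u)" for u
    by (rule DERIV_cong[OF DERIV_add[OF DERIV_add[OF mono[of c0 n u] mono[of c1 "n + 1" u]] mono[of c2 "n + 2" u]]])
      (simp add: power_add algebra_simps power2_eq_square)
  \<comment> \<open>With the polynomial part integrated explicitly, the rest has a derivative
    divisible by u^(n+3) and is therefore divisible by u^(n+4).\<close>
  have "\<forall>\<^sub>F u in nhds 0. ((\<lambda>u. f u - ?p u) has_real_derivative u ^ (n + 3) * r u) (at u)"
    using assms(3)
  proof eventually_elim
    case (elim u)
    show ?case
      by (rule DERIV_cong[OF DERIV_diff[OF elim p]]) (simp add: power_add algebra_simps)
  qed
  from smooth_at_antiderivative_factor[OF assms(2) this]
  obtain h where h: "smooth_at h 0" "\<forall>\<^sub>F u in nhds 0. f u - ?p u = u ^ Suc (n + 3) * h u"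
    using assms(1) by auto
  from h(2) have "\<forall>\<^sub>F u in nhds 0. f u = u ^ (n + 1) *
    (c0 / real (n + 1) + c1 / real (n + 2) * u + c2 / real (n + 3) * u ^ 2 + u ^ 3 * h u)"
  proof eventually_elim
    case (elim u)
    then have "f u = ?p u + u ^ Suc (n + 3) * h u" by simp
    then show ?case by (simp add: power_add algebra_simps eval_nat_numeral)
  qed
  with h(1) show thesis by (rule that)
qed

lemma sin_cos_expansion:
  obtains p q :: "real \<Rightarrow> real" where "smooth_at p 0" "\<forall>\<^sub>F u in nhds 0. cos u = 1 - u ^ 2 / 2 + u ^ 3 * p u"
    "smooth_at q 0" "\<forall>\<^sub>F u in nhds 0. sin u = u * (1 - u ^ 2 / 6 + u ^ 3 * q u)"
proof -
  obtain w0 where w0: "smooth_at w0 (0::real)" "\<forall>\<^sub>F u::real in nhds 0. sin u = u ^ Suc 0 * w0 u"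
    by (rule smooth_at_antiderivative_factor[OF smooth_at_cos, of sin 0])
      (auto intro!: always_eventually derivative_eq_intros)
  \<comment> \<open>A chain of antiderivatives starting from sin: each integration raises the order
    of vanishing by one and keeps the quotient smooth.\<close>
  have d: "((\<lambda>u. 1 - cos u) has_real_derivative sin u) (at u)"
    "((\<lambda>u. u - sin u) has_real_derivative 1 - cos u) (at u)"
    "((\<lambda>u. cos u - 1 + u ^ 2 / 2) has_real_derivative u - sin u) (at u)"
    "((\<lambda>u. sin u - u + u ^ 3 / 6) has_real_derivative cos u - 1 + u ^ 2 / 2) (at u)" for u :: real
    by (auto intro!: derivative_eq_intros)
  have "\<forall>\<^sub>F u in nhds 0. ((\<lambda>u. 1 - cos u) has_real_derivative u ^ 1 * w0 u) (at u)"
    using w0(2) by eventually_elim (rule DERIV_cong[OF d(1)], simp)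
  then obtain w1 :: "real \<Rightarrow> real" where w1: "smooth_at w1 0" "\<forall>\<^sub>F u in nhds 0. 1 - cos u = u ^ Suc 1 * w1 u"
    by (rule smooth_at_antiderivative_factor[OF w0(1)]) simp
  have "\<forall>\<^sub>F u in nhds 0. ((\<lambda>u. u - sin u) has_real_derivative u ^ 2 * w1 u) (at u)"
    using w1(2) by eventually_elim (rule DERIV_cong[OF d(2)], simp add: eval_nat_numeral)
  then obtain w2 :: "real \<Rightarrow> real" where w2: "smooth_at w2 0" "\<forall>\<^sub>F u in nhds 0. u - sin u = u ^ Suc 2 * w2 u"
    by (rule smooth_at_antiderivative_factor[OF w1(1)]) simp
  have "\<forall>\<^sub>F u in nhds 0. ((\<lambda>u. cos u - 1 + u ^ 2 / 2) has_real_derivative u ^ 3 * w2 u) (at u)"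
    using w2(2) by eventually_elim (rule DERIV_cong[OF d(3)], simp add: eval_nat_numeral)
  then obtain w3 :: "real \<Rightarrow> real" where w3: "smooth_at w3 0" "\<forall>\<^sub>F u in nhds 0. cos u - 1 + u ^ 2 / 2 = u ^ Suc 3 * w3 u"
    by (rule smooth_at_antiderivative_factor[OF w2(1)]) simp
  have "\<forall>\<^sub>F u in nhds 0. ((\<lambda>u. sin u - u + u ^ 3 / 6) has_real_derivative u ^ 4 * w3 u) (at u)"
    using w3(2) by eventually_elim (rule DERIV_cong[OF d(4)], simp add: eval_nat_numeral)
  then obtain w4 :: "real \<Rightarrow> real" where w4: "smooth_at w4 0" "\<forall>\<^sub>F u in nhds 0. sin u - u + u ^ 3 / 6 = u ^ Suc 4 * w4 u"
    by (rule smooth_at_antiderivative_factor[OF w3(1)]) simp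
  show thesis
  proof (rule that)
    show "smooth_at (\<lambda>u. u * w3 u) 0" "smooth_at (\<lambda>u. u * w4 u) 0" by (intro smooth_intros w3 w4)+
    show "\<forall>\<^sub>F u in nhds 0. cos u = 1 - u ^ 2 / 2 + u ^ 3 * (u * w3 u)"
      using w3(2) by eventually_elim (simp add: eval_nat_numeral algebra_simps)
    show "\<forall>\<^sub>F u in nhds 0. sin u = u * (1 - u ^ 2 / 6 + u ^ 3 * (u * w4 u))"
      using w4(2) by eventually_elim (simp add: eval_nat_numeral algebra_simps)
  qed
qed

text \<open>The corrections - g0 / 2 and - g0 / 6 are due to the quadratic terms of cos u and of sin
  u / u. They express the turning of the tangent and are the source of the summand with 2400 in
  Q.\<close>

lemma tangent_angle_expansion:
  assumes E: "\<forall>\<^sub>F u in nhds 0. (E has_vector_derivative D u *\<^sub>R tangent_dir (u + \<theta>)) (at u)"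
    and D: "smooth_at g3 0" "\<forall>\<^sub>F u in nhds 0. D u = u ^ m * (g0 + g1 * u + g2 * u ^ 2 + u ^ 3 * g3 u)"
  obtains X Y hX hY where
    "\<forall>u. E u = E 0 + X u *\<^sub>R tangent_dir \<theta> + Y u *\<^sub>R normal_dir \<theta>"
    "smooth_at hX 0" "\<forall>\<^sub>F u in nhds 0. X u = u ^ (m + 1) * (g0 / real (m + 1) + g1 / real (m + 2) * u
      + (g2 - g0 / 2) / real (m + 3) * u ^ 2 + u ^ 3 * hX u)"
    "smooth_at hY 0" "\<forall>\<^sub>F u in nhds 0. Y u = u ^ (m + 2) * (g0 / real (m + 2) + g1 / real (m + 3) * u
      + (g2 - g0 / 6) / real (m + 4) * u ^ 2 + u ^ 3 * hY u)"
proof -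
  define X Y where "X u = (E u - E 0) \<bullet> tangent_dir \<theta>" and "Y u = (E u - E 0) \<bullet> normal_dir \<theta>" for u
  have sc: "sin \<theta> * sin \<theta> + cos \<theta> * cos \<theta> = 1"
    using sin_cos_squared_add[of \<theta>] by (simp add: power2_eq_square)
  have frame: "E u = E 0 + X u *\<^sub>R tangent_dir \<theta> + Y u *\<^sub>R normal_dir \<theta>" for u
  proof -
    obtain a b where ab: "E u - E 0 = (a, b)" by fastforce
    have "a = (a * cos \<theta> + b * sin \<theta>) * cos \<theta> - (b * cos \<theta> - a * sin \<theta>) * sin \<theta>"
      "b = (a * cos \<theta> + b * sin \<theta>) * sin \<theta> + (b * cos \<theta> - a * sin \<theta>) * cos \<theta>"
      using sc by algebra+
    then have "E u - E 0 = X u *\<^sub>R tangent_dir \<theta> + Y u *\<^sub>R normal_dir \<theta>"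
      unfolding X_def Y_def ab by (simp add: tangent_dir_def normal_dir_def)
    then show ?thesis by (metis add.assoc add_diff_cancel_left' diff_add_cancel add.commute)
  qed
  obtain p q :: "real \<Rightarrow> real" where p: "smooth_at p 0" "\<forall>\<^sub>F u in nhds 0. cos u = 1 - u ^ 2 / 2 + u ^ 3 * p u"
    and q: "smooth_at q 0" "\<forall>\<^sub>F u in nhds 0. sin u = u * (1 - u ^ 2 / 6 + u ^ 3 * q u)"
    by (rule sin_cos_expansion)
  have inner: "tangent_dir (u + \<theta>) \<bullet> tangent_dir \<theta> = cos u" "tangent_dir (u + \<theta>) \<bullet> normal_dir \<theta> = sin u" for u
    using cos_diff[of "u + \<theta>" \<theta>] sin_diff[of "u + \<theta>" \<theta>] by (simp_all add: tangent_dir_def normal_dir_def)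
  have dXY: "(X has_real_derivative D u * cos u) (at u)" "(Y has_real_derivative D u * sin u) (at u)"
    if "(E has_vector_derivative D u *\<^sub>R tangent_dir (u + \<theta>)) (at u)" for u
  proof -
    have "((\<lambda>u. (E u - E 0) \<bullet> w) has_vector_derivative (D u *\<^sub>R tangent_dir (u + \<theta>)) \<bullet> w) (at u)" for w
      using bounded_linear.has_vector_derivative[OF bounded_linear_inner_left
          has_vector_derivative_diff[OF that has_vector_derivative_const[of "E 0"]], of w] by simp
    from this[of "tangent_dir \<theta>"] this[of "normal_dir \<theta>"]
    show "(X has_real_derivative D u * cos u) (at u)" "(Y has_real_derivative D u * sin u) (at u)"
      unfolding X_def[abs_def] Y_def[abs_def] has_real_derivative_iff_has_vector_derivative
      by (simp_all add: inner)
  qed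
  \<comment> \<open>The products of - u^2 / 2 with g1 u and g2 u^2 have orders 3 and 4 and therefore
    end up here, as - g1 / 2 and - g2 / 2 * u.\<close>
  let ?r = "\<lambda>u. g3 u * cos u + (g0 + g1 * u + g2 * u ^ 2) * p u - g1 / 2 - g2 / 2 * u"
  let ?s = "\<lambda>u. g3 u * (1 - u ^ 2 / 6 + u ^ 3 * q u) + (g0 + g1 * u + g2 * u ^ 2) * q u - g1 / 6 - g2 / 6 * u"
  have r: "smooth_at ?r 0" "smooth_at ?s 0" by (intro smooth_intros smooth_at_cos D(1) p(1) q(1); simp)+
  have dX: "\<forall>\<^sub>F u in nhds 0. (X has_real_derivative u ^ m * (g0 + g1 * u + (g2 - g0 / 2) * u ^ 2 + u ^ 3 * ?r u)) (at u)"
    using E D(2) p(2)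
  proof eventually_elim
    case (elim u)
    have "D u * cos u = u ^ m * ((g0 + g1 * u + g2 * u ^ 2) * cos u + u ^ 3 * (g3 u * cos u))"
      unfolding elim(2) by (simp add: algebra_simps)
    also have "(g0 + g1 * u + g2 * u ^ 2) * cos u = (g0 + g1 * u + g2 * u ^ 2) * (1 - u ^ 2 / 2 + u ^ 3 * p u)"
      unfolding elim(3) ..
    finally have "D u * cos u = u ^ m * (g0 + g1 * u + (g2 - g0 / 2) * u ^ 2 + u ^ 3 * ?r u)"
      by (simp add: algebra_simps eval_nat_numeral)
    then show ?case using dXY(1)[OF elim(1)] by simp
  qed
  have dY: "\<forall>\<^sub>F u in nhds 0. (Y has_real_derivative u ^ (m + 1) * (g0 + g1 * u + (g2 - g0 / 6) * u ^ 2 + u ^ 3 * ?s u)) (at u)"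
    using E D(2) q(2)
  proof eventually_elim
    case (elim u)
    have "D u * sin u = u ^ (m + 1) * (g0 + g1 * u + (g2 - g0 / 6) * u ^ 2 + u ^ 3 * ?s u)"
      unfolding elim(2,3) by (simp add: algebra_simps eval_nat_numeral)
    then show ?case using dXY(2)[OF elim(1)] by simp
  qed
  have z: "X 0 = 0" "Y 0 = 0" by (simp_all add: X_def Y_def)
  obtain hX where hX: "smooth_at hX 0" "\<forall>\<^sub>F u in nhds 0. X u = u ^ (m + 1) * (g0 / real (m + 1) + g1 / real (m + 2) * u
      + (g2 - g0 / 2) / real (m + 3) * u ^ 2 + u ^ 3 * hX u)"
    by (rule antiderivative_expansion[OF z(1) r(1) dX])
  obtain hY where hY: "smooth_at hY 0" "\<forall>\<^sub>F u in nhds 0. Y u = u ^ (m + 1 + 1) * (g0 / real (m + 1 + 1) + g1 / real (m + 1 + 2) * u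
      + (g2 - g0 / 6) / real (m + 1 + 3) * u ^ 2 + u ^ 3 * hY u)"
    by (rule antiderivative_expansion[OF z(2) r(2) dY])
  have nat: "m + 1 + 1 = m + 2" "m + 1 + 2 = m + 3" "m + 1 + 3 = m + 4" by simp_all
  show thesis by (rule that[OF allI[OF frame] hX hY[unfolded nat]])
qed

text \<open>Y is of higher order than the leading term of X, so X decides. As an inner product with
  a unit vector, X also bounds the distance from below.\<close>

lemma tangent_angle_order:
  assumes E: "\<forall>\<^sub>F u in nhds 0. (E has_vector_derivative D u *\<^sub>R tangent_dir (u + \<theta>)) (at u)"
    and D: "smooth_at g3 0" "\<forall>\<^sub>F u in nhds 0. D u = u ^ m * (g0 + g1 * u + g2 * u ^ 2 + u ^ 3 * g3 u)"
  shows "\<exists>C. \<forall>\<^sub>F u in nhds 0. norm (E u - E 0) \<le> C * \<bar>u\<bar> ^ (m + 1)"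
    and "g0 \<noteq> 0 \<Longrightarrow> \<exists>c>0. \<forall>\<^sub>F u in nhds 0. c * \<bar>u\<bar> ^ (m + 1) \<le> norm (E u - E 0)"
proof -
  obtain X Y hX hY where
    frame: "\<forall>u. E u = E 0 + X u *\<^sub>R tangent_dir \<theta> + Y u *\<^sub>R normal_dir \<theta>" and
    X: "smooth_at hX 0" "\<forall>\<^sub>F u in nhds 0. X u = u ^ (m + 1) * (g0 / real (m + 1) + g1 / real (m + 2) * u
      + (g2 - g0 / 2) / real (m + 3) * u ^ 2 + u ^ 3 * hX u)" and
    Y: "smooth_at hY 0" "\<forall>\<^sub>F u in nhds 0. Y u = u ^ (m + 2) * (g0 / real (m + 2) + g1 / real (m + 3) * u
      + (g2 - g0 / 6) / real (m + 4) * u ^ 2 + u ^ 3 * hY u)"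
    by (rule tangent_angle_expansion[OF E D])
  define P where "P u = g0 / real (m + 1) + g1 / real (m + 2) * u
      + (g2 - g0 / 2) / real (m + 3) * u ^ 2 + u ^ 3 * hX u" for u
  define R where "R u = u * (g0 / real (m + 2) + g1 / real (m + 3) * u
      + (g2 - g0 / 6) / real (m + 4) * u ^ 2 + u ^ 3 * hY u)" for u
  have PR: "isCont P 0" "isCont R 0"
    unfolding P_def R_def by (intro smooth_at_isCont smooth_intros X(1) Y(1))+
  have unit: "norm (tangent_dir \<theta>) = 1" "norm (normal_dir \<theta>) = 1" "tangent_dir \<theta> \<bullet> tangent_dir \<theta> = 1"
    "normal_dir \<theta> \<bullet> tangent_dir \<theta> = 0"
    by (simp_all add: tangent_dir_def normal_dir_def norm_Pair flip: power2_eq_square)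
  have X': "\<forall>\<^sub>F u in nhds 0. X u = u ^ (m + 1) * P u" using X(2) unfolding P_def .
  have Y': "\<forall>\<^sub>F u in nhds 0. Y u = u ^ (m + 1) * R u"
    using Y(2) by eventually_elim (simp add: R_def)
  have diff: "E u - E 0 = X u *\<^sub>R tangent_dir \<theta> + Y u *\<^sub>R normal_dir \<theta>" for u
    by (subst frame[rule_format]) simp
  have "\<forall>\<^sub>F u in nhds 0. norm (E u - E 0) \<le> (\<bar>P 0\<bar> + 1 + (\<bar>R 0\<bar> + 1)) * \<bar>u\<bar> ^ (m + 1)"
    using isCont_factor_bounds(1)[OF PR(1), of "m + 1"] isCont_factor_bounds(1)[OF PR(2), of "m + 1"] X' Y'
  proof eventually_elim
    case (elim u)
    have "norm (E u - E 0) \<le> \<bar>X u\<bar> + \<bar>Y u\<bar>"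
      unfolding diff using norm_triangle_ineq[of "X u *\<^sub>R tangent_dir \<theta>" "Y u *\<^sub>R normal_dir \<theta>"] by (simp add: unit)
    with elim show ?case by (simp add: distrib_right)
  qed
  then show "\<exists>C. \<forall>\<^sub>F u in nhds 0. norm (E u - E 0) \<le> C * \<bar>u\<bar> ^ (m + 1)" by blast
  assume "g0 \<noteq> 0"
  then have P0: "P 0 \<noteq> 0" by (simp add: P_def)
  have "\<forall>\<^sub>F u in nhds 0. \<bar>P 0\<bar> / 2 * \<bar>u\<bar> ^ (m + 1) \<le> norm (E u - E 0)"
    using isCont_factor_bounds(2)[OF PR(1) P0, of "m + 1"] X'
  proof eventually_elim
    case (elim u)
    have "\<bar>X u\<bar> = \<bar>(E u - E 0) \<bullet> tangent_dir \<theta>\<bar>"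
      unfolding diff by (simp add: inner_add_left unit)
    also have "\<dots> \<le> norm (E u - E 0)" using Cauchy_Schwarz_ineq2[of "E u - E 0" "tangent_dir \<theta>"] by (simp add: unit)
    finally show ?case using elim by simp
  qed
  with P0 show "\<exists>c>0. \<forall>\<^sub>F u in nhds 0. c * \<bar>u\<bar> ^ (m + 1) \<le> norm (E u - E 0)"
    by (intro exI[of _ "\<bar>P 0\<bar> / 2"]) simp
qed

text \<open>Three coefficients are displayed because \<epsilon> depends only on the derivatives of
  order 3, 4 and 5 when m = 3.\<close>

lemma higher_deriv_expansion:
  fixes f :: "real \<Rightarrow> real"
  assumes "smooth_at f 0" "\<And>i. i < m \<Longrightarrow> (deriv ^^ i) f 0 = 0"
  obtains r where "smooth_at r 0" "\<forall>\<^sub>F t in nhds 0. f t = t ^ m * ((deriv ^^ m) f 0 / fact m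
    + (deriv ^^ (m + 1)) f 0 / fact (m + 1) * t + (deriv ^^ (m + 2)) f 0 / fact (m + 2) * t ^ 2 + t ^ 3 * r t)"
proof -
  obtain r where r: "smooth_at r 0"
    "\<forall>\<^sub>F t in nhds 0. f t = (\<Sum>i<m + 3. (deriv ^^ i) f 0 / fact i * t ^ i) + t ^ (m + 3) * r t"
    by (rule taylor_smooth[OF assms(1)])
  have m3: "{..<m + 3} = insert (m + 2) (insert (m + 1) (insert m {..<m}))" by auto
  have "(\<Sum>i<m. (deriv ^^ i) f 0 / fact i * t ^ i) = 0" for t
    using assms(2) by (intro sum.neutral) auto
  then have s: "(\<Sum>i<m + 3. (deriv ^^ i) f 0 / fact i * t ^ i) = (deriv ^^ m) f 0 / fact m * t ^ m
    + (deriv ^^ (m + 1)) f 0 / fact (m + 1) * t ^ (m + 1) + (deriv ^^ (m + 2)) f 0 / fact (m + 2) * t ^ (m + 2)" for t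
    unfolding m3 by (simp del: fact_Suc funpow.simps)
  have "\<forall>\<^sub>F t in nhds 0. f t = t ^ m * ((deriv ^^ m) f 0 / fact m
    + (deriv ^^ (m + 1)) f 0 / fact (m + 1) * t + (deriv ^^ (m + 2)) f 0 / fact (m + 2) * t ^ 2 + t ^ 3 * r t)"
    using r(2)
  proof eventually_elim
    case (elim t)
    show ?case unfolding elim s power_add by (simp add: algebra_simps del: fact_Suc funpow.simps)
  qed
  with r(1) show thesis by (rule that)
qed

lemma monomial_curve_order:
  "\<forall>\<^sub>F t in nhds 0. 1 * \<bar>t\<bar> ^ n \<le> norm (t ^ n, t ^ Suc n :: real)"
  "\<forall>\<^sub>F t in nhds 0. norm (t ^ n, t ^ Suc n :: real) \<le> 2 * \<bar>t\<bar> ^ n"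
proof -
  show "\<forall>\<^sub>F t in nhds 0. 1 * \<bar>t\<bar> ^ n \<le> norm (t ^ n, t ^ Suc n :: real)"
    using norm_fst_le[of "t ^ n" "t ^ Suc n" for t :: real] by (intro always_eventually allI) (simp add: power_abs)
  have "\<forall>\<^sub>F t::real in nhds 0. t \<in> {-1<..<1}" by (intro eventually_nhds_in_open) auto
  then show "\<forall>\<^sub>F t in nhds 0. norm (t ^ n, t ^ Suc n :: real) \<le> 2 * \<bar>t\<bar> ^ n"
  proof eventually_elim
    case (elim t)
    have "norm (t ^ n, t ^ Suc n) \<le> \<bar>t\<bar> ^ n + \<bar>t\<bar> ^ n * \<bar>t\<bar>"
      using norm_Pair_le[of "t ^ n" "t ^ Suc n"] by (simp add: power_abs abs_mult mult.commute)
    also have "\<dots> \<le> \<bar>t\<bar> ^ n + \<bar>t\<bar> ^ n * 1" using elim by (intro add_left_mono mult_left_mono) auto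
    finally show ?case by simp
  qed
qed

lemma A_equivalent_monomial_order:
  assumes "A_equivalent E (\<lambda>t. (t ^ n, t ^ Suc n))" "isCont E 0" "n > 0"
  obtains c C where "c > 0" "\<forall>\<^sub>F t in nhds 0. c * \<bar>t\<bar> ^ n \<le> norm (E t - E 0)"
    "\<forall>\<^sub>F t in nhds 0. norm (E t - E 0) \<le> C * \<bar>t\<bar> ^ n"
  by (rule Ck_equivalent_order[OF assms(1)[unfolded A_equivalent_def] _ assms(2) _ _ _ monomial_curve_order[of n]])
    (use assms(3) in \<open>auto simp: zero_prod_def power_0_left intro!: continuous_intros\<close>)

text \<open>The vanishing order of \<open>D\<close> at \<open>0\<close> is determined by the order of contact of \<open>E\<close> with its
  base point, which is invariant under equivalence.\<close>

lemma tangent_angle_monomial_order: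
  assumes E: "\<forall>\<^sub>F u in nhds 0. (E has_vector_derivative D u *\<^sub>R tangent_dir (u + \<theta>)) (at u)"
    and D: "smooth_at D 0" and "isCont E 0" "A_equivalent E (\<lambda>t. (t ^ Suc m, t ^ Suc (Suc m)))"
  shows "(\<forall>i<m. (deriv ^^ i) D 0 = 0) \<and> (deriv ^^ m) D 0 \<noteq> 0"
proof -
  obtain c C where cC: "c > 0" "\<forall>\<^sub>F t in nhds 0. c * \<bar>t\<bar> ^ Suc m \<le> norm (E t - E 0)"
    "\<forall>\<^sub>F t in nhds 0. norm (E t - E 0) \<le> C * \<bar>t\<bar> ^ Suc m"
    by (rule A_equivalent_monomial_order[OF assms(4,3)]) auto
  \<comment> \<open>If the first nonzero derivative has index k, the distance to E 0 is at least of
    size |u|^(k+1), while the equivalence makes it at most of size |u|^(m+1).\<close>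
  have ge: "m \<le> k" if k: "\<And>i. i < k \<Longrightarrow> (deriv ^^ i) D 0 = 0" "(deriv ^^ k) D 0 \<noteq> 0" for k
  proof -
    obtain r where r: "smooth_at r 0" "\<forall>\<^sub>F t in nhds 0. D t = t ^ k * ((deriv ^^ k) D 0 / fact k
      + (deriv ^^ (k + 1)) D 0 / fact (k + 1) * t + (deriv ^^ (k + 2)) D 0 / fact (k + 2) * t ^ 2 + t ^ 3 * r t)"
      by (rule higher_deriv_expansion[OF D k(1)])
    obtain c' where c': "c' > 0" "\<forall>\<^sub>F u in nhds 0. c' * \<bar>u\<bar> ^ (k + 1) \<le> norm (E u - E 0)"
      using tangent_angle_order(2)[OF E r] k(2) by auto
    from c'(2) cC(3) have "\<forall>\<^sub>F u in nhds 0. c' * \<bar>u\<bar> ^ (k + 1) \<le> C * \<bar>u\<bar> ^ Suc m"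
      by eventually_elim linarith
    from power_bound_exponent_le[OF c'(1) this] show ?thesis by simp
  qed
  have low: "(deriv ^^ i) D 0 = 0" if "i < m" for i
    using that
  proof (induction i rule: less_induct)
    case (less i)
    then show ?case using ge[of i] by (meson less_trans not_le)
  qed
  moreover have "(deriv ^^ m) D 0 \<noteq> 0"
  proof
    assume "(deriv ^^ m) D 0 = 0"
    \<comment> \<open>One further vanishing derivative would bound the distance above by a multiple
      of |u|^(m+2), against the lower bound of order m + 1.\<close>
    with low have *: "(deriv ^^ i) D 0 = 0" if "i < Suc m" for i using that by (auto simp: less_Suc_eq)
    obtain r where r: "smooth_at r 0" "\<forall>\<^sub>F t in nhds 0. D t = t ^ Suc m * ((deriv ^^ Suc m) D 0 / fact (Suc m)
      + (deriv ^^ (Suc m + 1)) D 0 / fact (Suc m + 1) * t + (deriv ^^ (Suc m + 2)) D 0 / fact (Suc m + 2) * t ^ 2 + t ^ 3 * r t)"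
      by (rule higher_deriv_expansion[OF D *])
    obtain C' where C': "\<forall>\<^sub>F u in nhds 0. norm (E u - E 0) \<le> C' * \<bar>u\<bar> ^ (Suc m + 1)"
      using tangent_angle_order(1)[OF E r] by blast
    from C' cC(2) have "\<forall>\<^sub>F u in nhds 0. c * \<bar>u\<bar> ^ Suc m \<le> C' * \<bar>u\<bar> ^ (Suc m + 1)"
      by eventually_elim linarith
    from power_bound_exponent_le[OF cC(1) this] show False by simp
  qed
  ultimately show ?thesis by blast
qed


lemma higher_deriv_cmult:
  fixes f :: "real \<Rightarrow> real"
  assumes "smooth_at f a"
  shows "\<forall>\<^sub>F t in nhds a. (deriv ^^ n) (\<lambda>t. c * f t) t = c * (deriv ^^ n) f t"
proof (induction n)
  case (Suc n)
  from eventually_deriv_cong[OF Suc] smooth_at_deriv(2)[OF smooth_at_higher_deriv[OF assms, of n]]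
  show ?case
  proof eventually_elim
    case (elim t)
    have "deriv (\<lambda>t. c * (deriv ^^ n) f t) t = c * deriv ((deriv ^^ n) f) t"
      by (rule DERIV_imp_deriv[OF DERIV_cmult[OF elim(2)]])
    with elim(1) show ?case by simp
  qed
qed simp

section \<open>The Wigner caustic branch\<close>

lemma tangent_angle_3_2_cusp:
  assumes E: "\<forall>\<^sub>F u in nhds 0. (E has_vector_derivative D u *\<^sub>R tangent_dir (u + \<theta>)) (at u)"
    and D: "smooth_at D 0" "D 0 = 0" "deriv D 0 \<noteq> 0"
  shows "is_3_2_cusp E"
proof -
  obtain r where r: "smooth_at r 0" "\<forall>\<^sub>F t in nhds 0. D t = t ^ 1 * ((deriv ^^ 1) D 0 / fact 1
    + (deriv ^^ (1 + 1)) D 0 / fact (1 + 1) * t + (deriv ^^ (1 + 2)) D 0 / fact (1 + 2) * t ^ 2 + t ^ 3 * r t)"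
    by (rule higher_deriv_expansion[OF D(1), of 1]) (use D(2) in auto)
  define g0 g1 g2 where "g0 = (deriv ^^ 1) D 0 / fact 1" and "g1 = (deriv ^^ (1 + 1)) D 0 / fact (1 + 1)"
    and "g2 = (deriv ^^ (1 + 2)) D 0 / fact (1 + 2)"
  have g0: "g0 \<noteq> 0" using D(3) by (simp add: g0_def)
  obtain X Y hX hY where frame: "\<forall>u. E u = E 0 + X u *\<^sub>R tangent_dir \<theta> + Y u *\<^sub>R normal_dir \<theta>"
    and X: "smooth_at hX 0" "\<forall>\<^sub>F u in nhds 0. X u = u ^ (1 + 1) * (g0 / real (1 + 1) + g1 / real (1 + 2) * u
      + (g2 - g0 / 2) / real (1 + 3) * u ^ 2 + u ^ 3 * hX u)"
    and Y: "smooth_at hY 0" "\<forall>\<^sub>F u in nhds 0. Y u = u ^ (1 + 2) * (g0 / real (1 + 2) + g1 / real (1 + 3) * u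
      + (g2 - g0 / 6) / real (1 + 4) * u ^ 2 + u ^ 3 * hY u)"
    by (rule tangent_angle_expansion[OF E r[folded g0_def g1_def g2_def]])
  show ?thesis
  proof (rule is_3_2_cuspI)
    show "\<forall>\<^sub>F u in nhds 0. E u = E 0 + X u *\<^sub>R tangent_dir \<theta> + Y u *\<^sub>R normal_dir \<theta>"
      using frame by (rule always_eventually)
    show "smooth_at (\<lambda>u. (g2 - g0 / 2) / 4 + u * hX u) 0" by (intro smooth_intros X(1)) simp
    show "\<forall>\<^sub>F u in nhds 0. X u = g0 / 2 * u ^ 2 + g1 / 3 * u ^ 3 + u ^ 4 * ((g2 - g0 / 2) / 4 + u * hX u)"
      using X(2) by eventually_elim (simp add: eval_nat_numeral algebra_simps)
    show "smooth_at (\<lambda>u. g1 / 4 + (g2 - g0 / 6) / 5 * u + u ^ 2 * hY u) 0" by (intro smooth_intros Y(1)) simp_all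
    show "\<forall>\<^sub>F u in nhds 0. Y u = g0 / 3 * u ^ 3 + u ^ 4 * (g1 / 4 + (g2 - g0 / 6) / 5 * u + u ^ 2 * hY u)"
      using Y(2) by eventually_elim (simp add: eval_nat_numeral algebra_simps)
  qed (use g0 in simp_all)
qed

lemma tangent_angle_4_3_cusp:
  assumes E: "\<forall>\<^sub>F u in nhds 0. (E has_vector_derivative D u *\<^sub>R tangent_dir (u + \<theta>)) (at u)"
    and D: "smooth_at D 0" "D 0 = 0" "deriv D 0 = 0" "(deriv ^^ 2) D 0 \<noteq> 0"
  shows "is_4_3_cusp E"
proof -
  obtain r where r: "smooth_at r 0" "\<forall>\<^sub>F t in nhds 0. D t = t ^ 2 * ((deriv ^^ 2) D 0 / fact 2
    + (deriv ^^ (2 + 1)) D 0 / fact (2 + 1) * t + (deriv ^^ (2 + 2)) D 0 / fact (2 + 2) * t ^ 2 + t ^ 3 * r t)"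
    by (rule higher_deriv_expansion[OF D(1), of 2]) (use D(2,3) in \<open>auto simp: less_2_cases_iff\<close>)
  define g0 g1 g2 where "g0 = (deriv ^^ 2) D 0 / fact 2" and "g1 = (deriv ^^ (2 + 1)) D 0 / fact (2 + 1)"
    and "g2 = (deriv ^^ (2 + 2)) D 0 / fact (2 + 2)"
  have g0: "g0 \<noteq> 0" using D(4) by (simp add: g0_def)
  obtain X Y hX hY where frame: "\<forall>u. E u = E 0 + X u *\<^sub>R tangent_dir \<theta> + Y u *\<^sub>R normal_dir \<theta>"
    and X: "smooth_at hX 0" "\<forall>\<^sub>F u in nhds 0. X u = u ^ (2 + 1) * (g0 / real (2 + 1) + g1 / real (2 + 2) * u
      + (g2 - g0 / 2) / real (2 + 3) * u ^ 2 + u ^ 3 * hX u)"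
    and Y: "smooth_at hY 0" "\<forall>\<^sub>F u in nhds 0. Y u = u ^ (2 + 2) * (g0 / real (2 + 2) + g1 / real (2 + 3) * u
      + (g2 - g0 / 6) / real (2 + 4) * u ^ 2 + u ^ 3 * hY u)"
    by (rule tangent_angle_expansion[OF E r[folded g0_def g1_def g2_def]])
  show ?thesis
  proof (rule is_4_3_cuspI)
    show "\<forall>\<^sub>F u in nhds 0. E u = E 0 + X u *\<^sub>R tangent_dir \<theta> + Y u *\<^sub>R normal_dir \<theta>"
      using frame by (rule always_eventually)
    show "\<forall>\<^sub>F u in nhds 0. X u = g0 / 3 * u ^ 3 + g1 / 4 * u ^ 4 + (g2 - g0 / 2) / 5 * u ^ 5 + u ^ 6 * hX u"
      using X(2) by eventually_elim (simp add: eval_nat_numeral algebra_simps)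
    show "smooth_at (\<lambda>u. (g2 - g0 / 6) / 6 + u * hY u) 0" by (intro smooth_intros Y(1)) simp
    show "\<forall>\<^sub>F u in nhds 0. Y u = g0 / 4 * u ^ 4 + g1 / 5 * u ^ 5 + u ^ 6 * ((g2 - g0 / 6) / 6 + u * hY u)"
      using Y(2) by eventually_elim (simp add: eval_nat_numeral algebra_simps)
  qed (use g0 X(1) in simp_all)
qed

lemma tangent_angle_5_4_cusp:
  assumes E: "\<forall>\<^sub>F u in nhds 0. (E has_vector_derivative D u *\<^sub>R tangent_dir (u + \<theta>)) (at u)"
    and D: "smooth_at D 0" "D 0 = 0" "deriv D 0 = 0" "(deriv ^^ 2) D 0 = 0" "(deriv ^^ 3) D 0 \<noteq> 0"
  obtains \<epsilon> where "A_equivalent E (\<lambda>t. (t ^ 4, t ^ 5 + \<epsilon> * t ^ 7))"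
    "35 * ((deriv ^^ 4) D 0)\<^sup>2 - 48 * (deriv ^^ 3) D 0 * (deriv ^^ 5) D 0 + 2400 * ((deriv ^^ 3) D 0)\<^sup>2
      = 8064 * ((deriv ^^ 3) D 0)\<^sup>2 * \<epsilon>"
proof -
  obtain r where r: "smooth_at r 0" "\<forall>\<^sub>F t in nhds 0. D t = t ^ 3 * ((deriv ^^ 3) D 0 / fact 3
    + (deriv ^^ (3 + 1)) D 0 / fact (3 + 1) * t + (deriv ^^ (3 + 2)) D 0 / fact (3 + 2) * t ^ 2 + t ^ 3 * r t)"
  proof (rule higher_deriv_expansion[OF D(1), of 3])
    fix i :: nat assume "i < 3"
    then have "i = 0 \<or> i = 1 \<or> i = 2" by linarith
    then show "(deriv ^^ i) D 0 = 0" using D(2-4) by auto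
  qed
  define g0 g1 g2 where "g0 = (deriv ^^ 3) D 0 / fact 3" and "g1 = (deriv ^^ (3 + 1)) D 0 / fact (3 + 1)"
    and "g2 = (deriv ^^ (3 + 2)) D 0 / fact (3 + 2)"
  have d: "(deriv ^^ 3) D 0 = 6 * g0" "(deriv ^^ 4) D 0 = 24 * g1" "(deriv ^^ 5) D 0 = 120 * g2"
    by (simp_all add: g0_def g1_def g2_def fact_numeral)
  have g0: "g0 \<noteq> 0" using D(5) by (simp add: g0_def)
  obtain X Y hX hY where frame: "\<forall>u. E u = E 0 + X u *\<^sub>R tangent_dir \<theta> + Y u *\<^sub>R normal_dir \<theta>"
    and X: "smooth_at hX 0" "\<forall>\<^sub>F u in nhds 0. X u = u ^ (3 + 1) * (g0 / real (3 + 1) + g1 / real (3 + 2) * u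
      + (g2 - g0 / 2) / real (3 + 3) * u ^ 2 + u ^ 3 * hX u)"
    and Y: "smooth_at hY 0" "\<forall>\<^sub>F u in nhds 0. Y u = u ^ (3 + 2) * (g0 / real (3 + 2) + g1 / real (3 + 3) * u
      + (g2 - g0 / 6) / real (3 + 4) * u ^ 2 + u ^ 3 * hY u)"
    by (rule tangent_angle_expansion[OF E r[folded g0_def g1_def g2_def]])
  \<comment> \<open>X is needed one order beyond the displayed coefficients; hX 0 is its coefficient
    of u^7, which \<gamma> will compensate.\<close>
  obtain k where k: "smooth_at k 0" "\<forall>\<^sub>F u in nhds 0. hX u = hX 0 + u * k u"
    by (rule smooth_at_hadamard[OF X(1)])
  \<comment> \<open>\<alpha>, \<beta> and \<epsilon> solve the three equations of
    \<open>A_equivalent_5_4\<close> with x0 = g0/4, x1 = g1/5, y0 = g0/5, y1 = g1/6 and the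
    corrected third coefficients.\<close>
  define \<alpha> where "\<alpha> = - g1 / (6 * g0)"
  define \<beta> where "\<beta> = - (6 * \<alpha>\<^sup>2 * (g0 / 4) + 5 * \<alpha> * (g1 / 5) + (g2 - g0 / 2) / 6) / g0"
  define \<epsilon> where "\<epsilon> = (g0 / 5 * (5 * \<beta> + 10 * \<alpha>\<^sup>2) + 6 * \<alpha> * (g1 / 6) + (g2 - g0 / 6) / 7) / (g0 / 5)"
  have \<alpha>: "6 * g0 * \<alpha> = - g1" using g0 by (simp add: \<alpha>_def)
  have \<beta>: "g0 * \<beta> = - (6 * \<alpha>\<^sup>2 * (g0 / 4) + 5 * \<alpha> * (g1 / 5) + (g2 - g0 / 2) / 6)"
    using g0 by (simp add: \<beta>_def)
  have \<epsilon>: "\<epsilon> * (g0 / 5) = g0 / 5 * (5 * \<beta> + 10 * \<alpha>\<^sup>2) + 6 * \<alpha> * (g1 / 6) + (g2 - g0 / 6) / 7"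
    using g0 by (simp add: \<epsilon>_def)
  show thesis
  proof (rule that)
    show "A_equivalent E (\<lambda>t. (t ^ 4, t ^ 5 + \<epsilon> * t ^ 7))"
    proof (rule A_equivalent_5_4)
      show "\<forall>\<^sub>F u in nhds 0. E u = E 0 + X u *\<^sub>R tangent_dir \<theta> + Y u *\<^sub>R normal_dir \<theta>"
        using frame by (rule always_eventually)
      show "\<forall>\<^sub>F u in nhds 0. X u = g0 / 4 * u ^ 4 + g1 / 5 * u ^ 5 + (g2 - g0 / 2) / 6 * u ^ 6 + hX 0 * u ^ 7 + u ^ 8 * k u"
        using X(2) k(2)
      proof eventually_elim
        case (elim u)
        show ?case unfolding elim(1) elim(2) by (simp add: eval_nat_numeral algebra_simps)
      qed
      show "\<forall>\<^sub>F u in nhds 0. Y u = g0 / 5 * u ^ 5 + g1 / 6 * u ^ 6 + (g2 - g0 / 6) / 7 * u ^ 7 + u ^ 8 * hY u"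
        using Y(2) by eventually_elim (simp add: eval_nat_numeral algebra_simps)
      show "5 * \<alpha> * (g0 / 5) + g1 / 6 = 0" using \<alpha> by (simp add: field_simps)
      show "g0 / 4 * (4 * \<beta> + 6 * \<alpha>\<^sup>2) + 5 * \<alpha> * (g1 / 5) + (g2 - g0 / 2) / 6 = 0"
        using \<beta> by (simp add: algebra_simps)
    qed (use \<epsilon> g0 X(1) Y(1) k(1) in simp_all)
    have g1: "g1 = - 6 * g0 * \<alpha>" using \<alpha> by simp
    have g2: "g2 = g0 / 2 - 6 * g0 * \<beta> - 9 * \<alpha>\<^sup>2 * g0 - 6 * \<alpha> * g1"
      using \<beta> by (simp add: field_simps)
    have "g0 * \<epsilon> = g0 * (5 * \<beta> + 10 * \<alpha>\<^sup>2) + 5 * \<alpha> * g1 + 5 / 7 * (g2 - g0 / 6)"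
      using \<epsilon> by (simp add: field_simps)
    then have e: "g0\<^sup>2 * \<epsilon> = g0 * (g0 * (5 * \<beta> + 10 * \<alpha>\<^sup>2) + 5 * \<alpha> * g1 + 5 / 7 * (g2 - g0 / 6))"
      by (simp add: power2_eq_square)
    \<comment> \<open>The part of \<epsilon> independent of g1 and g2 is 5/12 - 5/42 = 25/84: the
      first summand comes from g0/2 through 5 \<beta>, the second from g0/6. Multiplied by 8064 it
      gives 2400.\<close>
    have "35 * (24 * g1)\<^sup>2 - 48 * (6 * g0) * (120 * g2) + 2400 * (6 * g0)\<^sup>2 = 8064 * 36 * (g0\<^sup>2 * \<epsilon>)"
      unfolding e g2 g1 by (simp add: power2_eq_square field_simps)
    then show "35 * ((deriv ^^ 4) D 0)\<^sup>2 - 48 * (deriv ^^ 3) D 0 * (deriv ^^ 5) D 0 + 2400 * ((deriv ^^ 3) D 0)\<^sup>2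
      = 8064 * ((deriv ^^ 3) D 0)\<^sup>2 * \<epsilon>"
      unfolding d by (simp add: power_mult_distrib)
  qed
qed

theorem theorem3p3:
  fixes \<gamma>p \<gamma>m E :: "real \<Rightarrow> real \<times> real"
    and \<rho>p \<rho>m \<Delta> :: "real \<Rightarrow> real"
    and \<theta>0 Q :: real
  assumes pair: "angularly_regular_parallel_pair \<gamma>p \<gamma>m \<rho>p \<rho>m \<theta>0"
    and base: "\<gamma>p 0 \<noteq> \<gamma>m 0"
    and Delta: "\<Delta> = (\<lambda>u. \<rho>p u - \<rho>m u)"
    and E: "E = wigner_caustic_branch \<gamma>p \<gamma>m"
    and Q: "Q = 35 * ((deriv ^^ 4) \<Delta> 0)\<^sup>2 - 48 * (deriv ^^ 3) \<Delta> 0 * (deriv ^^ 5) \<Delta> 0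
                + 2400 * ((deriv ^^ 3) \<Delta> 0)\<^sup>2"
  shows
    "(\<forall>\<^sub>F u in nhds 0. (E has_vector_derivative (\<Delta> u / 2) *\<^sub>R tangent_dir (u + \<theta>0)) (at u)) \<and>
     cooriented_front E (\<lambda>u. normal_dir (u + \<theta>0)) \<and>
     (regular_at E 0 \<longleftrightarrow> \<Delta> 0 \<noteq> 0) \<and>
     (is_3_2_cusp E \<longleftrightarrow> \<Delta> 0 = 0 \<and> deriv \<Delta> 0 \<noteq> 0) \<and>
     (is_4_3_cusp E \<longleftrightarrow> \<Delta> 0 = 0 \<and> deriv \<Delta> 0 = 0 \<and> (deriv ^^ 2) \<Delta> 0 \<noteq> 0) \<and>
     (\<Delta> 0 = 0 \<and> deriv \<Delta> 0 = 0 \<and> (deriv ^^ 2) \<Delta> 0 = 0 \<and> (deriv ^^ 3) \<Delta> 0 \<noteq> 0 \<longrightarrow>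
        C1_equivalent E (\<lambda>t. (t ^ 4, t ^ 5)) \<and>
        (Q = 0 \<longrightarrow> is_5_4_cusp E) \<and>
        (Q > 0 \<longrightarrow> is_5_4_plus_7_cusp E) \<and>
        (Q < 0 \<longrightarrow> is_5_4_minus_7_cusp E))"
proof -
  have sm: "smooth_at \<gamma>p 0" "smooth_at \<gamma>m 0" "smooth_at \<rho>p 0" "smooth_at \<rho>m 0"
    using pair unfolding angularly_regular_parallel_pair_def angularly_regular_frontal_def
      frontal_with_angle_def cooriented_frontal_def smooth_germ_iff_smooth_at by blast+
  define D where "D u = 1 / 2 * \<Delta> u" for u
  have s\<Delta>: "smooth_at \<Delta> 0" unfolding Delta by (intro smooth_intros sm)
  have sD: "smooth_at D 0" unfolding D_def by (intro smooth_intros s\<Delta>)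
  have sE: "smooth_at E 0" unfolding E wigner_caustic_branch_def by (intro smooth_intros sm)
  have dE: "\<forall>\<^sub>F u in nhds 0. (E has_vector_derivative D u *\<^sub>R tangent_dir (u + \<theta>0)) (at u)"
    using parallel_pair_derivatives[OF pair]
  proof eventually_elim
    case (elim u)
    have "((\<lambda>u. (1 / 2) *\<^sub>R (\<gamma>p u + \<gamma>m u)) has_vector_derivative
        (1 / 2) *\<^sub>R (\<rho>p u *\<^sub>R tangent_dir (u + \<theta>0) + - \<rho>m u *\<^sub>R tangent_dir (u + \<theta>0))) (at u)"
      by (rule bounded_linear.has_vector_derivative[OF bounded_linear_scaleR_right has_vector_derivative_add[OF elim]])
    then show ?case
      unfolding E wigner_caustic_branch_def D_def Delta by (simp add: scaleR_left_diff_distrib[symmetric])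
  qed
  then have dE': "\<forall>\<^sub>F u in nhds 0. (E has_vector_derivative (\<Delta> u / 2) *\<^sub>R tangent_dir (u + \<theta>0)) (at u)"
    by (simp add: D_def)
  have Dd: "(deriv ^^ n) D 0 = 1 / 2 * (deriv ^^ n) \<Delta> 0" for n
    unfolding D_def by (rule eventually_nhds_x_imp_x[OF higher_deriv_cmult[OF s\<Delta>]])
  have D0: "D 0 = 0 \<longleftrightarrow> \<Delta> 0 = 0" "deriv D 0 = 0 \<longleftrightarrow> deriv \<Delta> 0 = 0"
    using Dd[of 0] Dd[of 1] by auto
  have tn: "tangent_dir t \<noteq> 0" "norm (normal_dir t) = 1" "tangent_dir t \<bullet> normal_dir t = 0" for t
    using sin_zero_abs_cos_one[of t]
    by (auto simp: tangent_dir_def normal_dir_def zero_prod_def norm_Pair)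
  have regular: "regular_at E 0 \<longleftrightarrow> \<Delta> 0 \<noteq> 0"
    using eventually_nhds_x_imp_x[OF dE] tn(1)[of "0 + \<theta>0"] D0(1) vector_derivative_unique_at
    unfolding regular_at_def by fastforce
  have sn: "smooth_at (\<lambda>u. normal_dir (u + \<theta>0)) 0"
    unfolding normal_dir_def
    by (intro smooth_intros smooth_at_compose[OF smooth_at_sin _ refl] smooth_at_compose[OF smooth_at_cos _ refl])
  have dn: "((\<lambda>u. normal_dir (u + \<theta>0)) has_vector_derivative - tangent_dir (u + \<theta>0)) (at u)" for u
    unfolding normal_dir_def tangent_dir_def
    by (auto intro!: derivative_eq_intros has_vector_derivative_Pair
        simp flip: has_real_derivative_iff_has_vector_derivative)
  \<comment> \<open>The normal turns with unit speed in the angular parameter, so the pair is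
    immersed even where D vanishes.\<close>
  have front: "cooriented_front E (\<lambda>u. normal_dir (u + \<theta>0))"
    unfolding cooriented_front_def cooriented_frontal_def smooth_germ_iff_smooth_at
  proof (intro conjI sE sn)
    show "\<forall>\<^sub>F t in nhds 0. norm (normal_dir (t + \<theta>0)) = 1 \<and>
        vector_derivative E (at t) \<bullet> normal_dir (t + \<theta>0) = 0"
      using dE by eventually_elim (simp add: tn vector_derivative_at)
    show "\<forall>\<^sub>F t in nhds 0. regular_at (\<lambda>s. (E s, normal_dir (s + \<theta>0))) t"
      using dE
    proof eventually_elim
      case (elim t)
      have "(D t *\<^sub>R tangent_dir (t + \<theta>0), - tangent_dir (t + \<theta>0)) \<noteq> 0"
        using tn(1)[of "t + \<theta>0"] by (simp add: prod_eq_iff)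
      with has_vector_derivative_Pair[OF elim dn] show ?case
        unfolding regular_at_def by blast
    qed
  qed
  have order: "(\<forall>i<m. (deriv ^^ i) \<Delta> 0 = 0) \<and> (deriv ^^ m) \<Delta> 0 \<noteq> 0"
    if "A_equivalent E (\<lambda>t. (t ^ Suc m, t ^ Suc (Suc m)))" for m
    using tangent_angle_monomial_order[OF dE sD smooth_at_isCont[OF sE] that] by (simp add: Dd)
  have Suc_eqs: "Suc 1 = 2" "Suc 2 = 3" "Suc 3 = 4" by simp_all
  have cusp32: "is_3_2_cusp E \<longleftrightarrow> \<Delta> 0 = 0 \<and> deriv \<Delta> 0 \<noteq> 0"
  proof
    assume "is_3_2_cusp E"
    then have "A_equivalent E (\<lambda>t. (t ^ Suc 1, t ^ Suc (Suc 1)))"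
      unfolding is_3_2_cusp_def Suc_eqs .
    from order[OF this] show "\<Delta> 0 = 0 \<and> deriv \<Delta> 0 \<noteq> 0" by simp
  next
    assume "\<Delta> 0 = 0 \<and> deriv \<Delta> 0 \<noteq> 0"
    then show "is_3_2_cusp E" using tangent_angle_3_2_cusp[OF dE sD] D0 by simp
  qed
  have cusp43: "is_4_3_cusp E \<longleftrightarrow> \<Delta> 0 = 0 \<and> deriv \<Delta> 0 = 0 \<and> (deriv ^^ 2) \<Delta> 0 \<noteq> 0"
  proof
    assume "is_4_3_cusp E"
    then have "A_equivalent E (\<lambda>t. (t ^ Suc 2, t ^ Suc (Suc 2)))"
      unfolding is_4_3_cusp_def Suc_eqs .
    from order[OF this] have *: "(deriv ^^ 0) \<Delta> 0 = 0" "(deriv ^^ 1) \<Delta> 0 = 0" "(deriv ^^ 2) \<Delta> 0 \<noteq> 0"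
      by (metis pos2, metis one_less_numeral_iff semiring_norm(76), blast)
    then show "\<Delta> 0 = 0 \<and> deriv \<Delta> 0 = 0 \<and> (deriv ^^ 2) \<Delta> 0 \<noteq> 0" by simp
  next
    assume "\<Delta> 0 = 0 \<and> deriv \<Delta> 0 = 0 \<and> (deriv ^^ 2) \<Delta> 0 \<noteq> 0"
    then show "is_4_3_cusp E" using tangent_angle_4_3_cusp[OF dE sD] D0 Dd[of 2] by simp
  qed
  have cusp54: "C1_equivalent E (\<lambda>t. (t ^ 4, t ^ 5)) \<and> (Q = 0 \<longrightarrow> is_5_4_cusp E) \<and>
      (Q > 0 \<longrightarrow> is_5_4_plus_7_cusp E) \<and> (Q < 0 \<longrightarrow> is_5_4_minus_7_cusp E)"
    if z: "\<Delta> 0 = 0 \<and> deriv \<Delta> 0 = 0 \<and> (deriv ^^ 2) \<Delta> 0 = 0 \<and> (deriv ^^ 3) \<Delta> 0 \<noteq> 0"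
  proof -
    have "D 0 = 0" "deriv D 0 = 0" "(deriv ^^ 2) D 0 = 0" "(deriv ^^ 3) D 0 \<noteq> 0"
      using z D0 Dd[of 2] Dd[of 3] by simp_all
    from tangent_angle_5_4_cusp[OF dE sD this] obtain \<epsilon> where
      equiv: "A_equivalent E (\<lambda>t. (t ^ 4, t ^ 5 + \<epsilon> * t ^ 7))" and
      "35 * ((deriv ^^ 4) D 0)\<^sup>2 - 48 * (deriv ^^ 3) D 0 * (deriv ^^ 5) D 0 + 2400 * ((deriv ^^ 3) D 0)\<^sup>2
        = 8064 * ((deriv ^^ 3) D 0)\<^sup>2 * \<epsilon>" .
    \<comment> \<open>Both sides are homogeneous of degree 2 in the derivatives, so the factor
      between D and \<Delta> cancels.\<close>
    then have "Q = 8064 * ((deriv ^^ 3) \<Delta> 0)\<^sup>2 * \<epsilon>"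
      unfolding Q Dd by (simp add: power_mult_distrib power2_eq_square)
    moreover have "sgn (8064 * ((deriv ^^ 3) \<Delta> 0)\<^sup>2) = 1" using z by (intro sgn_pos) simp
    ultimately have sgn: "sgn Q = sgn \<epsilon>" by (simp only: sgn_mult)
    have "C1_equivalent E (\<lambda>t. (t ^ 4, t ^ 5))"
      using Ck_equivalent_trans[OF Ck_equivalent_mono[OF equiv[unfolded A_equivalent_def], of 1]
          C1_equivalent_5_4[unfolded C1_equivalent_def]]
      by (simp add: C1_equivalent_def)
    moreover have "is_5_4_cusp E" if "Q = 0"
    proof -
      have "\<epsilon> = 0" using sgn that by (simp add: sgn_zero_iff)
      then show ?thesis using equiv by (simp add: is_5_4_cusp_def)
    qed
    moreover have scaled: "A_equivalent E (\<lambda>t. (t ^ 4, t ^ 5 + sgn \<epsilon> * t ^ 7))" if "Q \<noteq> 0"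
    proof -
      have "\<epsilon> \<noteq> 0" using sgn that by (auto simp: sgn_zero_iff)
      from Ck_equivalent_trans[OF equiv[unfolded A_equivalent_def] A_equivalent_5_4_scaling[OF this, unfolded A_equivalent_def]]
      show ?thesis unfolding A_equivalent_def .
    qed
    moreover have "is_5_4_plus_7_cusp E" if "Q > 0"
      using scaled that unfolding sgn[symmetric] by (simp add: is_5_4_plus_7_cusp_def)
    moreover have "is_5_4_minus_7_cusp E" if "Q < 0"
      using scaled that unfolding sgn[symmetric] by (simp add: is_5_4_minus_7_cusp_def)
    ultimately show ?thesis by blast
  qed
  show ?thesis using dE' front regular cusp32 cusp43 cusp54 by blast
qed


end
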